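(* Let $H$ be a finite group and let $\alpha,\beta$ be integers with $0<\alpha<\beta$. Let $s(n)$ be the number of solutions of $X^\alpha=X^\beta$ in $H\wr T_n$. Then, as $n\to\infty$, $$s(n)\sim\frac{1}{r_n^n\sqrt{(\beta-\alpha)\,\Delta_1(|H|r_n)\Delta_2(|H|r_n)\cdots\Delta_{\alpha-1}(|H|r_n)\,\log^{(\alpha-1)}\!\big(\tfrac1{\beta-\alpha}\log n\big)}}$$ $$\times\exp\!\bigg(\Big(\frac{\Delta_\alpha(|H|r_n)}{(\beta-\alpha)|H|r_n\Delta_\alpha'(|H|r_n)}+\log n-1\Big)n+\frac1{|H|}\sum_{\gamma\mid\beta-\alpha}\Big(\frac1\gamma-\frac1{\beta-\alpha}\Big)\iota_H\big(\tfrac{\beta-\alpha}\gamma\big)\big(\Delta_\alpha(|H|r_n)\big)^\gamma\bigg),$$ where $r_n$ is the unique positive real solution, for large $n$, of $$r\sum_{\gamma\mid\beta-\alpha}\iota_H\big(\tfrac{\beta-\alpha}\gamma\big)\big(\Delta_\alpha(|H|r)\big)^{\gamma-1}\Delta_\alpha'(|H|r)=n.$$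
   Context: $T_n$ is the full transformation semigroup on $[n]$ (all maps $[n]\to[n]$) with product $(\tau_1\cdot\tau_2)(j)=\tau_2(\tau_1(j))$; $H\wr T_n$ is the set of pairs $(f,\tau)$, $f:[n]\to H$, $\tau\in T_n$, with product $(f_1,\tau_1)(f_2,\tau_2)=(f,\tau_1\cdot\tau_2)$, $f(j)=f_1(j)f_2(\tau_1(j))$. $\iota_H(m)$ is the number of $x\in H$ with $x^m=1$. $\Delta_0(z)=z$, $\Delta_\alpha(z)=z\exp(\Delta_{\alpha-1}(z))$ for $\alpha\ge1$; $\Delta_\alpha'$ is its derivative. $\log^{(0)}(z)=z$ and $\log^{(m)}(z)=\log(\log^{(m-1)}(z))$. *)

theory Defs
  imports
    "HOL-Analysis.Analysis"
    "HOL-Library.Landau_Symbols"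
    "HOL-Algebra.Coset"
begin

text \<open>Maps act on the right: the product \<open>\<tau>\<^sub>1 \<cdot> \<tau>\<^sub>2\<close> first applies \<open>\<tau>\<^sub>1\<close>. Maps on
  \<open>{1..n}\<close> are represented by extensional functions, so that distinct elements of
  the carriers below are distinct maps.\<close>

definition full_transf :: "nat \<Rightarrow> (nat \<Rightarrow> nat) monoid" where
  "full_transf n =
     \<lparr> carrier = {1..n} \<rightarrow>\<^sub>E {1..n},
       mult = (\<lambda>\<tau>\<^sub>1 \<tau>\<^sub>2. \<lambda>j\<in>{1..n}. \<tau>\<^sub>2 (\<tau>\<^sub>1 j)),
       one = (\<lambda>j\<in>{1..n}. j) \<rparr>"

definition wreath_transf ::
    "('a, 'b) monoid_scheme \<Rightarrow> nat \<Rightarrow> ((nat \<Rightarrow> 'a) \<times> (nat \<Rightarrow> nat)) monoid" where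
  "wreath_transf H n =
     \<lparr> carrier = ({1..n} \<rightarrow>\<^sub>E carrier H) \<times> carrier (full_transf n),
       mult = (\<lambda>(f\<^sub>1, \<tau>\<^sub>1) (f\<^sub>2, \<tau>\<^sub>2).
         (\<lambda>j\<in>{1..n}. f\<^sub>1 j \<otimes>\<^bsub>H\<^esub> f\<^sub>2 (\<tau>\<^sub>1 j), \<tau>\<^sub>1 \<otimes>\<^bsub>full_transf n\<^esub> \<tau>\<^sub>2)),
       one = (\<lambda>j\<in>{1..n}. \<one>\<^bsub>H\<^esub>, \<one>\<^bsub>full_transf n\<^esub>) \<rparr>"

lemma monoid_full_transf: "monoid (full_transf n)"
  by (rule monoidI) (auto simp: full_transf_def PiE_iff extensional_def fun_eq_iff)

lemma monoid_wreath_transf: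
  assumes "monoid H"
  shows "monoid (wreath_transf H n)"
proof -
  interpret monoid H by fact
  show ?thesis
    by (rule monoidI)
       (auto simp: wreath_transf_def full_transf_def PiE_iff extensional_def fun_eq_iff m_assoc)
qed

definition num_solutions :: "('a, 'b) monoid_scheme \<Rightarrow> nat \<Rightarrow> nat \<Rightarrow> nat \<Rightarrow> nat" where
  "num_solutions H \<alpha> \<beta> n =
     card {X \<in> carrier (wreath_transf H n).
             X [^]\<^bsub>wreath_transf H n\<^esub> \<alpha> = X [^]\<^bsub>wreath_transf H n\<^esub> \<beta>}"

definition iota :: "('a, 'b) monoid_scheme \<Rightarrow> nat \<Rightarrow> nat" where
  "iota H m = card {x \<in> carrier H. x [^]\<^bsub>H\<^esub> m = \<one>\<^bsub>H\<^esub>}"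

primrec Delta :: "nat \<Rightarrow> real \<Rightarrow> real" where
  "Delta 0 z = z"
| "Delta (Suc \<alpha>) z = z * exp (Delta \<alpha> z)"

definition is_saddle ::
    "('a, 'b) monoid_scheme \<Rightarrow> nat \<Rightarrow> nat \<Rightarrow> nat \<Rightarrow> real \<Rightarrow> bool" where
  "is_saddle H \<alpha> \<beta> n r \<longleftrightarrow> 0 < r \<and>
     r * (\<Sum>\<gamma> | \<gamma> dvd \<beta> - \<alpha>. real (iota H ((\<beta> - \<alpha>) div \<gamma>))
            * Delta \<alpha> (real (order H) * r) ^ (\<gamma> - 1)
            * deriv (Delta \<alpha>) (real (order H) * r)) = real n"

text \<open>Meaningful only when exactly one positive solution exists.\<close>

definition saddle :: "('a, 'b) monoid_scheme \<Rightarrow> nat \<Rightarrow> nat \<Rightarrow> nat \<Rightarrow> real" where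
  "saddle H \<alpha> \<beta> n = (THE r. is_saddle H \<alpha> \<beta> n r)"

end

theory Submission
  imports
    Defs
    "HOL-Complex_Analysis.Complex_Analysis"
    "HOL-Probability.Probability"
    "HOL-Real_Asymp.Real_Asymp"
begin

text \<open>
  With \<open>d = \<beta> - \<alpha>\<close> and \<open>h = |H|\<close>, the exponential generating function of the number of solutions is
  \<open>exp (P z)\<close> where \<open>P z = 1/h \<Sum>\<^bsub>\<gamma> | d\<^esub> \<iota>(d/\<gamma>)/\<gamma> \<Delta>\<^sub>\<alpha>(h z)\<^sup>\<gamma>\<close>: a solution consists of cycles of
  lengths \<open>\<gamma>\<close> dividing \<open>d\<close>, whose cycle product has order dividing \<open>d/\<gamma>\<close>, with rooted trees of
  height at most \<open>\<alpha>\<close> attached and arbitrary labels off the cycles. The saddle point method applies to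
  \<open>exp P\<close> because \<open>P\<close> is entire with nonnegative coefficients. Near the positive axis a cubic Taylor
  estimate suffices. Away from it, \<open>Re \<Delta>\<^sub>k(z) \<le> \<Delta>\<^sub>k(|z|) - (|z| - Re z)\<close> makes the summand
  \<open>\<gamma> = d\<close> lose a definite fraction of its size. The variance \<open>r (r P')'\<close> at the saddle point is
  \<open>\<sim> n d \<Delta>\<^sub>0 \<cdots> \<Delta>\<^bsub>\<alpha>-1\<^esub>\<close>, and \<open>\<Delta>\<^sub>0(h r) = h r \<sim> log\<^bsup>(\<alpha>-1)\<^esup>(log n / d)\<close>.
\<close>

section \<open>The saddle point method\<close>

text \<open>The method needs the sizes of theta P, theta^2 P and theta^3 P on the positive axis,
  where theta = r d/dr. Although P is built from towers of exponentials, these sizes differ only by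
  factors D^o(1), where D is \<open>Delta \<alpha>\<close> at h r: the logarithmic derivative
  \<open>Lam k\<close> of \<open>Delta k\<close> is a polynomial in the lower towers, hence of
  smaller order than every positive power of \<open>Delta k\<close>. So one variable y = D^d
  measures everything, and the width of the central arc can be a fixed power of y. The variance,
  however, must be known up to a factor 1 + o(1); this requires the derivative of \<open>Lam\<close>
  to be smaller than the square of \<open>Lam\<close> by a factor 1/z. The iterated logarithm
  appears because theta P = n gives log n ~ d \<open>Delta (\<alpha> - 1)\<close> at h r, and each
  further logarithm removes one level of the tower. The exponent, in contrast, is exact: the saddle
  point equation turns part of P into a multiple of n. Analysis and counting are kept apart; the
  analytic part works with abstract weights and knows nothing about groups.\<close>

lemma has_integral_Cauchy_coeff:
  fixes f :: "complex \<Rightarrow> complex"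
  assumes holo: "f holomorphic_on UNIV" and F: "f has_fps_expansion F" and r: "r > 0"
  shows "((\<lambda>t. f (of_real r * cis t) * cis (- (real n * t))) has_integral
            2 * of_real pi * fps_nth F n * of_real r ^ n) {-pi..pi}"
proof -
  \<comment> \<open>\<open>circlepath\<close> runs over the angles from 0 to 2 pi, while the saddle
    point t = 0 should lie inside the interval. Passing to u -> f (- u) and shifting the angle by pi
    moves the interval to [-pi, pi]; the sign this causes in the coefficients is cancelled by the
    factor (-1)^n below.\<close>
  define g where "g = (\<lambda>u. f (- u))"
  have g_holo: "g holomorphic_on A" for A
    unfolding g_def using holomorphic_on_compose[OF holomorphic_on_minus[OF holomorphic_on_ident]
        holomorphic_on_subset[OF holo subset_UNIV]]
    by (simp add: o_def)
  have "(f \<circ> uminus) has_fps_expansion (F oo (fps_const (-1) * fps_X))"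
    using has_fps_expansion_cmult_left[OF has_fps_expansion_fps_X, of "-1"]
    by (intro has_fps_expansion_compose F) auto
  then have gF: "g has_fps_expansion (F oo (fps_const (-1) * fps_X))"
    by (simp add: g_def o_def)
  have coeff: "(deriv ^^ n) g 0 / fact n = (-1) ^ n * fps_nth F n"
    using fps_nth_fps_expansion[OF gF, of n] by (simp add: fps_nth_compose_linear)
  have "((\<lambda>u. g u / (u - 0) ^ Suc n) has_contour_integral (2 * pi * \<i>) / fact n * (deriv ^^ n) g 0)
          (circlepath 0 r)"
    using r by (intro Cauchy_has_contour_integral_higher_derivative_circlepath)
      (auto intro!: g_holo holomorphic_on_imp_continuous_on)
  then have "((\<lambda>t. g (0 + r * cis t) / (0 + r * cis t - 0) ^ Suc n * r * \<i> * cis t) has_integral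
       (2 * pi * \<i>) / fact n * (deriv ^^ n) g 0) {0..2 * pi}"
    unfolding circlepath_def by (subst (asm) has_contour_integral_part_circlepath_iff) auto
  then have "((\<lambda>t. g (0 + r * cis (1 * t + pi)) / (0 + r * cis (1 * t + pi) - 0) ^ Suc n * r * \<i> * cis (1 * t + pi))
       has_integral ((2 * pi * \<i>) / fact n * (deriv ^^ n) g 0)) {-pi..pi}"
    using has_integral_affinity[where m = 1 and c = pi and a = 0 and b = "2 * pi"] by fastforce
  then have "((\<lambda>t. (g (0 + r * cis (1 * t + pi)) / (0 + r * cis (1 * t + pi) - 0) ^ Suc n * r * \<i> * cis (1 * t + pi)) * ((-1) ^ n * of_real r ^ n / \<i>))
       has_integral ((2 * pi * \<i>) / fact n * (deriv ^^ n) g 0) * ((-1) ^ n * of_real r ^ n / \<i>)) {-pi..pi}"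
    by (rule has_integral_mult_left)
  moreover have "((2 * pi * \<i>) / fact n * (deriv ^^ n) g 0) * ((-1) ^ n * of_real r ^ n / \<i>)
      = 2 * of_real pi * fps_nth F n * of_real r ^ n"
  proof -
    have "((2 * pi * \<i>) / fact n * (deriv ^^ n) g 0) = (2 * pi * \<i>) * ((-1) ^ n * fps_nth F n)"
      using coeff by (simp add: field_simps)
    then show ?thesis
      by (simp add: field_simps flip: power_mult_distrib)
  qed
  moreover have "(g (0 + r * cis (1 * t + pi)) / (0 + r * cis (1 * t + pi) - 0) ^ Suc n * r * \<i> * cis (1 * t + pi)) * ((-1) ^ n * of_real r ^ n / \<i>)
     = f (of_real r * cis t) * cis (- (real n * t))" for t
  proof -
    have 1: "cis (1 * t + pi) = - cis t"
      by (simp add: cis_mult[symmetric])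
    have 2: "cis (- (real n * t)) = inverse (cis t ^ n)"
      by (simp add: Complex.DeMoivre cis_inverse)
    have "(- (r * cis t)) ^ n = (-1) ^ n * (of_real r ^ n * cis t ^ n)"
      using power_mult_distrib[of "-1" "r * cis t" n] by (simp add: power_mult_distrib)
    then show ?thesis
      unfolding 1 2 g_def using r by (simp add: field_simps flip: power_mult_distrib)
  qed
  ultimately show ?thesis by simp
qed

text \<open>The Taylor remainder of \<open>iexp (k t)\<close> is estimated term by term. Because the
  coefficients are nonnegative, the moduli of the errors add up to the third moment c at the
  positive point r itself.\<close>

lemma cmod_power_series_cubic_approx:
  fixes p :: "nat \<Rightarrow> real" and P :: "complex \<Rightarrow> complex"
  assumes p: "\<And>k. p k \<ge> 0" and P: "\<And>z. (\<lambda>k. of_real (p k) * z ^ k) sums P z" and r: "r \<ge> 0"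
    and a: "(\<lambda>k. real k * (p k * r ^ k)) sums a"
    and b: "(\<lambda>k. real k ^ 2 * (p k * r ^ k)) sums b"
    and c: "(\<lambda>k. real k ^ 3 * (p k * r ^ k)) sums c"
  shows "cmod (P (of_real r * cis t) - P (of_real r) - \<i> * of_real (t * a) + of_real (b * t\<^sup>2 / 2))
           \<le> c * \<bar>t\<bar> ^ 3 / 6"
proof -
  define e where "e = (\<lambda>x. iexp x - (\<Sum>k\<le>2. (\<i> * of_real x) ^ k / fact k))"
  have e: "e x = iexp x - 1 - \<i> * of_real x + of_real (x\<^sup>2 / 2)" for x :: real
    by (simp add: e_def numeral_2_eq_2 power2_eq_square algebra_simps)
  define g where "g = (\<lambda>k. of_real (p k * r ^ k) * e (real k * t))"
  have sa: "(\<lambda>k. complex_of_real (real k * (p k * r ^ k))) sums of_real a"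
    using a by (rule sums_of_real)
  have sb: "(\<lambda>k. complex_of_real (real k ^ 2 * (p k * r ^ k))) sums of_real b"
    using b by (rule sums_of_real)
  have "(\<lambda>k. of_real (p k) * (of_real r * cis t) ^ k - of_real (p k) * of_real r ^ k
          - (\<i> * of_real t) * of_real (real k * (p k * r ^ k))
          + (of_real (t\<^sup>2 / 2)) * of_real (real k ^ 2 * (p k * r ^ k)))
       sums (P (of_real r * cis t) - P (of_real r) - (\<i> * of_real t) * of_real a + of_real (t\<^sup>2 / 2) * of_real b)"
    by (intro sums_add sums_diff P sums_mult sa sb)
  also have "(\<lambda>k. of_real (p k) * (of_real r * cis t) ^ k - of_real (p k) * of_real r ^ k
          - (\<i> * of_real t) * of_real (real k * (p k * r ^ k))
          + (of_real (t\<^sup>2 / 2)) * of_real (real k ^ 2 * (p k * r ^ k))) = g"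
  proof (rule ext)
    fix k
    have "iexp (real k * t) = cis t ^ k"
      using Complex.DeMoivre[of t k] by (simp only: cis_conv_exp)
    then show "of_real (p k) * (of_real r * cis t) ^ k - of_real (p k) * of_real r ^ k
          - (\<i> * of_real t) * of_real (real k * (p k * r ^ k))
          + (of_real (t\<^sup>2 / 2)) * of_real (real k ^ 2 * (p k * r ^ k)) = g k"
      by (simp add: g_def e algebra_simps power_mult_distrib)
  qed
  finally have g: "g sums (P (of_real r * cis t) - P (of_real r) - \<i> * of_real (t * a) + of_real (b * t\<^sup>2 / 2))"
    by (simp add: mult_ac)
  have "(\<lambda>k. real k ^ 3 * (p k * r ^ k) * (\<bar>t\<bar> ^ 3 / 6)) sums (c * (\<bar>t\<bar> ^ 3 / 6))"
    by (intro sums_mult2 c)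
  moreover have bound: "cmod (g k) \<le> real k ^ 3 * (p k * r ^ k) * (\<bar>t\<bar> ^ 3 / 6)" for k
  proof -
    have "cmod (g k) = p k * r ^ k * cmod (e (real k * t))"
      using p r by (simp add: g_def norm_mult norm_power)
    also have "\<dots> \<le> p k * r ^ k * (\<bar>real k * t\<bar> ^ 3 / 6)"
      using p r iexp_approx1[of "real k * t" 2]
      by (intro mult_left_mono) (auto simp add: e_def numeral_3_eq_3 fact_numeral)
    also have "p k * r ^ k * (\<bar>real k * t\<bar> ^ 3 / 6) = real k ^ 3 * (p k * r ^ k) * (\<bar>t\<bar> ^ 3 / 6)"
      by (simp add: abs_mult power_mult_distrib)
    finally show ?thesis .
  qed
  ultimately have "cmod (suminf g) \<le> c * (\<bar>t\<bar> ^ 3 / 6)"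
    using norm_suminf_le[of g, OF bound] by (simp add: sums_iff)
  then show ?thesis
    using g by (simp add: sums_iff)
qed

text \<open>Laplace's method for the Cauchy integral. The saddle point equation cancels the linear
  term in t, leaving a Gaussian of width 1 / sqrt b. The three limits say that the central arc |t|
  \<le> \<delta> covers many such widths, that the cubic error is negligible on it, and that the
  outer arc is negligible against a central integral of order 1 / sqrt b.\<close>

theorem saddle_point_asymptotics:
  fixes p :: "nat \<Rightarrow> real" and P :: "complex \<Rightarrow> complex" and r b c \<delta> \<epsilon> :: "nat \<Rightarrow> real"
  assumes p: "\<And>k. p k \<ge> 0" and P: "\<And>z. (\<lambda>k. of_real (p k) * z ^ k) sums P z"
    and F: "(\<lambda>z. exp (P z)) has_fps_expansion F"
    and r: "eventually (\<lambda>n. r n > 0) sequentially"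
    and saddle: "eventually (\<lambda>n. (\<lambda>k. real k * (p k * r n ^ k)) sums real n) sequentially"
    and b: "eventually (\<lambda>n. (\<lambda>k. real k ^ 2 * (p k * r n ^ k)) sums b n) sequentially"
    and c: "eventually (\<lambda>n. (\<lambda>k. real k ^ 3 * (p k * r n ^ k)) sums c n) sequentially"
    and b_pos: "eventually (\<lambda>n. b n > 0) sequentially"
    and \<delta>: "eventually (\<lambda>n. 0 < \<delta> n \<and> \<delta> n \<le> pi) sequentially"
    and b_\<delta>: "filterlim (\<lambda>n. \<delta> n * sqrt (b n)) at_top sequentially"
    and c_\<delta>: "(\<lambda>n. c n * \<delta> n ^ 3) \<longlonglongrightarrow> 0"
    and tail: "eventually (\<lambda>n. \<forall>t. \<delta> n \<le> \<bar>t\<bar> \<longrightarrow> \<bar>t\<bar> \<le> pi \<longrightarrow>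
                 cmod (exp (P (of_real (r n) * cis t))) \<le> \<epsilon> n * exp (Re (P (of_real (r n))))) sequentially"
    and \<epsilon>: "(\<lambda>n. sqrt (b n) * \<epsilon> n) \<longlonglongrightarrow> 0"
  shows "(\<lambda>n. Re (fps_nth F n) * r n ^ n * sqrt (2 * pi * b n) / exp (Re (P (of_real (r n))))) \<longlonglongrightarrow> 1"
proof -
  \<comment> \<open>\<open>K\<close> is the Cauchy integrand divided by its value at t = 0.
    \<open>G\<close> is its central part, rescaled to unit variance and extended by zero, so that
    all \<open>G n\<close> live on the whole line and dominated convergence applies.\<close>
  define K where "K = (\<lambda>n t. exp (P (of_real (r n) * cis t) - P (of_real (r n))) * cis (- (real n * t)))"
  define G where "G = (\<lambda>n t. if \<bar>t\<bar> \<le> \<delta> n * sqrt (b n) then K n (t / sqrt (b n)) else 0)"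
  \<comment> \<open>The condition \<open>c n * \<delta> n ^ 3 < 1\<close> bounds the real part of
    the cubic error by 1; this is where the factor \<open>exp 1\<close> of the dominating function
    comes from.\<close>
  define good where "good = (\<lambda>n. r n > 0 \<and> (\<lambda>k. real k * (p k * r n ^ k)) sums real n \<and>
     (\<lambda>k. real k ^ 2 * (p k * r n ^ k)) sums b n \<and> (\<lambda>k. real k ^ 3 * (p k * r n ^ k)) sums c n \<and>
     b n > 0 \<and> 0 < \<delta> n \<and> \<delta> n \<le> pi \<and> c n * \<delta> n ^ 3 < 1 \<and>
     (\<forall>t. \<delta> n \<le> \<bar>t\<bar> \<longrightarrow> \<bar>t\<bar> \<le> pi \<longrightarrow>
                 cmod (exp (P (of_real (r n) * cis t))) \<le> \<epsilon> n * exp (Re (P (of_real (r n))))))"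
  have "eventually (\<lambda>n. c n * \<delta> n ^ 3 < 1) sequentially"
    using order_tendstoD(2)[OF c_\<delta>, of 1] by simp
  then have ev_good: "eventually good sequentially"
    using r saddle b c b_pos \<delta> tail unfolding good_def by eventually_elim auto
  have summ: "summable (\<lambda>k. of_real (p k) * z ^ k)" for z :: complex
    using P sums_summable by blast
  have P_eq: "P = (\<lambda>z. \<Sum>k. of_real (p k) * z ^ k)"
    using P by (auto simp: sums_iff fun_eq_iff)
  have P_holo: "P holomorphic_on A" for A
  proof -
    have "P field_differentiable (at z)" for z
      unfolding P_eq field_differentiable_def
      by (rule exI, rule termdiffs_strong_converges_everywhere[OF summ])
    then show ?thesis
      by (simp add: holomorphic_on_def field_differentiable_at_within)
  qed
  have P_real: "P (of_real x) = of_real (Re (P (of_real x)))" for x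
  proof -
    have "(\<lambda>k. complex_of_real (p k * x ^ k)) sums P (of_real x)"
      using P[of "of_real x"] by simp
    then have "(\<lambda>k. Im (complex_of_real (p k * x ^ k))) sums Im (P (of_real x))"
      by (rule sums_Im)
    then have "Im (P (of_real x)) = 0"
      using sums_unique2[OF _ sums_zero] by simp
    then show ?thesis
      by (simp add: complex_eq_iff)
  qed
  have K_cont: "continuous_on A (K n)" for A n
    unfolding K_def
    by (intro continuous_intros continuous_on_compose2[OF holomorphic_on_imp_continuous_on[OF P_holo[of UNIV]]]) auto
  have K_int: "K n integrable_on {x..y}" for n x y
    by (intro integrable_continuous_interval K_cont)
  have K_approx: "\<exists>R. K n t = exp (- of_real (b n * t\<^sup>2 / 2) + R) \<and> cmod R \<le> c n * \<bar>t\<bar> ^ 3 / 6"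
    if "good n" for n t
  proof -
    define R where "R = P (of_real (r n) * cis t) - P (of_real (r n)) - \<i> * of_real (t * real n) + of_real (b n * t\<^sup>2 / 2)"
    have "cmod R \<le> c n * \<bar>t\<bar> ^ 3 / 6"
      using that p P unfolding R_def good_def
      by (intro cmod_power_series_cubic_approx[where p = p]) auto
    moreover have "K n t = exp (- of_real (b n * t\<^sup>2 / 2) + R)"
    proof -
      have eq: "- of_real (b n * t\<^sup>2 / 2) + R =
          (P (of_real (r n) * cis t) - P (of_real (r n))) + \<i> * of_real (- (real n * t))"
        by (simp add: R_def)
      show ?thesis
        unfolding eq exp_add K_def cis_conv_exp ..
    qed
    ultimately show ?thesis by blast
  qed
  have c_nonneg: "c n \<ge> 0" if "good n" for n
  proof (rule sums_le[OF _ sums_zero])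
    show "(\<lambda>k. real k ^ 3 * (p k * r n ^ k)) sums c n"
      using that by (simp add: good_def)
    show "0 \<le> real k ^ 3 * (p k * r n ^ k)" for k
      using that p by (simp add: good_def)
  qed
  have G_bound: "cmod (G n t) \<le> exp 1 * exp (- t\<^sup>2 / 2)" if gn: "good n" for n t
  proof (cases "\<bar>t\<bar> \<le> \<delta> n * sqrt (b n)")
    case True
    obtain R where R: "K n (t / sqrt (b n)) = exp (- of_real (b n * (t / sqrt (b n))\<^sup>2 / 2) + R)"
        "cmod R \<le> c n * \<bar>t / sqrt (b n)\<bar> ^ 3 / 6"
      using K_approx[OF gn] by blast
    have bn: "b n > 0" "\<delta> n > 0" using gn by (auto simp: good_def)
    have le: "\<bar>t / sqrt (b n)\<bar> \<le> \<delta> n" using True bn by (simp add: field_simps)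
    have "cmod R \<le> c n * \<delta> n ^ 3"
    proof -
      have "c n * \<bar>t / sqrt (b n)\<bar> ^ 3 / 6 \<le> c n * \<bar>t / sqrt (b n)\<bar> ^ 3"
        using c_nonneg[OF gn] by simp
      also have "\<dots> \<le> c n * \<delta> n ^ 3"
        using le c_nonneg[OF gn] by (intro mult_left_mono power_mono) auto
      finally show ?thesis using R(2) by linarith
    qed
    then have "Re R \<le> 1"
      using complex_Re_le_cmod[of R] gn by (auto simp: good_def)
    moreover have "b n * (t / sqrt (b n))\<^sup>2 = t\<^sup>2"
      using bn by (simp add: power_divide)
    ultimately have "cmod (G n t) = exp (- t\<^sup>2 / 2 + Re R)"
      using True by (simp add: G_def R(1))
    also have "\<dots> \<le> exp (1 + - t\<^sup>2 / 2)"
      using \<open>Re R \<le> 1\<close> by simp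
    finally show ?thesis by (simp only: exp_add)
  next
    case False
    then show ?thesis by (simp add: G_def)
  qed
  have G_lim: "(\<lambda>n. G n t) \<longlonglongrightarrow> of_real (exp (- t\<^sup>2 / 2))" for t
  proof -
    define R where "R = (\<lambda>n. SOME R. K n (t / sqrt (b n)) = exp (- of_real (b n * (t / sqrt (b n))\<^sup>2 / 2) + R) \<and>
        cmod R \<le> c n * \<bar>t / sqrt (b n)\<bar> ^ 3 / 6)"
    have R: "K n (t / sqrt (b n)) = exp (- of_real (b n * (t / sqrt (b n))\<^sup>2 / 2) + R n)"
        "cmod (R n) \<le> c n * \<bar>t / sqrt (b n)\<bar> ^ 3 / 6" if "good n" for n
      using someI_ex[OF K_approx[OF that, of "t / sqrt (b n)"]] unfolding R_def by auto
    have ev: "eventually (\<lambda>n. \<bar>t\<bar> \<le> \<delta> n * sqrt (b n)) sequentially"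
      using b_\<delta> unfolding filterlim_at_top by blast
    have "eventually (\<lambda>n. cmod (R n) \<le> c n * \<delta> n ^ 3) sequentially"
      using ev ev_good
    proof eventually_elim
      case (elim n)
      have bn: "b n > 0" "\<delta> n > 0" using elim by (auto simp: good_def)
      have le: "\<bar>t / sqrt (b n)\<bar> \<le> \<delta> n" using elim bn by (simp add: field_simps)
      have "c n * \<bar>t / sqrt (b n)\<bar> ^ 3 / 6 \<le> c n * \<bar>t / sqrt (b n)\<bar> ^ 3"
        using c_nonneg elim by simp
      also have "\<dots> \<le> c n * \<delta> n ^ 3"
        using le c_nonneg elim by (intro mult_left_mono power_mono) auto
      finally show ?case using R(2)[OF elim(2)] by linarith
    qed
    then have "R \<longlonglongrightarrow> 0"
      using c_\<delta> by (rule Lim_null_comparison)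
    then have "(\<lambda>n. exp (- of_real (t\<^sup>2 / 2) + R n)) \<longlonglongrightarrow> exp (- of_real (t\<^sup>2 / 2) + 0)"
      by (intro tendsto_intros)
    moreover have "eventually (\<lambda>n. exp (- of_real (t\<^sup>2 / 2) + R n) = G n t) sequentially"
      using ev ev_good
    proof eventually_elim
      case (elim n)
      then have "b n * (t / sqrt (b n))\<^sup>2 = t\<^sup>2"
        by (simp add: power_divide good_def)
      then show ?case using R(1)[OF elim(2)] elim by (simp add: G_def)
    qed
    ultimately show ?thesis
      by (simp add: tendsto_cong exp_of_real[symmetric])
  qed
  have gauss_real: "((\<lambda>t::real. exp (- t\<^sup>2 / 2)) has_integral sqrt (2 * pi)) UNIV"
  proof -
    have "((\<lambda>t::real. std_normal_density t * sqrt (2 * pi)) has_integral 1 * sqrt (2 * pi)) UNIV"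
      using has_integral_integral_lborel[of "std_normal_density"] integrable_normal_density[of 1 0]
        integral_normal_density[of 1 0]
      by (intro has_integral_mult_left) auto
    then show ?thesis
      by (simp add: normal_density_def)
  qed
  have gauss: "((\<lambda>t. complex_of_real (exp (- t\<^sup>2 / 2))) has_integral of_real (sqrt (2 * pi))) UNIV"
    using has_integral_linear[OF gauss_real bounded_linear_of_real[where 'a = complex]]
    by (simp add: o_def)
  have gauss_int: "(\<lambda>t::real. exp 1 * exp (- t\<^sup>2 / 2)) integrable_on UNIV"
    by (rule has_integral_integrable[OF has_integral_mult_right[OF gauss_real]])
  have G_int: "G n integrable_on UNIV"
    and G_integral: "integral UNIV (G n) = of_real (sqrt (b n)) * integral {-\<delta> n..\<delta> n} (K n)"
    if "good n" for n
  proof -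
    have bn: "b n > 0" "\<delta> n > 0" using that by (auto simp: good_def)
    have "(K n has_integral integral {-\<delta> n..\<delta> n} (K n)) (cbox (- \<delta> n) (\<delta> n))"
      using K_int by (simp add: has_integral_integrable_integral)
    from has_integral_affinity'[OF this, of "1 / sqrt (b n)" 0]
    have "((\<lambda>t. K n (t / sqrt (b n))) has_integral of_real (sqrt (b n)) * integral {-\<delta> n..\<delta> n} (K n))
        {- (\<delta> n * sqrt (b n))..\<delta> n * sqrt (b n)}"
      using bn by (simp add: field_simps scaleR_conv_of_real)
    then have "(G n has_integral of_real (sqrt (b n)) * integral {-\<delta> n..\<delta> n} (K n)) UNIV"
      unfolding G_def by (subst (asm) has_integral_restrict_UNIV[symmetric]) (simp add: abs_le_iff minus_le_iff conj_commute)
    then show "G n integrable_on UNIV"  "integral UNIV (G n) = of_real (sqrt (b n)) * integral {-\<delta> n..\<delta> n} (K n)"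
      by (auto simp: integral_unique)
  qed
  \<comment> \<open>Dominated convergence wants integrability and the bound for every index, while
    they hold only eventually; hence the shift by \<open>N\<close>.\<close>
  obtain N where N: "\<And>n. n \<ge> N \<Longrightarrow> good n"
    using ev_good unfolding eventually_sequentially by blast
  have "(\<lambda>n. integral UNIV (G (n + N))) \<longlonglongrightarrow> integral UNIV (\<lambda>t. complex_of_real (exp (- t\<^sup>2 / 2)))"
    using N G_int G_bound LIMSEQ_ignore_initial_segment[OF G_lim] gauss_int
    by (intro dominated_convergence(2)[where h = "\<lambda>t. exp 1 * exp (- t\<^sup>2 / 2)"]) auto
  then have "(\<lambda>n. integral UNIV (G n)) \<longlonglongrightarrow> of_real (sqrt (2 * pi))"
    unfolding integral_unique[OF gauss] by (rule LIMSEQ_offset)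
  then have central: "(\<lambda>n. of_real (sqrt (b n)) * integral {-\<delta> n..\<delta> n} (K n)) \<longlonglongrightarrow> of_real (sqrt (2 * pi))"
    by (rule Lim_transform_eventually) (rule eventually_mono[OF ev_good G_integral])
  have rest_bound: "cmod (of_real (sqrt (b n)) * (integral {-pi..pi} (K n) - integral {-\<delta> n..\<delta> n} (K n)))
       \<le> 2 * pi * (sqrt (b n) * \<epsilon> n)" if "good n" for n
  proof -
    have bn: "b n > 0" "\<delta> n > 0" "\<delta> n \<le> pi" using that by (auto simp: good_def)
    have K_le: "cmod (K n t) \<le> \<epsilon> n" if "\<delta> n \<le> \<bar>t\<bar>" "\<bar>t\<bar> \<le> pi" for t
      using \<open>good n\<close> that by (simp add: K_def norm_mult exp_diff norm_divide good_def divide_le_eq)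
    \<comment> \<open>The tail bound at t = pi forces this sign.\<close>
    have "\<epsilon> n \<ge> 0" using order_trans[OF norm_ge_zero K_le[of pi]] bn by auto
    have "cmod (integral {-pi..-\<delta> n} (K n)) \<le> \<epsilon> n * (- \<delta> n - (- pi))"
      using bn by (intro integral_bound K_cont K_le) auto
    moreover have "cmod (integral {\<delta> n..pi} (K n)) \<le> \<epsilon> n * (pi - \<delta> n)"
      using bn by (intro integral_bound K_cont K_le) auto
    moreover have "integral {-pi..pi} (K n) =
        integral {-pi..-\<delta> n} (K n) + (integral {-\<delta> n..\<delta> n} (K n) + integral {\<delta> n..pi} (K n))"
      using bn Henstock_Kurzweil_Integration.integral_combine[where a = "- pi" and c = "- \<delta> n" and b = pi and f = "K n"]
        Henstock_Kurzweil_Integration.integral_combine[where a = "- \<delta> n" and c = "\<delta> n" and b = pi and f = "K n"]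
      by (simp add: K_int)
    ultimately have "cmod (integral {-pi..pi} (K n) - integral {-\<delta> n..\<delta> n} (K n)) \<le> \<epsilon> n * (- \<delta> n - (- pi)) + \<epsilon> n * (pi - \<delta> n)"
      using norm_triangle_mono by fastforce
    also have "\<dots> = 2 * \<epsilon> n * (pi - \<delta> n)" by (simp add: algebra_simps)
    also have "\<dots> \<le> 2 * \<epsilon> n * pi"
      using bn \<open>\<epsilon> n \<ge> 0\<close> by (intro mult_left_mono) auto
    finally show ?thesis
      using bn by (simp add: norm_mult mult_ac mult_left_mono)
  qed
  have "(\<lambda>n. of_real (sqrt (b n)) * (integral {-pi..pi} (K n) - integral {-\<delta> n..\<delta> n} (K n))) \<longlonglongrightarrow> 0"
  proof (rule Lim_null_comparison)
    show "(\<lambda>n. 2 * pi * (sqrt (b n) * \<epsilon> n)) \<longlonglongrightarrow> 0"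
      using tendsto_mult[OF tendsto_const \<epsilon>, of "2 * pi"] by simp
  qed (rule eventually_mono[OF ev_good rest_bound])
  from tendsto_add[OF central this]
  have "(\<lambda>n. of_real (sqrt (b n)) * integral {-pi..pi} (K n)) \<longlonglongrightarrow> of_real (sqrt (2 * pi))"
    by (simp add: algebra_simps)
  from tendsto_Re[OF this] have lim: "(\<lambda>n. sqrt (b n) * Re (integral {-pi..pi} (K n)) / sqrt (2 * pi)) \<longlonglongrightarrow> sqrt (2 * pi) / sqrt (2 * pi)"
    by (intro tendsto_intros) auto
  have "(\<lambda>n. sqrt (b n) * Re (integral {-pi..pi} (K n)) / sqrt (2 * pi)) \<longlonglongrightarrow> 1"
    using lim by simp
  then show ?thesis
  proof (rule Lim_transform_eventually)
    show "\<forall>\<^sub>F n in sequentially. sqrt (b n) * Re (integral {-pi..pi} (K n)) / sqrt (2 * pi) =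
       Re (fps_nth F n) * r n ^ n * sqrt (2 * pi * b n) / exp (Re (P (of_real (r n))))"
      using ev_good
    proof eventually_elim
      case (elim n)
      have "((\<lambda>t. exp (P (of_real (r n) * cis t)) * cis (- (real n * t))) has_integral
              2 * of_real pi * fps_nth F n * of_real (r n) ^ n) {-pi..pi}"
        using elim by (intro has_integral_Cauchy_coeff F holomorphic_on_exp' P_holo) (auto simp: good_def)
      from has_integral_mult_left[OF this, of "exp (- P (of_real (r n)))"]
      have "integral {-pi..pi} (K n) = 2 * of_real pi * fps_nth F n * of_real (r n) ^ n * exp (- P (of_real (r n)))"
        by (intro integral_unique) (simp add: K_def exp_diff exp_minus field_simps)
      also have "\<dots> = of_real (2 * pi * r n ^ n * exp (- Re (P (of_real (r n))))) * fps_nth F n"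
        by (subst P_real) (simp add: exp_of_real[symmetric])
      finally have "Re (integral {-pi..pi} (K n)) = 2 * pi * r n ^ n * exp (- Re (P (of_real (r n)))) * Re (fps_nth F n)"
        by simp
      moreover have "sqrt (2 * pi * b n) = sqrt (2 * pi) * sqrt (b n)"
        by (rule real_sqrt_mult)
      moreover have "2 * pi / sqrt (2 * pi) = sqrt (2 * pi)"
        by (simp add: real_div_sqrt)
      ultimately show ?case
        by (simp add: exp_minus divide_simps)
    qed
  qed
qed

section \<open>Growth of the iterated exponentials\<close>

text \<open>Termwise differentiation followed by multiplication with z turns the coefficients p k
  into k p k and restores the exponents, so the lemma can be iterated. Three applications identify
  closed forms of theta P, theta^2 P and theta^3 P with the moments that the saddle point method
  asks for.\<close>

lemma sums_theta_power_series:
  fixes p :: "nat \<Rightarrow> real" and f g :: "real \<Rightarrow> real"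
  assumes f: "\<And>z. z > 0 \<Longrightarrow> (\<lambda>k. p k * z ^ k) sums f z"
    and f': "\<And>z. z > 0 \<Longrightarrow> (f has_real_derivative g z / z) (at z)" and z: "z > 0"
  shows "(\<lambda>k. real k * (p k * z ^ k)) sums g z"
proof -
  have summ: "summable (\<lambda>k. p k * y ^ k)" for y :: real
    using powser_inside[OF sums_summable[OF f[of "\<bar>y\<bar> + 1"]], of y] by auto
  have "((\<lambda>x. \<Sum>k. p k * x ^ k) has_real_derivative (\<Sum>k. diffs p k * z ^ k)) (at z)"
    by (rule termdiffs_strong_converges_everywhere[OF summ])
  moreover have "((\<lambda>x. \<Sum>k. p k * x ^ k) has_real_derivative g z / z) (at z)"
  proof (rule has_field_derivative_transform_within_open[OF f'[OF z]])
    show "open {0::real<..}" "z \<in> {0::real<..}" using z by auto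
    show "\<And>x. x \<in> {0<..} \<Longrightarrow> f x = (\<Sum>k. p k * x ^ k)"
      using f by (auto simp: sums_iff)
  qed
  ultimately have "(\<Sum>k. diffs p k * z ^ k) = g z / z"
    by (rule DERIV_unique)
  moreover have "summable (\<lambda>k. diffs p k * z ^ k)"
    by (rule termdiff_converges_all[OF summ])
  ultimately have "(\<lambda>k. diffs p k * z ^ k) sums (g z / z)"
    by (simp add: sums_iff)
  then have "(\<lambda>k. z * (diffs p k * z ^ k)) sums (z * (g z / z))"
    by (rule sums_mult)
  then have "(\<lambda>k. real (Suc k) * (p (Suc k) * z ^ Suc k)) sums g z"
    using z by (simp add: diffs_def mult_ac)
  from sums_Suc[where f = "\<lambda>k. real k * (p k * z ^ k)", OF this] show ?thesis by simp
qed

text \<open>In terms of \<open>\<theta> = z d/dz\<close>: \<open>Lam k = \<theta> \<Delta>\<^sub>k / \<Delta>\<^sub>k\<close>, \<open>Lam1 k = \<theta> (Lam k)\<close> and \<open>Lam2 k = \<theta>\<^sup>2 (Lam k)\<close>.\<close>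

primrec Lam :: "nat \<Rightarrow> real \<Rightarrow> real" where
  "Lam 0 z = 1"
| "Lam (Suc k) z = 1 + Delta k z * Lam k z"

primrec Lam1 :: "nat \<Rightarrow> real \<Rightarrow> real" where
  "Lam1 0 z = 0"
| "Lam1 (Suc k) z = Delta k z * (Lam k z ^ 2 + Lam1 k z)"

primrec Lam2 :: "nat \<Rightarrow> real \<Rightarrow> real" where
  "Lam2 0 z = 0"
| "Lam2 (Suc k) z = Delta k z * (Lam k z ^ 3 + 3 * Lam k z * Lam1 k z + Lam2 k z)"

lemma Delta_ge: "z \<ge> 0 \<Longrightarrow> Delta k z \<ge> z"
proof (induction k)
  case (Suc k)
  then have "z * exp (Delta k z) \<ge> z * 1"
    by (intro mult_left_mono) auto
  then show ?case by simp
qed auto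

lemma Delta_nonneg: "z \<ge> 0 \<Longrightarrow> Delta k z \<ge> 0"
  using Delta_ge[of z k] by linarith

lemma Delta_pos: "z > 0 \<Longrightarrow> Delta k z > 0"
  using Delta_ge[of z k] by linarith

lemma Lam_ge_1: "z \<ge> 0 \<Longrightarrow> Lam k z \<ge> 1"
  by (induction k) (auto simp: Delta_nonneg)

lemma Lam1_nonneg: "z \<ge> 0 \<Longrightarrow> Lam1 k z \<ge> 0"
  by (induction k) (auto simp: Delta_nonneg)

lemma Lam2_nonneg: "z \<ge> 0 \<Longrightarrow> Lam2 k z \<ge> 0"
proof (induction k)
  case (Suc k)
  then show ?case using Lam_ge_1[of z k] Lam1_nonneg[of z k] Delta_nonneg[of z k] by simp
qed auto

lemma Delta_strict_mono: "0 < z \<Longrightarrow> z < w \<Longrightarrow> Delta k z < Delta k w"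
  by (induction k) (auto intro!: mult_strict_mono)

lemma Lam_mono: "0 < z \<Longrightarrow> z < w \<Longrightarrow> Lam k z \<le> Lam k w"
proof (induction k)
  case (Suc k)
  then show ?case
    using Delta_strict_mono[of z w k] Delta_pos[of z k] Lam_ge_1[of z k]
    by (auto intro!: mult_mono)
qed auto

lemma has_derivative_Delta:
  "z \<noteq> 0 \<Longrightarrow> (Delta k has_real_derivative Delta k z * Lam k z / z) (at z)"
proof (induction k)
  case (Suc k)
  show ?case
    unfolding Delta.simps[abs_def] Lam.simps using Suc.prems
    by (auto intro!: derivative_eq_intros Suc.IH simp: field_simps)
qed (auto simp: Delta.simps[abs_def])

lemma has_derivative_Lam:
  "z \<noteq> 0 \<Longrightarrow> (Lam k has_real_derivative Lam1 k z / z) (at z)"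
proof (induction k)
  case (Suc k)
  show ?case
    unfolding Lam.simps[abs_def] Lam1.simps using Suc.prems
    by (auto intro!: derivative_eq_intros Suc.IH has_derivative_Delta simp: field_simps power2_eq_square)
qed (auto simp: Lam.simps[abs_def])

lemma has_derivative_Lam1:
  "z \<noteq> 0 \<Longrightarrow> (Lam1 k has_real_derivative Lam2 k z / z) (at z)"
proof (induction k)
  case (Suc k)
  show ?case
    unfolding Lam1.simps[abs_def] Lam2.simps using Suc.prems
    by (auto intro!: derivative_eq_intros Suc.IH has_derivative_Delta has_derivative_Lam
        simp: field_simps power2_eq_square power3_eq_cube)
qed (auto simp: Lam1.simps[abs_def])

lemma filterlim_Delta_at_top: "filterlim (Delta k) at_top at_top"
proof (rule filterlim_at_top_mono[OF filterlim_ident])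
  show "eventually (\<lambda>z. z \<le> Delta k z) at_top"
    using eventually_ge_at_top[of 0] by eventually_elim (rule Delta_ge)
qed

text \<open>Unfolded, \<open>Lam k\<close> is 1 + \<open>Delta (k-1)\<close> +
  \<open>Delta (k-1)\<close> \<open>Delta (k-2)\<close> + ..., and the last summand, the full
  product, dominates. The product under the square root of the theorem originates here.\<close>

lemma Lam_asymp_prod_Delta: "((\<lambda>z. Lam k z / (\<Prod>i<k. Delta i z)) \<longlongrightarrow> 1) at_top"
proof (induction k)
  case (Suc k)
  have inv: "((\<lambda>z. 1 / (\<Prod>i<Suc k. Delta i z)) \<longlongrightarrow> 0) at_top"
  proof (rule tendsto_divide_0[OF tendsto_const])
    have "filterlim (\<lambda>z. \<Prod>i<Suc k. Delta i z) at_top at_top"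
    proof (rule filterlim_at_top_mono[OF filterlim_ident])
      show "eventually (\<lambda>z. z \<le> (\<Prod>i<Suc k. Delta i z)) at_top"
        using eventually_ge_at_top[of 1]
      proof eventually_elim
        case (elim z)
        have "(\<Prod>i<k. Delta (Suc i) z) \<ge> 1"
        proof (rule prod_ge_1)
          fix i show "Delta (Suc i) z \<ge> 1" using Delta_ge[of z "Suc i"] elim by linarith
        qed
        then show ?case using elim unfolding prod.lessThan_Suc_shift by simp
      qed
    qed
    then show "filterlim (\<lambda>z. \<Prod>i<Suc k. Delta i z) at_infinity at_top"
      by (rule filterlim_at_top_imp_at_infinity)
  qed
  have "((\<lambda>z. 1 / (\<Prod>i<Suc k. Delta i z) + Lam k z / (\<Prod>i<k. Delta i z)) \<longlongrightarrow> 0 + 1) at_top"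
    by (intro tendsto_add inv Suc.IH)
  then have "((\<lambda>z. 1 / (\<Prod>i<Suc k. Delta i z) + Lam k z / (\<Prod>i<k. Delta i z)) \<longlongrightarrow> 1) at_top"
    by simp
  then show ?case
  proof (rule Lim_transform_eventually)
    show "\<forall>\<^sub>F z in at_top. 1 / (\<Prod>i<Suc k. Delta i z) + Lam k z / (\<Prod>i<k. Delta i z) =
         Lam (Suc k) z / (\<Prod>i<Suc k. Delta i z)"
      using eventually_gt_at_top[of 0]
    proof eventually_elim
      case (elim z)
      have "Delta k z \<noteq> 0" using Delta_pos[OF elim, of k] by simp
      then show ?case by (simp add: add_divide_distrib)
    qed
  qed
qed auto

text \<open>The gain 1/z is regained at each level: with L = \<open>Lam k\<close>, the product of
  \<open>Delta k\<close> and L^2 is (\<open>Delta k\<close> L)^2 / \<open>Delta k\<close>, and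
  \<open>Delta k z\<close> \<ge> z. This gain makes the second summand of \<open>thetaP2\<close>
  negligible against the first.\<close>

lemma Lam1_le: "z \<ge> 1 \<Longrightarrow> Lam1 k z \<le> real k * Lam k z ^ 2 / z"
proof (induction k)
  case (Suc k)
  have D: "Delta k z \<ge> z" "Delta k z > 0" using Delta_ge[of z k] Suc.prems by auto
  have L: "Lam k z \<ge> 1" using Lam_ge_1[of z k] Suc.prems by auto
  have "Lam1 k z \<le> real k * Lam k z ^ 2 / z" using Suc by simp
  also have "\<dots> \<le> real k * Lam k z ^ 2"
    using divide_left_mono[of 1 z "real k * Lam k z ^ 2"] Suc.prems by simp
  finally have "Lam1 (Suc k) z \<le> Delta k z * (real (Suc k) * Lam k z ^ 2)"
    using D by (simp add: algebra_simps)
  also have "\<dots> = real (Suc k) * (Delta k z * Lam k z) ^ 2 / Delta k z"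
    using D by (simp add: field_simps power2_eq_square)
  also have "\<dots> \<le> real (Suc k) * Lam (Suc k) z ^ 2 / z"
  proof (rule frac_le)
    show "real (Suc k) * (Delta k z * Lam k z) ^ 2 \<le> real (Suc k) * Lam (Suc k) z ^ 2"
      using D L by (intro mult_left_mono power_mono) auto
  qed (use D Suc.prems in auto)
  finally show ?case .
qed auto

lemma Lam1_le':
  assumes "z \<ge> 1"
  shows "Lam1 k z \<le> real k * Lam k z ^ 2"
proof -
  have "real k * Lam k z ^ 2 / z \<le> real k * Lam k z ^ 2"
    using divide_left_mono[of 1 z "real k * Lam k z ^ 2"] assms by simp
  then show ?thesis using Lam1_le[OF assms, of k] by linarith
qed

text \<open>Only an upper bound for the third moment up to a constant is required, so the generous
  estimate of \<open>Delta k\<close> by its cube suffices.\<close>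

lemma Lam2_le: "\<exists>C. \<forall>z\<ge>1. Lam2 k z \<le> C * Lam k z ^ 3"
proof (induction k)
  case 0
  show ?case by (auto intro!: exI[of _ 0])
next
  case (Suc k)
  then obtain C where C: "\<And>z. z \<ge> 1 \<Longrightarrow> Lam2 k z \<le> C * Lam k z ^ 3" by blast
  \<comment> \<open>The three summands collect the constants of the three terms in
    \<open>Lam2 (Suc k)\<close>; the absolute value is taken because the induction hypothesis leaves
    the sign of \<open>C\<close> open.\<close>
  define K where "K = 1 + 3 * real k + \<bar>C\<bar>"
  show ?case
  proof (intro exI allI impI)
    fix z :: real assume z: "z \<ge> 1"
    have D: "Delta k z \<ge> 1" using Delta_ge[of z k] z by auto
    have L: "Lam k z \<ge> 1" using Lam_ge_1[of z k] z by auto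
    have "3 * Lam k z * Lam1 k z \<le> 3 * Lam k z * (real k * Lam k z ^ 2)"
      using L by (intro mult_left_mono Lam1_le' z) auto
    moreover have "Lam2 k z \<le> \<bar>C\<bar> * Lam k z ^ 3"
      using C[OF z] L by (smt (verit) mult_right_mono zero_le_power)
    ultimately have "Lam k z ^ 3 + 3 * Lam k z * Lam1 k z + Lam2 k z \<le> K * Lam k z ^ 3"
      by (simp add: K_def power3_eq_cube power2_eq_square algebra_simps)
    then have "Lam2 (Suc k) z \<le> Delta k z * (K * Lam k z ^ 3)"
      using D by simp
    also have "\<dots> \<le> Delta k z ^ 3 * (K * Lam k z ^ 3)"
      using D L by (intro mult_right_mono self_le_power) (auto simp: K_def)
    also have "\<dots> = K * (Delta k z * Lam k z) ^ 3"
      by (simp add: power_mult_distrib)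
    also have "\<dots> \<le> K * Lam (Suc k) z ^ 3"
      using D L by (intro mult_left_mono power_mono) (auto simp: K_def)
    finally show "Lam2 (Suc k) z \<le> K * Lam (Suc k) z ^ 3" .
  qed
qed

text \<open>\<open>Delta (Suc k)\<close> is exponential in \<open>Delta k\<close>, whereas
  \<open>Lam (Suc k)\<close> is at most 1 + (\<open>Delta k\<close>)^2 for large z. The latter uses
  the induction hypothesis with exponent 1, whatever exponent is wanted at the next level; this is
  why \<epsilon> is arbitrary in the induction.\<close>

lemma Lam_smallo_Delta_powr:
  assumes "\<epsilon> > 0"
  shows "((\<lambda>z. Lam k z / Delta k z powr \<epsilon>) \<longlongrightarrow> 0) at_top"
  using assms
proof (induction k arbitrary: \<epsilon>)
  case 0
  then show ?case by simp real_asymp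
next
  case (Suc k)
  have "eventually (\<lambda>z. Lam k z / Delta k z powr 1 < 1) at_top"
    using Suc.IH[of 1] by (intro order_tendstoD) auto
  then have ev: "eventually (\<lambda>z. norm (Lam (Suc k) z / Delta (Suc k) z powr \<epsilon>)
       \<le> (1 + Delta k z ^ 2) / exp (\<epsilon> * Delta k z)) at_top"
    using eventually_ge_at_top[of 1]
  proof eventually_elim
    case (elim z)
    have D: "Delta k z \<ge> 1" using Delta_ge[of z k] elim by auto
    have L: "Lam k z \<ge> 1" using Lam_ge_1[of z k] elim by auto
    have LD: "Lam k z \<le> Delta k z" using elim D by (simp add: divide_less_eq)
    have "Lam (Suc k) z / Delta (Suc k) z powr \<epsilon> \<le> (1 + Delta k z ^ 2) / exp (\<epsilon> * Delta k z)"
    proof (rule frac_le)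
      show "Lam (Suc k) z \<le> 1 + Delta k z ^ 2"
        using LD D by (simp add: power2_eq_square)
      have "exp (\<epsilon> * Delta k z) = exp (Delta k z) powr \<epsilon>"
        by (simp add: powr_def mult.commute)
      also have "\<dots> \<le> Delta (Suc k) z powr \<epsilon>"
        using Suc.prems elim by (intro powr_mono2) auto
      finally show "exp (\<epsilon> * Delta k z) \<le> Delta (Suc k) z powr \<epsilon>" .
    qed auto
    moreover have "Lam (Suc k) z / Delta (Suc k) z powr \<epsilon> \<ge> 0"
      using Lam_ge_1[of z "Suc k"] elim by (intro divide_nonneg_nonneg) auto
    ultimately show ?case by simp
  qed
  have "((\<lambda>x::real. (1 + x ^ 2) / exp (\<epsilon> * x)) \<longlongrightarrow> 0) at_top"
    using Suc.prems by real_asymp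
  from filterlim_compose[OF this filterlim_Delta_at_top]
  have "((\<lambda>z. (1 + Delta k z ^ 2) / exp (\<epsilon> * Delta k z)) \<longlongrightarrow> 0) at_top" .
  then show ?case using ev by (rule Lim_null_comparison[rotated])
qed

text \<open>One logarithm removes one level: ln X = ln (X / \<open>Delta (Suc k) z\<close>) + ln z +
  \<open>Delta k z\<close>, where the first term tends to 0 and ln z = o(z). Asymptotic equivalence
  survives the logarithm because the main term tends to infinity. The innermost logarithm is peeled
  off, so \<open>X\<close> changes in the induction.\<close>

lemma ln_funpow_asymp_Delta:
  assumes z: "filterlim z at_top sequentially"
    and X: "(\<lambda>n::nat. X n / Delta k (z n)) \<longlonglongrightarrow> 1"
  shows "(\<lambda>n. (ln ^^ k) (X n) / z n) \<longlonglongrightarrow> 1"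
  using X
proof (induction k arbitrary: X)
  case (Suc k)
  have Dk: "filterlim (\<lambda>n. Delta k (z n)) at_top sequentially"
    by (rule filterlim_compose[OF filterlim_Delta_at_top z])
  have zpos: "eventually (\<lambda>n. z n > 0) sequentially"
    using z by (simp add: filterlim_at_top_dense)
  have Xpos: "eventually (\<lambda>n. X n / Delta (Suc k) (z n) > 0) sequentially"
    using Suc.prems by (intro order_tendstoD) auto
  have "(\<lambda>n. ln (X n / Delta (Suc k) (z n))) \<longlonglongrightarrow> ln 1"
    by (intro tendsto_ln Suc.prems) auto
  moreover have "((\<lambda>n. inverse (Delta k (z n))) \<longlongrightarrow> 0) sequentially"
    using Dk by (rule tendsto_inverse_0_at_top)
  ultimately have 1: "(\<lambda>n. ln (X n / Delta (Suc k) (z n)) * inverse (Delta k (z n))) \<longlonglongrightarrow> ln 1 * 0"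
    by (rule tendsto_mult)
  have "((\<lambda>x::real. ln x / x) \<longlongrightarrow> 0) at_top" by real_asymp
  from filterlim_compose[OF this z] have 2: "(\<lambda>n. ln (z n) / z n) \<longlonglongrightarrow> 0" .
  have 3: "(\<lambda>n. ln (z n) / Delta k (z n)) \<longlonglongrightarrow> 0"
  proof (rule Lim_null_comparison[OF _ 2])
    have "eventually (\<lambda>n. z n \<ge> 1) sequentially"
      using z by (simp add: filterlim_at_top)
    then show "eventually (\<lambda>n. norm (ln (z n) / Delta k (z n)) \<le> ln (z n) / z n) sequentially"
    proof eventually_elim
      case (elim n)
      then have "ln (z n) / Delta k (z n) \<le> ln (z n) / z n" "Delta k (z n) \<ge> 0"
        using Delta_ge[of "z n" k] by (auto intro!: divide_left_mono)
      then show ?case using elim by simp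
    qed
  qed
  have "(\<lambda>n. ln (X n / Delta (Suc k) (z n)) * inverse (Delta k (z n)) + ln (z n) / Delta k (z n) + 1) \<longlonglongrightarrow> ln 1 * 0 + 0 + 1"
    by (intro tendsto_add 1 3 tendsto_const)
  then have "(\<lambda>n. ln (X n / Delta (Suc k) (z n)) * inverse (Delta k (z n)) + ln (z n) / Delta k (z n) + 1) \<longlonglongrightarrow> 1"
    by simp
  then have "(\<lambda>n. ln (X n) / Delta k (z n)) \<longlonglongrightarrow> 1"
  proof (rule Lim_transform_eventually)
    show "\<forall>\<^sub>F n in sequentially. ln (X n / Delta (Suc k) (z n)) * inverse (Delta k (z n)) + ln (z n) / Delta k (z n) + 1
      = ln (X n) / Delta k (z n)"
      using zpos Xpos
    proof eventually_elim
      case (elim n)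
      have D: "Delta k (z n) > 0" "Delta (Suc k) (z n) > 0" using elim Delta_pos by blast+
      have X: "X n > 0" using elim(2) D by (simp only: zero_less_divide_iff) auto
      have "ln (X n / Delta (Suc k) (z n)) = ln (X n) - (ln (z n) + Delta k (z n))"
        using X D elim by (simp add: ln_div ln_mult)
      then show ?case using D by (simp add: field_simps)
    qed
  qed
  from Suc.IH[OF this] show ?case by (simp add: funpow_swap1)
qed auto

section \<open>Saddle point asymptotics for exponentials of polynomials in \<open>\<Delta>\<^sub>\<alpha>\<close>\<close>

text \<open>In the application w \<gamma> is iota(d/\<gamma>) / (\<gamma> h), the weight of a cycle
  of length \<gamma>. Of the individual weights only w d has to be positive, since \<gamma> = d
  alone determines the growth.\<close>

locale delta_weights =
  fixes h :: real and d \<alpha> :: nat and w :: "nat \<Rightarrow> real"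
  assumes h: "h > 0" and d: "d > 0" and \<alpha>: "\<alpha> > 0"
    and w_nonneg: "\<And>\<gamma>. w \<gamma> \<ge> 0" and w_d: "w d > 0"
begin

text \<open>\<open>S 0\<close> is the polynomial with P = S 0 (D), and \<open>S j\<close> arises
  from it by applying x d/dx j times. Its value at 1 serves as a constant in upper bounds.\<close>

definition S :: "nat \<Rightarrow> real \<Rightarrow> real" where
  "S j x = (\<Sum>\<gamma> | \<gamma> dvd d. real \<gamma> ^ j * w \<gamma> * x ^ \<gamma>)"

definition D :: "real \<Rightarrow> real" where "D r = Delta \<alpha> (h * r)"

text \<open>For \<open>P r = S 0 (D r)\<close>, the functions \<open>thetaP\<close>, \<open>thetaP2\<close>, \<open>thetaP3\<close> are \<open>\<theta> P\<close>, \<open>\<theta>\<^sup>2 P\<close>, \<open>\<theta>\<^sup>3 P\<close>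
  with \<open>\<theta> = r d/dr\<close>.\<close>

definition thetaP :: "real \<Rightarrow> real" where
  "thetaP r = S 1 (D r) * Lam \<alpha> (h * r)"

definition thetaP2 :: "real \<Rightarrow> real" where
  "thetaP2 r = S 2 (D r) * Lam \<alpha> (h * r) ^ 2 + S 1 (D r) * Lam1 \<alpha> (h * r)"

definition thetaP3 :: "real \<Rightarrow> real" where
  "thetaP3 r = S 3 (D r) * Lam \<alpha> (h * r) ^ 3 + 3 * S 2 (D r) * Lam \<alpha> (h * r) * Lam1 \<alpha> (h * r)
     + S 1 (D r) * Lam2 \<alpha> (h * r)"

lemma finite_div [simp]: "finite {\<gamma>. \<gamma> dvd d}"
  by (rule finite_divisors_nat[OF d])

lemma div_pos: "\<gamma> dvd d \<Longrightarrow> \<gamma> > 0"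
  using d by (auto intro!: Nat.gr0I)

lemma S_ge: "x \<ge> 0 \<Longrightarrow> S j x \<ge> w d * x ^ d"
proof -
  assume x: "x \<ge> 0"
  have "1 * (w d * x ^ d) \<le> real d ^ j * (w d * x ^ d)"
    using d x w_nonneg by (intro mult_right_mono one_le_power) auto
  also have "\<dots> = (\<Sum>\<gamma>\<in>{d}. real \<gamma> ^ j * w \<gamma> * x ^ \<gamma>)" by simp
  also have "\<dots> \<le> S j x"
    unfolding S_def using x w_nonneg by (intro sum_mono2) auto
  finally show ?thesis by simp
qed

lemma S_pos: "x > 0 \<Longrightarrow> S j x > 0"
  using S_ge[of x j] mult_pos_pos[OF w_d zero_less_power[of x d]] by linarith

lemma S_nonneg: "x \<ge> 0 \<Longrightarrow> S j x \<ge> 0"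
  unfolding S_def using w_nonneg by (intro sum_nonneg) auto

lemma S_le: "x \<ge> 1 \<Longrightarrow> S j x \<le> S j 1 * x ^ d"
  unfolding S_def sum_distrib_right
proof (rule sum_mono)
  fix \<gamma> assume x: "x \<ge> 1" and "\<gamma> \<in> {\<gamma>. \<gamma> dvd d}"
  then have "x ^ \<gamma> \<le> x ^ d"
    using d dvd_imp_le by (intro power_increasing) auto
  then show "real \<gamma> ^ j * w \<gamma> * x ^ \<gamma> \<le> real \<gamma> ^ j * w \<gamma> * 1 ^ \<gamma> * x ^ d"
    using w_nonneg by (simp add: mult_left_mono)
qed

lemma S_strict_mono: "0 < x \<Longrightarrow> x < y \<Longrightarrow> S j x < S j y"
  unfolding S_def
proof (rule sum_strict_mono_ex1)
  assume "0 < x" "x < y"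
  then show "\<forall>\<gamma>\<in>{\<gamma>. \<gamma> dvd d}. real \<gamma> ^ j * w \<gamma> * x ^ \<gamma> \<le> real \<gamma> ^ j * w \<gamma> * y ^ \<gamma>"
    using w_nonneg by (auto intro!: mult_left_mono power_mono)
  show "\<exists>\<gamma>\<in>{\<gamma>. \<gamma> dvd d}. real \<gamma> ^ j * w \<gamma> * x ^ \<gamma> < real \<gamma> ^ j * w \<gamma> * y ^ \<gamma>"
    using \<open>0 < x\<close> \<open>x < y\<close> d w_d by (intro bexI[of _ d]) (auto intro!: power_strict_mono)
qed auto

lemma has_derivative_S:
  assumes "x > 0"
  shows "(S j has_real_derivative S (Suc j) x / x) (at x)"
proof -
  have "(S j has_real_derivative (\<Sum>\<gamma> | \<gamma> dvd d. real \<gamma> ^ j * w \<gamma> * (real \<gamma> * x ^ (\<gamma> - 1)))) (at x)"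
    unfolding S_def[abs_def] by (auto intro!: derivative_eq_intros sum.cong)
  also have "(\<Sum>\<gamma> | \<gamma> dvd d. real \<gamma> ^ j * w \<gamma> * (real \<gamma> * x ^ (\<gamma> - 1))) = S (Suc j) x / x"
    unfolding S_def sum_divide_distrib
  proof (rule sum.cong)
    fix \<gamma> assume "\<gamma> \<in> {\<gamma>. \<gamma> dvd d}"
    then have "x ^ \<gamma> = x * x ^ (\<gamma> - 1)"
      using div_pos[of \<gamma>] by (simp flip: power_Suc)
    then show "real \<gamma> ^ j * w \<gamma> * (real \<gamma> * x ^ (\<gamma> - 1)) = real \<gamma> ^ Suc j * w \<gamma> * x ^ \<gamma> / x"
      using assms by simp
  qed auto
  finally show ?thesis .
qed

lemma S_asymp: "((\<lambda>x. S j x / x ^ d) \<longlongrightarrow> real d ^ j * w d) at_top"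
proof -
  have "((\<lambda>x. \<Sum>\<gamma> | \<gamma> dvd d. real \<gamma> ^ j * w \<gamma> * (x ^ \<gamma> / x ^ d)) \<longlongrightarrow>
      (\<Sum>\<gamma> | \<gamma> dvd d. real \<gamma> ^ j * w \<gamma> * (if \<gamma> = d then 1 else 0))) at_top"
  proof (intro tendsto_sum tendsto_mult tendsto_const)
    fix \<gamma> assume "\<gamma> \<in> {\<gamma>. \<gamma> dvd d}"
    then have le: "\<gamma> \<le> d" using d dvd_imp_le by auto
    show "((\<lambda>x::real. x ^ \<gamma> / x ^ d) \<longlongrightarrow> (if \<gamma> = d then 1 else 0)) at_top"
    proof (cases "\<gamma> = d")
      case True
      have "eventually (\<lambda>x::real. x ^ \<gamma> / x ^ d = 1) at_top"
        using eventually_gt_at_top[of 0] by eventually_elim (use True in auto)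
      then show ?thesis using True by (simp add: tendsto_eventually)
    next
      case False
      with le have lt: "d - \<gamma> > 0" by simp
      have "((\<lambda>x::real. inverse (x ^ (d - \<gamma>))) \<longlongrightarrow> 0) at_top"
        using lt by (intro tendsto_inverse_0_at_top filterlim_pow_at_top filterlim_ident) auto
      moreover have "eventually (\<lambda>x::real. inverse (x ^ (d - \<gamma>)) = x ^ \<gamma> / x ^ d) at_top"
        using eventually_gt_at_top[of 0]
      proof eventually_elim
        case (elim x)
        have "x ^ d = x ^ \<gamma> * x ^ (d - \<gamma>)" using le by (simp flip: power_add)
        then show ?case using elim by (simp add: field_simps)
      qed
      ultimately have "((\<lambda>x::real. x ^ \<gamma> / x ^ d) \<longlongrightarrow> 0) at_top"
        by (rule Lim_transform_eventually)
      then show ?thesis using False by simp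
    qed
  qed
  also have "(\<Sum>\<gamma> | \<gamma> dvd d. real \<gamma> ^ j * w \<gamma> * (if \<gamma> = d then 1 else 0)) = real d ^ j * w d"
    using d by (subst sum.remove[of _ d]) (auto intro!: sum.neutral)
  finally show ?thesis
    by (simp add: S_def sum_divide_distrib)
qed

lemma D_pos: "r > 0 \<Longrightarrow> D r > 0"
  unfolding D_def using h by (intro Delta_pos) auto

lemma D_ge: "r \<ge> 0 \<Longrightarrow> D r \<ge> h * r"
  unfolding D_def using h by (intro Delta_ge) auto

lemma has_derivative_S_D:
  assumes r: "r > 0"
  shows "((\<lambda>r. S j (D r)) has_real_derivative S (Suc j) (D r) * Lam \<alpha> (h * r) / r) (at r)"
proof -
  have "(D has_real_derivative D r * Lam \<alpha> (h * r) / (h * r) * h) (at r)"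
    unfolding D_def[abs_def] using r h
    by (intro DERIV_chain2[OF has_derivative_Delta]) (auto intro!: derivative_eq_intros)
  from DERIV_chain2[OF has_derivative_S[OF D_pos[OF r]] this]
  show ?thesis using r h D_pos[OF r] by (simp add: field_simps)
qed

lemma has_derivative_Lam_h:
  assumes r: "r > 0"
  shows "((\<lambda>r. Lam \<alpha> (h * r)) has_real_derivative Lam1 \<alpha> (h * r) / r) (at r)"
    and "((\<lambda>r. Lam1 \<alpha> (h * r)) has_real_derivative Lam2 \<alpha> (h * r) / r) (at r)"
proof -
  have 1: "((\<lambda>r. h * r) has_real_derivative h) (at r)"
    by (auto intro!: derivative_eq_intros)
  show "((\<lambda>r. Lam \<alpha> (h * r)) has_real_derivative Lam1 \<alpha> (h * r) / r) (at r)"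
    "((\<lambda>r. Lam1 \<alpha> (h * r)) has_real_derivative Lam2 \<alpha> (h * r) / r) (at r)"
    using DERIV_chain2[OF has_derivative_Lam[of "h * r" \<alpha>] 1]
      DERIV_chain2[OF has_derivative_Lam1[of "h * r" \<alpha>] 1] h r by auto
qed

lemma has_derivative_thetaP:
  assumes r: "r > 0"
  shows "(thetaP has_real_derivative thetaP2 r / r) (at r)"
    and "(thetaP2 has_real_derivative thetaP3 r / r) (at r)"
proof -
  have S1: "((\<lambda>r. S 1 (D r)) has_real_derivative S 2 (D r) * Lam \<alpha> (h * r) / r) (at r)"
    and S2: "((\<lambda>r. S 2 (D r)) has_real_derivative S 3 (D r) * Lam \<alpha> (h * r) / r) (at r)"
    using has_derivative_S_D[OF r, of 1] has_derivative_S_D[OF r, of 2] by (simp_all add: eval_nat_numeral)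
  note L = has_derivative_Lam_h[OF r]
  show "(thetaP has_real_derivative thetaP2 r / r) (at r)"
    unfolding thetaP_def[abs_def] thetaP2_def
    using r by (intro DERIV_cong[OF DERIV_mult[OF S1 L(1)]]) (simp add: add_divide_distrib algebra_simps power2_eq_square)
  show "(thetaP2 has_real_derivative thetaP3 r / r) (at r)"
    unfolding thetaP2_def[abs_def] thetaP3_def
    using r
    by (intro DERIV_cong[OF DERIV_add[OF DERIV_mult[OF S2 DERIV_power[OF L(1), of 2]] DERIV_mult[OF S1 L(2)]]])
      (simp add: add_divide_distrib algebra_simps power2_eq_square power3_eq_cube)
qed

lemma theta_sums:
  assumes p: "\<And>z. z > 0 \<Longrightarrow> (\<lambda>k. p k * z ^ k) sums S 0 (D z)" and r: "r > 0"
  shows "(\<lambda>k. real k * (p k * r ^ k)) sums thetaP r"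
    and "(\<lambda>k. real k ^ 2 * (p k * r ^ k)) sums thetaP2 r"
    and "(\<lambda>k. real k ^ 3 * (p k * r ^ k)) sums thetaP3 r"
proof -
  have 1: "(\<lambda>k. real k * p k * z ^ k) sums thetaP z" if "z > 0" for z
  proof -
    have "(\<lambda>k. real k * (p k * z ^ k)) sums thetaP z"
      using that has_derivative_S_D[of _ 0]
      by (intro sums_theta_power_series[OF p]) (simp_all add: thetaP_def)
    then show ?thesis by (simp add: mult.assoc)
  qed
  have 2: "(\<lambda>k. real k * (real k * p k) * z ^ k) sums thetaP2 z" if "z > 0" for z
    using sums_theta_power_series[of "\<lambda>k. real k * p k", OF 1 has_derivative_thetaP(1) that]
    by (simp add: mult.assoc)
  have 3: "(\<lambda>k. real k * (real k * (real k * p k)) * z ^ k) sums thetaP3 z" if "z > 0" for z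
    using sums_theta_power_series[of "\<lambda>k. real k * (real k * p k)", OF 2 has_derivative_thetaP(2) that]
    by (simp add: mult.assoc)
  show "(\<lambda>k. real k * (p k * r ^ k)) sums thetaP r"
    "(\<lambda>k. real k ^ 2 * (p k * r ^ k)) sums thetaP2 r"
    "(\<lambda>k. real k ^ 3 * (p k * r ^ k)) sums thetaP3 r"
    using 1[OF r] 2[OF r] 3[OF r] by (simp_all add: power2_eq_square power3_eq_cube mult.assoc)
qed

lemma thetaP_strict_mono: "0 < r \<Longrightarrow> r < s \<Longrightarrow> thetaP r < thetaP s"
  unfolding thetaP_def
proof (rule mult_less_le_imp_less)
  assume rs: "0 < r" "r < s"
  then have hr: "0 < h * r" "h * r < h * s" using h by auto
  show "S 1 (D r) < S 1 (D s)"
    unfolding D_def using hr by (intro S_strict_mono Delta_strict_mono Delta_pos)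
  show "Lam \<alpha> (h * r) \<le> Lam \<alpha> (h * s)" using hr by (rule Lam_mono)
  show "0 \<le> S 1 (D r)" using rs D_pos S_pos less_imp_le by blast
  show "0 < Lam \<alpha> (h * r)" using Lam_ge_1[of "h * r" \<alpha>] hr by linarith
qed

lemma filterlim_thetaP: "filterlim thetaP at_top at_top"
proof -
  have "filterlim (\<lambda>r. w d * (h * r) ^ d) at_top at_top"
    using w_d h d
    by (intro filterlim_tendsto_pos_mult_at_top[OF tendsto_const] filterlim_pow_at_top filterlim_ident) auto
  then show ?thesis
  proof (rule filterlim_at_top_mono)
    show "eventually (\<lambda>r. w d * (h * r) ^ d \<le> thetaP r) at_top"
      using eventually_gt_at_top[of 0]
    proof eventually_elim
      case (elim r)
      have "w d * (h * r) ^ d \<le> w d * D r ^ d"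
        using elim h w_d D_ge[of r] by (intro mult_left_mono power_mono) auto
      also have "\<dots> \<le> S 1 (D r) * 1"
        using S_ge[of "D r" 1] D_pos[OF elim] by simp
      also have "\<dots> \<le> thetaP r"
        unfolding thetaP_def using Lam_ge_1[of "h * r" \<alpha>] S_pos[OF D_pos[OF elim], of 1] h elim
        by (intro mult_left_mono) auto
      finally show ?case .
    qed
  qed
qed

text \<open>Uniqueness is the strict monotonicity of \<open>thetaP\<close> on the whole positive
  axis. For existence the intermediate value theorem starts at 1, which is why n has to be at least
  \<open>thetaP 1\<close>.\<close>

lemma ex1_saddle: "eventually (\<lambda>n. \<exists>!r. r > 0 \<and> thetaP r = real n) sequentially"
  using eventually_ge_at_top[of "nat \<lceil>thetaP 1\<rceil>"]
proof eventually_elim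
  case (elim n)
  then have 1: "thetaP 1 \<le> real n" by linarith
  obtain R where R: "R \<ge> 1" "thetaP R \<ge> real n"
  proof -
    obtain R where "\<And>x. x \<ge> R \<Longrightarrow> thetaP x \<ge> real n"
      using filterlim_thetaP unfolding filterlim_at_top eventually_at_top_linorder by blast
    then show ?thesis using that[of "max 1 R"] by simp
  qed
  have "continuous_on {1..R} thetaP"
    using DERIV_isCont[OF has_derivative_thetaP(1)]
    by (intro continuous_at_imp_continuous_on) simp
  from IVT'[OF 1 R(2) R(1) this] obtain x where x: "x \<ge> 1" "thetaP x = real n" by blast
  show ?case
  proof (intro ex1I[of _ x])
    show "x > 0 \<and> thetaP x = real n" using x by simp
    fix y assume "y > 0 \<and> thetaP y = real n"
    then show "y = x"
      using x thetaP_strict_mono[of x y] thetaP_strict_mono[of y x] by (cases x y rule: linorder_cases) auto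
  qed
qed

lemma filterlim_saddle:
  assumes r: "eventually (\<lambda>n. r n > 0 \<and> thetaP (r n) = real n) sequentially"
  shows "filterlim r at_top sequentially"
  unfolding filterlim_at_top
proof
  fix Z :: real
  define M where "M = max 1 Z"
  have M: "M \<ge> Z" "M > 0" by (auto simp: M_def)
  show "eventually (\<lambda>n. Z \<le> r n) sequentially"
    using r eventually_gt_at_top[of "nat \<lceil>thetaP M\<rceil>"]
  proof eventually_elim
    case (elim n)
    then have "thetaP M < thetaP (r n)" by linarith
    then have "M < r n"
      using thetaP_strict_mono[of "r n" M] elim by (cases "r n" M rule: linorder_cases) auto
    then show ?case using M by simp
  qed
qed

end

section \<open>Estimates off the positive axis and nonnegativity of the coefficients\<close>

lemma norm_exp_minus_1_le:
  fixes w :: "'a::{real_normed_field,banach}"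
  shows "norm (exp w - 1) \<le> exp (norm w) - 1"
proof -
  have s: "(\<lambda>n. x ^ Suc n /\<^sub>R fact (Suc n)) sums (exp x - 1)" for x :: "'b::{real_normed_field,banach}"
    using exp_converges[of x] by (subst sums_Suc_iff) simp
  have "norm (\<Sum>n. w ^ Suc n /\<^sub>R fact (Suc n)) \<le> (\<Sum>n. norm w ^ Suc n /\<^sub>R fact (Suc n))"
    by (intro norm_suminf_le sums_summable[OF s]) (simp add: norm_power norm_mult)
  then show ?thesis
    using sums_unique[OF s[of w]] sums_unique[OF s[of "norm w"]] by simp
qed

primrec cDelta :: "nat \<Rightarrow> complex \<Rightarrow> complex" where
  "cDelta 0 z = z"
| "cDelta (Suc k) z = z * exp (cDelta k z)"

lemma cDelta_of_real: "cDelta k (of_real x) = of_real (Delta k x)"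
  by (induction k) (auto simp: exp_of_real)

lemma norm_cDelta_le: "cmod (cDelta k z) \<le> Delta k (cmod z)"
proof (induction k)
  case (Suc k)
  have "exp (Re (cDelta k z)) \<le> exp (Delta k (cmod z))"
    using complex_Re_le_cmod[of "cDelta k z"] Suc by simp
  then show ?case by (simp add: norm_mult mult_left_mono)
qed auto

text \<open>Split off the linear term: \<open>cDelta k z\<close> = z + z (exp
  (\<open>cDelta (k-1) z\<close>) - 1). The loss |z| - Re z comes from the linear term alone; the
  remainder is bounded by its value at |z|.\<close>

lemma Re_cDelta_le: "Re (cDelta k z) \<le> Delta k (cmod z) - (cmod z - Re z)"
proof (cases k)
  case (Suc m)
  have "cDelta k z = z + z * (exp (cDelta m z) - 1)"
    using Suc by (simp add: algebra_simps)
  then have "Re (cDelta k z) = Re z + Re (z * (exp (cDelta m z) - 1))"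
    by simp
  also have "Re (z * (exp (cDelta m z) - 1)) \<le> cmod z * cmod (exp (cDelta m z) - 1)"
    using complex_Re_le_cmod[of "z * (exp (cDelta m z) - 1)"] by (simp add: norm_mult)
  also have "\<dots> \<le> cmod z * (exp (Delta m (cmod z)) - 1)"
  proof (rule mult_left_mono)
    have "cmod (exp (cDelta m z) - 1) \<le> exp (cmod (cDelta m z)) - 1"
      by (rule norm_exp_minus_1_le)
    also have "\<dots> \<le> exp (Delta m (cmod z)) - 1"
      using norm_cDelta_le[of m z] by simp
    finally show "cmod (exp (cDelta m z) - 1) \<le> exp (Delta m (cmod z)) - 1" .
  qed auto
  also have "\<dots> = Delta k (cmod z) - cmod z"
    using Suc by (simp add: algebra_simps)
  finally show ?thesis by simp
qed auto

lemma holomorphic_cDelta: "cDelta k holomorphic_on A"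
  by (induction k) (auto simp: cDelta.simps[abs_def] intro!: holomorphic_intros)

text \<open>A property of complex series, so that it can be carried through the same closure rules
  as \<open>has_fps_expansion\<close>. It supplies the nonnegative coefficients of P without
  computing them.\<close>

definition fps_nonneg :: "complex fps \<Rightarrow> bool" where
  "fps_nonneg F \<longleftrightarrow> (\<forall>n. fps_nth F n \<in> \<real>\<^sub>\<ge>\<^sub>0)"

lemma sum_in_nonneg_Reals: "(\<And>x. x \<in> A \<Longrightarrow> f x \<in> \<real>\<^sub>\<ge>\<^sub>0) \<Longrightarrow> sum f A \<in> \<real>\<^sub>\<ge>\<^sub>0"
  by (induction A rule: infinite_finite_induct) auto

lemma fps_nonneg_mult: "fps_nonneg F \<Longrightarrow> fps_nonneg G \<Longrightarrow> fps_nonneg (F * G)"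
  by (auto simp: fps_nonneg_def fps_mult_nth intro!: sum_in_nonneg_Reals nonneg_Reals_mult_I)

lemma fps_nonneg_const: "c \<in> \<real>\<^sub>\<ge>\<^sub>0 \<Longrightarrow> fps_nonneg (fps_const c)"
  by (auto simp: fps_nonneg_def)

lemma fps_nonneg_X: "fps_nonneg fps_X"
  by (auto simp: fps_nonneg_def fps_X_def)

lemma fps_nonneg_exp: "fps_nonneg (fps_exp 1)"
  unfolding fps_nonneg_def
proof
  fix n
  have "fps_nth (fps_exp 1) n = complex_of_real (1 / fact n)" by simp
  then show "fps_nth (fps_exp 1 :: complex fps) n \<in> \<real>\<^sub>\<ge>\<^sub>0"
    by (simp only: nonneg_Reals_of_real_iff) simp
qed

lemma fps_nonneg_power: "fps_nonneg F \<Longrightarrow> fps_nonneg (F ^ n)"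
proof (induction n)
  case 0
  then show ?case using fps_nonneg_const[of 1] by simp
qed (auto intro: fps_nonneg_mult)

lemma fps_nonneg_sum: "(\<And>x. x \<in> A \<Longrightarrow> fps_nonneg (F x)) \<Longrightarrow> fps_nonneg (sum F A)"
  by (auto simp: fps_nonneg_def fps_sum_nth intro!: sum_in_nonneg_Reals)

lemma fps_nonneg_compose: "fps_nonneg F \<Longrightarrow> fps_nonneg G \<Longrightarrow> fps_nonneg (F oo G)"
  using fps_nonneg_power[of G]
  by (auto simp: fps_nonneg_def fps_compose_nth intro!: sum_in_nonneg_Reals nonneg_Reals_mult_I)

text \<open>The vanishing constant coefficient is part of the induction because it is what permits
  composition with the exponential series.\<close>

lemma ex_cDelta_expansion:
  "\<exists>F. cDelta k has_fps_expansion F \<and> fps_nonneg F \<and> fps_nth F 0 = 0"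
proof (induction k)
  case 0
  show ?case
    by (intro exI[of _ fps_X]) (auto simp: cDelta.simps[abs_def] fps_nonneg_X intro!: fps_expansion_intros)
next
  case (Suc k)
  then obtain F where F: "cDelta k has_fps_expansion F" "fps_nonneg F" "fps_nth F 0 = 0" by blast
  have "(exp \<circ> cDelta k) has_fps_expansion (fps_exp 1 oo F)"
    by (intro has_fps_expansion_compose F has_fps_expansion_exp1)
  then have "(\<lambda>z. z * exp (cDelta k z)) has_fps_expansion fps_X * (fps_exp 1 oo F)"
    by (intro has_fps_expansion_mult has_fps_expansion_fps_X) (simp add: o_def)
  then show ?case
    using F by (intro exI[of _ "fps_X * (fps_exp 1 oo F)"])
      (auto simp: cDelta.simps[abs_def] intro!: fps_nonneg_mult fps_nonneg_X fps_nonneg_compose fps_nonneg_exp)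
qed

lemma one_minus_cos_ge:
  fixes x :: real
  assumes "0 \<le> x" "x \<le> 1"
  shows "1 - cos x \<ge> x\<^sup>2 / 4"
proof -
  have "\<bar>Re (iexp x - (\<Sum>k\<le>2. (\<i> * of_real x) ^ k / fact k))\<bar> \<le> \<bar>x\<bar> ^ 3 / 6"
    using order_trans[OF abs_Re_le_cmod iexp_approx1[of x 2]] by (simp add: numeral_3_eq_3 fact_numeral)
  moreover have "Re (iexp x - (\<Sum>k\<le>2. (\<i> * of_real x) ^ k / fact k)) = cos x - 1 + x\<^sup>2 / 2"
    by (simp add: numeral_2_eq_2 power2_eq_square flip: cis_conv_exp)
  moreover have "x ^ 3 \<le> x ^ 2"
    using assms by (intro power_decreasing) auto
  ultimately have "cos x - 1 + x\<^sup>2 / 2 \<le> x ^ 3 / 6" "x ^ 3 \<le> x\<^sup>2"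
    using assms by (simp_all only: abs_of_nonneg abs_le_iff)
  then show ?thesis using zero_le_power2[of x] by linarith
qed

lemma one_minus_exp_neg_ge:
  fixes u :: real
  assumes "0 \<le> u" "u \<le> 1"
  shows "1 - exp (- u) \<ge> u / 2"
proof -
  have "exp (- u) \<le> 1 / (1 + u)"
    using exp_ge_add_one_self[of u] assms by (simp add: exp_minus field_simps)
  also have "\<dots> \<le> 1 - u / 2"
    using assms mult_right_mono[of u 1 u] by (simp add: field_simps)
  finally show ?thesis by simp
qed

context delta_weights
begin

definition cP :: "complex \<Rightarrow> complex" where
  "cP z = (\<Sum>\<gamma> | \<gamma> dvd d. of_real (w \<gamma>) * cDelta \<alpha> (of_real h * z) ^ \<gamma>)"

lemma holomorphic_cP: "cP holomorphic_on A"
proof -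
  have "(cDelta \<alpha> \<circ> (\<lambda>z. of_real h * z)) holomorphic_on A"
    by (intro holomorphic_on_compose holomorphic_cDelta holomorphic_intros)
  then have "(\<lambda>z. cDelta \<alpha> (of_real h * z)) holomorphic_on A"
    by (simp add: o_def)
  then show ?thesis
    unfolding cP_def[abs_def] by (intro holomorphic_intros)
qed

lemma cP_of_real: "cP (of_real r) = of_real (S 0 (D r))"
  unfolding cP_def S_def D_def using cDelta_of_real[of \<alpha> "h * r"] by simp

lemma ex_cP_series:
  "\<exists>p :: nat \<Rightarrow> real. (\<forall>k. p k \<ge> 0) \<and> (\<forall>z. (\<lambda>k. of_real (p k) * z ^ k) sums cP z)"
proof -
  obtain F where F: "cDelta \<alpha> has_fps_expansion F" "fps_nonneg F" "fps_nth F 0 = 0"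
    using ex_cDelta_expansion by blast
  have hX: "(\<lambda>z. complex_of_real h * z) has_fps_expansion (fps_const (of_real h) * fps_X)"
    using has_fps_expansion_cmult_left[OF has_fps_expansion_fps_X, of "complex_of_real h"] by simp
  have "(cDelta \<alpha> \<circ> (\<lambda>z. of_real h * z)) has_fps_expansion (F oo (fps_const (of_real h) * fps_X))"
    by (intro has_fps_expansion_compose F hX) auto
  then have D: "(\<lambda>z. cDelta \<alpha> (of_real h * z)) has_fps_expansion (F oo (fps_const (of_real h) * fps_X))"
    by (simp add: o_def)
  define G where "G = (\<Sum>\<gamma> | \<gamma> dvd d. fps_const (complex_of_real (w \<gamma>)) * (F oo (fps_const (of_real h) * fps_X)) ^ \<gamma>)"
  have G: "cP has_fps_expansion G"
    unfolding cP_def[abs_def] G_def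
    by (intro has_fps_expansion_sum has_fps_expansion_cmult_left has_fps_expansion_power D)
  have nn: "fps_nonneg G"
    unfolding G_def using h w_nonneg
    by (intro fps_nonneg_sum fps_nonneg_mult fps_nonneg_power fps_nonneg_compose fps_nonneg_const F fps_nonneg_X) auto
  define p where "p = (\<lambda>k. Re (fps_nth G k))"
  have p: "fps_nth G k = of_real (p k)" "p k \<ge> 0" for k
    using nn by (auto simp: fps_nonneg_def complex_nonneg_Reals_iff p_def complex_eq_iff)
  \<comment> \<open>\<open>cP\<close> is entire, so its Taylor series at 0 represents it on the disc
    of radius \<infinity>.\<close>
  have "(\<lambda>k. of_real (p k) * z ^ k) sums cP z" for z
    using has_fps_expansion_imp_sums_complex[OF G holomorphic_cP, of z \<infinity>] p by simp
  then show ?thesis using p by blast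
qed

text \<open>As \<alpha> > 0 there is an outermost exponential, and the modulus of
  \<open>cDelta \<alpha>\<close> is exactly |z| exp (Re (\<open>cDelta (\<alpha> - 1) z\<close>)).
  The additive loss one level below thereby becomes a factor, whose d-th power enters through the
  summand \<gamma> = d. The other summands are bounded by their moduli.\<close>

lemma Re_cP_le:
  assumes r: "r > 0"
  shows "Re (cP (of_real r * cis t)) \<le>
    S 0 (D r) - w d * D r ^ d * (1 - exp (- (real d * (h * r) * (1 - cos t))))"
proof -
  define z where "z = of_real h * (of_real r * cis t)"
  have nz: "cmod z = h * r" and Rz: "Re z = h * r * cos t"
    using h r by (auto simp: z_def norm_mult)
  have term_le: "Re (cDelta \<alpha> z ^ \<gamma>) \<le> D r ^ \<gamma>" for \<gamma>
  proof -
    have "Re (cDelta \<alpha> z ^ \<gamma>) \<le> cmod (cDelta \<alpha> z) ^ \<gamma>"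
      using complex_Re_le_cmod[of "cDelta \<alpha> z ^ \<gamma>"] by (simp add: norm_power)
    also have "\<dots> \<le> D r ^ \<gamma>"
      using norm_cDelta_le[of \<alpha> z] nz by (intro power_mono) (auto simp: D_def)
    finally show ?thesis .
  qed
  obtain a where a: "\<alpha> = Suc a" using \<alpha> by (cases \<alpha>) auto
  have "cmod (cDelta \<alpha> z) = h * r * exp (Re (cDelta a z))"
    by (simp add: a norm_mult nz)
  also have "\<dots> \<le> h * r * exp (Delta a (h * r) - h * r * (1 - cos t))"
    using Re_cDelta_le[of a z] h r by (intro mult_left_mono) (auto simp: nz Rz algebra_simps)
  also have "\<dots> = D r * exp (- (h * r * (1 - cos t)))"
  proof -
    have "D r = Delta \<alpha> (h * r)" by (rule D_def)
    also have "\<dots> = h * r * exp (Delta a (h * r))" by (simp add: a)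
    finally show ?thesis by (simp add: exp_diff exp_minus divide_inverse)
  qed
  finally have "cmod (cDelta \<alpha> z) ^ d \<le> (D r * exp (- (h * r * (1 - cos t)))) ^ d"
    by (intro power_mono) auto
  also have "\<dots> = D r ^ d * exp (- (real d * (h * r) * (1 - cos t)))"
    by (simp add: power_mult_distrib algebra_simps flip: exp_of_nat_mult)
  finally have d_le: "Re (cDelta \<alpha> z ^ d) \<le> D r ^ d * exp (- (real d * (h * r) * (1 - cos t)))"
    using complex_Re_le_cmod[of "cDelta \<alpha> z ^ d"] by (simp add: norm_power)
  have d_in: "d \<in> {\<gamma>. \<gamma> dvd d}" by simp
  have "Re (cP (of_real r * cis t)) = (\<Sum>\<gamma> | \<gamma> dvd d. w \<gamma> * Re (cDelta \<alpha> z ^ \<gamma>))"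
    by (simp add: cP_def z_def)
  also have "\<dots> = w d * Re (cDelta \<alpha> z ^ d) + (\<Sum>\<gamma>\<in>{\<gamma>. \<gamma> dvd d} - {d}. w \<gamma> * Re (cDelta \<alpha> z ^ \<gamma>))"
    by (rule sum.remove[OF finite_div d_in])
  also have "\<dots> \<le> w d * (D r ^ d * exp (- (real d * (h * r) * (1 - cos t))))
      + (\<Sum>\<gamma>\<in>{\<gamma>. \<gamma> dvd d} - {d}. w \<gamma> * D r ^ \<gamma>)"
    by (intro add_mono mult_left_mono sum_mono d_le term_le w_nonneg)
  also have "(\<Sum>\<gamma>\<in>{\<gamma>. \<gamma> dvd d} - {d}. w \<gamma> * D r ^ \<gamma>) = S 0 (D r) - w d * D r ^ d"
    unfolding S_def using sum.remove[OF finite_div d_in, of "\<lambda>\<gamma>. w \<gamma> * D r ^ \<gamma>"] by simp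
  finally show ?thesis by (simp add: algebra_simps)
qed

text \<open>The constant 8 is 4 times 2: 1 - cos t \<ge> \<delta>^2 / 4 on the outer arc, and 1 -
  exp (-u) \<ge> u / 2 at u = \<delta>^2 / 4. The factor d h r is merely bounded below by 1.\<close>

lemma norm_exp_cP_tail:
  assumes r: "r > 0" "h * r \<ge> 1" and \<delta>: "0 \<le> \<delta>" "\<delta> \<le> 1" "\<delta> \<le> \<bar>t\<bar>" "\<bar>t\<bar> \<le> pi"
  shows "cmod (exp (cP (of_real r * cis t))) \<le> exp (- (w d * D r ^ d * \<delta>\<^sup>2 / 8)) * exp (S 0 (D r))"
proof -
  have "cos \<bar>t\<bar> \<le> cos \<delta>"
    using \<delta> by (intro cos_monotone_0_pi_le) auto
  then have c: "1 - cos t \<ge> \<delta>\<^sup>2 / 4"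
    using one_minus_cos_ge[of \<delta>] \<delta> by simp
  have "1 * (\<delta>\<^sup>2 / 4) \<le> real d * (h * r) * (1 - cos t)"
  proof (rule mult_mono[OF _ c])
    have "1 * 1 \<le> real d * (h * r)" using r d by (intro mult_mono) auto
    then show "1 \<le> real d * (h * r)" by simp
  qed (use r h d in auto)
  then have "exp (- (real d * (h * r) * (1 - cos t))) \<le> exp (- (\<delta>\<^sup>2 / 4))"
    by simp
  moreover have "\<delta>\<^sup>2 \<le> 1" using \<delta> by (simp add: power_le_one)
  then have "1 - exp (- (\<delta>\<^sup>2 / 4)) \<ge> \<delta>\<^sup>2 / 4 / 2"
    by (intro one_minus_exp_neg_ge) auto
  ultimately have "1 - exp (- (real d * (h * r) * (1 - cos t))) \<ge> \<delta>\<^sup>2 / 8" by linarith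
  then have "w d * D r ^ d * (\<delta>\<^sup>2 / 8) \<le> w d * D r ^ d * (1 - exp (- (real d * (h * r) * (1 - cos t))))"
    using w_d D_pos[OF r(1)] by (intro mult_left_mono) auto
  then have "Re (cP (of_real r * cis t)) \<le> - (w d * D r ^ d * \<delta>\<^sup>2 / 8) + S 0 (D r)"
    using Re_cP_le[OF r(1), of t] by simp
  then show ?thesis by (simp flip: exp_add)
qed

end

text \<open>Stirling's formula is the saddle point asymptotics of the coefficients of \<open>exp z\<close>.\<close>

lemma Stirling_limit:
  "(\<lambda>n. fact n / (sqrt (2 * pi * real n) * real n ^ n * exp (- real n))) \<longlonglongrightarrow> 1"
proof -
  \<comment> \<open>The coefficients of P z = z. The saddle point is then r = n and all moments
    equal n.\<close>
  define p where "p = (\<lambda>k::nat. if k = 1 then 1 else 0 :: real)"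
  have p_sums: "(\<lambda>k. real k ^ j * (p k * real n ^ k)) sums real n" for j n
  proof -
    have "(\<lambda>k. real k ^ j * (p k * real n ^ k)) sums (\<Sum>k\<in>{1}. real k ^ j * (p k * real n ^ k))"
      by (rule sums_finite) (auto simp: p_def)
    then show ?thesis by (simp add: p_def)
  qed
  \<comment> \<open>The exponent has to lie between -1/2 and -1/3: here \<delta> sqrt n = n^(1/10)
    tends to infinity and n \<delta>^3 = n^(-1/5) tends to 0.\<close>
  define \<delta> where "\<delta> = (\<lambda>n. real n powr (-2/5))"
  define \<epsilon> where "\<epsilon> = (\<lambda>n. exp (- (real n * \<delta> n ^ 2 / 4)))"
  have \<delta>1: "eventually (\<lambda>n. 0 < \<delta> n \<and> \<delta> n \<le> 1) sequentially"
    using eventually_gt_at_top[of 0]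
  proof eventually_elim
    case (elim n)
    then have "\<delta> n \<le> real n powr 0"
      unfolding \<delta>_def by (intro powr_mono) auto
    then show ?case using elim by (simp add: \<delta>_def)
  qed
  have "(\<lambda>n. Re (fps_nth (fps_exp 1) n) * real n ^ n * sqrt (2 * pi * real n) / exp (Re (complex_of_real (real n)))) \<longlonglongrightarrow> 1"
  proof (rule saddle_point_asymptotics[where p = p and c = real and \<delta> = \<delta> and \<epsilon> = \<epsilon>])
    show "(\<lambda>k. of_real (p k) * z ^ k) sums z" for z :: complex
    proof -
      have "(\<lambda>k. of_real (p k) * z ^ k) sums (\<Sum>k\<in>{1}. of_real (p k) * z ^ k)"
        by (rule sums_finite) (auto simp: p_def)
      then show ?thesis by (simp add: p_def)
    qed
    show "eventually (\<lambda>n. 0 < \<delta> n \<and> \<delta> n \<le> pi) sequentially"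
      using \<delta>1 by eventually_elim (use pi_gt3 in linarith)
    show "filterlim (\<lambda>n. \<delta> n * sqrt (real n)) at_top sequentially"
      unfolding \<delta>_def by real_asymp
    show "(\<lambda>n. real n * \<delta> n ^ 3) \<longlonglongrightarrow> 0"
      unfolding \<delta>_def by real_asymp
    show "(\<lambda>n. sqrt (real n) * \<epsilon> n) \<longlonglongrightarrow> 0"
      unfolding \<delta>_def \<epsilon>_def by real_asymp
    show "\<forall>\<^sub>F n in sequentially. \<forall>t. \<delta> n \<le> \<bar>t\<bar> \<longrightarrow> \<bar>t\<bar> \<le> pi \<longrightarrow>
        cmod (exp (of_real (real n) * cis t)) \<le> \<epsilon> n * exp (Re (of_real (real n)))"
      using \<delta>1
    proof eventually_elim
      case (elim n)
      show ?case
      proof (intro allI impI)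
        fix t assume t: "\<delta> n \<le> \<bar>t\<bar>" "\<bar>t\<bar> \<le> pi"
        have "cos \<bar>t\<bar> \<le> cos (\<delta> n)"
          using t elim by (intro cos_monotone_0_pi_le) auto
        then have "1 - cos t \<ge> \<delta> n ^ 2 / 4"
          using one_minus_cos_ge[of "\<delta> n"] elim by simp
        then have "real n * (\<delta> n ^ 2 / 4) \<le> real n * (1 - cos t)"
          by (intro mult_left_mono) auto
        then show "cmod (exp (of_real (real n) * cis t)) \<le> \<epsilon> n * exp (Re (of_real (real n)))"
          by (simp add: \<epsilon>_def algebra_simps flip: exp_add)
      qed
    qed
  qed (use p_sums[of 1] p_sums[of 2] p_sums[of 3] in
      \<open>auto simp: p_def has_fps_expansion_exp1 intro: eventually_gt_at_top\<close>)
  then have "(\<lambda>n. inverse (Re (fps_nth (fps_exp 1) n) * real n ^ n * sqrt (2 * pi * real n) / exp (real n))) \<longlonglongrightarrow> inverse 1"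
    by (intro tendsto_inverse) auto
  moreover have "inverse (Re (fps_nth (fps_exp 1) n) * real n ^ n * sqrt (2 * pi * real n) / exp (real n)) =
      fact n / (sqrt (2 * pi * real n) * real n ^ n * exp (- real n))" for n
  proof -
    have "fps_nth (fps_exp 1) n = complex_of_real (1 / fact n)" by simp
    then have eq: "Re (fps_nth (fps_exp 1) n) = 1 / fact n" by (simp only: Re_complex_of_real)
    show ?thesis unfolding eq by (simp add: exp_minus field_simps)
  qed
  ultimately show ?thesis by simp
qed

section \<open>The saddle point method applied to \<open>exp cP\<close>\<close>

context delta_weights
begin

lemma filterlim_D: "filterlim D at_top at_top"
proof (rule filterlim_at_top_mono)
  show "filterlim (\<lambda>r. h * r) at_top at_top"
    using h by (intro filterlim_tendsto_pos_mult_at_top[OF tendsto_const] filterlim_ident)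
  show "eventually (\<lambda>r. h * r \<le> D r) at_top"
    using eventually_ge_at_top[of 0] by eventually_elim (rule D_ge)
qed

lemma thetaP2_ge:
  assumes "r > 0"
  shows "thetaP2 r \<ge> w d * D r ^ d"
proof -
  have hr: "h * r \<ge> 0" using assms h by simp
  have "w d * D r ^ d * 1 \<le> S 2 (D r) * Lam \<alpha> (h * r) ^ 2"
    using S_ge[of "D r" 2] D_pos[OF assms] S_nonneg[of "D r" 2] Lam_ge_1[OF hr, of \<alpha>] w_nonneg
    by (intro mult_mono one_le_power) auto
  moreover have "S 1 (D r) * Lam1 \<alpha> (h * r) \<ge> 0"
    using S_nonneg[of "D r" 1] D_pos[OF assms] Lam1_nonneg[OF hr] by simp
  ultimately show ?thesis by (simp add: thetaP2_def)
qed

lemma thetaP2_le: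
  assumes "r > 0" "h * r \<ge> 1"
  shows "thetaP2 r \<le> (S 2 1 + real \<alpha> * S 1 1) * (D r ^ d * Lam \<alpha> (h * r) ^ 2)"
proof -
  have D1: "D r \<ge> 1" using D_ge[of r] assms by simp
  have L: "Lam \<alpha> (h * r) \<ge> 1" using assms by (intro Lam_ge_1) auto
  have "S 2 (D r) * Lam \<alpha> (h * r) ^ 2 \<le> (S 2 1 * D r ^ d) * Lam \<alpha> (h * r) ^ 2"
    by (intro mult_right_mono S_le D1) auto
  moreover have "S 1 (D r) * Lam1 \<alpha> (h * r) \<le> (S 1 1 * D r ^ d) * (real \<alpha> * Lam \<alpha> (h * r) ^ 2)"
    using D1 L S_nonneg[of 1 1] assms Lam1_nonneg[of "h * r" \<alpha>]
    by (intro mult_mono S_le D1 Lam1_le') auto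
  ultimately show ?thesis unfolding thetaP2_def by (simp add: algebra_simps)
qed

lemma thetaP3_le:
  "\<exists>K. \<forall>r>0. h * r \<ge> 1 \<longrightarrow> thetaP3 r \<le> K * (D r ^ d * Lam \<alpha> (h * r) ^ 3)"
proof -
  obtain C where C: "\<And>z. z \<ge> 1 \<Longrightarrow> Lam2 \<alpha> z \<le> C * Lam \<alpha> z ^ 3"
    using Lam2_le by blast
  show ?thesis
  proof (intro exI allI impI)
    fix r :: real assume r: "r > 0" "h * r \<ge> 1"
    define L where "L = Lam \<alpha> (h * r)"
    have D1: "D r \<ge> 1" using D_ge[of r] r by simp
    have L: "L \<ge> 1" unfolding L_def using r by (intro Lam_ge_1) auto
    have "S 3 (D r) * L ^ 3 \<le> (S 3 1 * D r ^ d) * L ^ 3"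
      using L by (intro mult_right_mono S_le D1) auto
    moreover have "(3 * S 2 (D r) * L) * Lam1 \<alpha> (h * r) \<le> (3 * (S 2 1 * D r ^ d) * L) * (real \<alpha> * L ^ 2)"
      using D1 L S_nonneg[of 1 2] S_nonneg[of "D r" 2] r Lam1_nonneg[of "h * r" \<alpha>] Lam1_le'[of "h * r" \<alpha>]
      by (intro mult_mono S_le D1) (auto simp: L_def)
    moreover have "S 1 (D r) * Lam2 \<alpha> (h * r) \<le> (S 1 1 * D r ^ d) * (C * L ^ 3)"
      using D1 L S_nonneg[of 1 1] r Lam2_nonneg[of "h * r" \<alpha>] C[of "h * r"]
      by (intro mult_mono S_le D1) (auto simp: L_def)
    ultimately show "thetaP3 r \<le> (S 3 1 + 3 * real \<alpha> * S 2 1 + C * S 1 1) * (D r ^ d * Lam \<alpha> (h * r) ^ 3)"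
      unfolding thetaP3_def L_def[symmetric]
      by (simp add: algebra_simps power2_eq_square power3_eq_cube)
  qed
qed

text \<open>The exponent 1/30 is a convenient small one: with y = D^d, the cubic error on the
  central arc becomes y^(1 + 3/30 - 6/5) = y^(-1/10), which still tends to 0.\<close>

lemma ev_Lam_le: "eventually (\<lambda>r. Lam \<alpha> (h * r) \<le> (D r ^ d) powr (1/30)) at_top"
proof -
  have hlim: "filterlim (\<lambda>r. h * r) at_top at_top"
    using h by (intro filterlim_tendsto_pos_mult_at_top[OF tendsto_const] filterlim_ident)
  have "((\<lambda>z. Lam \<alpha> z / Delta \<alpha> z powr (1/30)) \<longlongrightarrow> 0) at_top"
    by (rule Lam_smallo_Delta_powr) simp
  from filterlim_compose[OF this hlim]
  have "eventually (\<lambda>r. Lam \<alpha> (h * r) / D r powr (1/30) < 1) at_top"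
    unfolding D_def by (intro order_tendstoD) auto
  moreover have "eventually (\<lambda>r. h * r \<ge> 1) at_top"
    using hlim by (simp add: filterlim_at_top)
  ultimately show ?thesis
    using eventually_gt_at_top[of 0]
  proof eventually_elim
    case (elim r)
    have D1: "D r \<ge> 1" using D_ge[of r] elim by simp
    have "Lam \<alpha> (h * r) \<le> D r powr (1/30)"
      using elim D1 by (simp add: divide_less_eq)
    also have "\<dots> \<le> (D r ^ d) powr (1/30)"
      using D1 d self_le_power[of "D r" d] by (intro powr_mono2) auto
    finally show ?case .
  qed
qed

text \<open>All conditions of the method are reduced to limits in the single variable y = D^d. For
  large n, up to constants, the second moment lies between y and y^(1 + 2/30), and the third is at
  most y^(1 + 3/30). The lower bound makes the central arc wide enough; the upper bounds control the
  cubic error and the tail.\<close>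

theorem coeff_asymptotics:
  assumes F: "(\<lambda>z. exp (cP z)) has_fps_expansion F"
    and r: "eventually (\<lambda>n. r n > 0 \<and> thetaP (r n) = real n) sequentially"
  shows "(\<lambda>n. Re (fps_nth F n) * r n ^ n * sqrt (2 * pi * thetaP2 (r n)) / exp (S 0 (D (r n)))) \<longlonglongrightarrow> 1"
proof -
  obtain p :: "nat \<Rightarrow> real" where p: "\<And>k. p k \<ge> 0" "\<And>z. (\<lambda>k. of_real (p k) * z ^ k) sums cP z"
    using ex_cP_series by blast
  have p_sums: "(\<lambda>k. p k * z ^ k) sums S 0 (D z)" for z :: real
  proof -
    have "(\<lambda>k. Re (of_real (p k) * of_real z ^ k)) sums Re (cP (of_real z))"
      by (intro sums_Re p)
    then show ?thesis by (simp add: cP_of_real flip: of_real_power)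
  qed
  obtain K where K: "\<And>r. r > 0 \<Longrightarrow> h * r \<ge> 1 \<Longrightarrow> thetaP3 r \<le> K * (D r ^ d * Lam \<alpha> (h * r) ^ 3)"
    using thetaP3_le by blast
  define K2 where "K2 = S 2 1 + real \<alpha> * S 1 1"
  have K2: "K2 > 0" using S_pos[of 1 2] S_pos[of 1 1] by (simp add: K2_def add_pos_nonneg)
  define y where "y = (\<lambda>n. D (r n) ^ d)"
  \<comment> \<open>Up to factors \<open>y\<^bsup>o(1)\<^esup>\<close>, both \<open>\<theta>\<^sup>2 P\<close> and \<open>\<theta>\<^sup>3 P\<close> are of size \<open>y\<close>, so any exponent
    strictly between \<open>-1/2\<close> and \<open>-1/3\<close> works.\<close>
  define \<delta> where "\<delta> = (\<lambda>n. y n powr (-2/5))"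
  \<comment> \<open>The factor of \<open>norm_exp_cP_tail\<close>; its exponent is of order y^(1/5),
    which beats every power of y.\<close>
  define \<epsilon> where "\<epsilon> = (\<lambda>n. exp (- (w d * y n * \<delta> n ^ 2 / 8)))"
  have rlim: "filterlim r at_top sequentially" by (rule filterlim_saddle[OF r])
  have ylim: "filterlim y at_top sequentially"
    unfolding y_def using d by (intro filterlim_pow_at_top filterlim_compose[OF filterlim_D rlim])
  have hlim: "filterlim (\<lambda>n. h * r n) at_top sequentially"
    using h by (intro filterlim_tendsto_pos_mult_at_top[OF tendsto_const] rlim)
  define good where "good = (\<lambda>n. r n > 0 \<and> thetaP (r n) = real n \<and> h * r n \<ge> 1 \<and> y n \<ge> 1 \<and>
      Lam \<alpha> (h * r n) \<le> y n powr (1/30))"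
  have "eventually (\<lambda>n. h * r n \<ge> 1) sequentially" "eventually (\<lambda>n. y n \<ge> 1) sequentially"
    using hlim ylim by (simp_all add: filterlim_at_top)
  moreover have "eventually (\<lambda>n. Lam \<alpha> (h * r n) \<le> y n powr (1/30)) sequentially"
    unfolding y_def using eventually_compose_filterlim[OF ev_Lam_le rlim] .
  ultimately have good: "eventually good sequentially"
    using r unfolding good_def by eventually_elim auto
  have Lam1: "Lam \<alpha> (h * r n) \<ge> 1" if "good n" for n
    using that by (intro Lam_ge_1) (auto simp: good_def)
  have \<delta>01: "0 < \<delta> n" "\<delta> n \<le> 1" if "good n" for n
  proof -
    have "\<delta> n \<le> y n powr 0"
      unfolding \<delta>_def using that by (intro powr_mono) (auto simp: good_def)
    then show "0 < \<delta> n" "\<delta> n \<le> 1" using that by (auto simp: \<delta>_def good_def)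
  qed
  have "(\<lambda>n. Re (fps_nth F n) * r n ^ n * sqrt (2 * pi * thetaP2 (r n)) / exp (Re (cP (of_real (r n))))) \<longlonglongrightarrow> 1"
  proof (rule saddle_point_asymptotics[where p = p and c = "\<lambda>n. thetaP3 (r n)" and \<delta> = \<delta> and \<epsilon> = \<epsilon>, OF p F])
    show "eventually (\<lambda>n. r n > 0) sequentially"
      using r by eventually_elim auto
    show "eventually (\<lambda>n. (\<lambda>k. real k * (p k * r n ^ k)) sums real n) sequentially"
      using r
    proof eventually_elim
      case (elim n)
      then show ?case using theta_sums(1)[OF p_sums, of "r n"] by simp
    qed
    show "eventually (\<lambda>n. (\<lambda>k. real k ^ 2 * (p k * r n ^ k)) sums thetaP2 (r n)) sequentially"
      using r by eventually_elim (auto intro!: theta_sums p_sums)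
    show "eventually (\<lambda>n. (\<lambda>k. real k ^ 3 * (p k * r n ^ k)) sums thetaP3 (r n)) sequentially"
      using r by eventually_elim (auto intro!: theta_sums p_sums)
    show "eventually (\<lambda>n. thetaP2 (r n) > 0) sequentially"
      using r
    proof eventually_elim
      case (elim n)
      then have "w d * D (r n) ^ d > 0" using D_pos[of "r n"] w_d by simp
      then show ?case using thetaP2_ge[of "r n"] elim by linarith
    qed
    show "eventually (\<lambda>n. 0 < \<delta> n \<and> \<delta> n \<le> pi) sequentially"
      using good
    proof eventually_elim
      case (elim n)
      then show ?case using \<delta>01[OF elim] pi_gt3 by linarith
    qed
    show "filterlim (\<lambda>n. \<delta> n * sqrt (thetaP2 (r n))) at_top sequentially"
    proof (rule filterlim_at_top_mono)
      have "filterlim (\<lambda>y. y powr (-2/5) * sqrt (w d * y)) at_top at_top"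
        using w_d by real_asymp
      from filterlim_compose[OF this ylim]
      show "filterlim (\<lambda>n. \<delta> n * sqrt (w d * y n)) at_top sequentially"
        by (simp add: \<delta>_def)
      show "eventually (\<lambda>n. \<delta> n * sqrt (w d * y n) \<le> \<delta> n * sqrt (thetaP2 (r n))) sequentially"
        using good
      proof eventually_elim
        case (elim n)
        then have "sqrt (w d * y n) \<le> sqrt (thetaP2 (r n))"
          using thetaP2_ge[of "r n"] by (simp add: y_def good_def)
        then show ?case using \<delta>01[OF elim] by (intro mult_left_mono) auto
      qed
    qed
    show "(\<lambda>n. thetaP3 (r n) * \<delta> n ^ 3) \<longlonglongrightarrow> 0"
    proof (rule Lim_null_comparison)
      have "((\<lambda>y. \<bar>K\<bar> * (y * (y powr (1/30)) ^ 3) * (y powr (-2/5)) ^ 3) \<longlongrightarrow> 0) at_top"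
        by real_asymp
      from filterlim_compose[OF this ylim]
      show "(\<lambda>n. \<bar>K\<bar> * (y n * (y n powr (1/30)) ^ 3) * \<delta> n ^ 3) \<longlonglongrightarrow> 0"
        by (simp add: \<delta>_def)
      show "eventually (\<lambda>n. norm (thetaP3 (r n) * \<delta> n ^ 3) \<le> \<bar>K\<bar> * (y n * (y n powr (1/30)) ^ 3) * \<delta> n ^ 3) sequentially"
        using good
      proof eventually_elim
        case (elim n)
        have rn: "r n > 0" "h * r n \<ge> 1" "y n \<ge> 1" using elim by (auto simp: good_def)
        have "thetaP3 (r n) \<ge> 0"
          by (rule sums_le[OF _ sums_zero theta_sums(3)[OF p_sums rn(1)]]) (use p rn in auto)
        moreover have "thetaP3 (r n) \<le> K * (y n * Lam \<alpha> (h * r n) ^ 3)"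
          unfolding y_def by (rule K[OF rn(1,2)])
        moreover have "K * (y n * Lam \<alpha> (h * r n) ^ 3) \<le> \<bar>K\<bar> * (y n * (y n powr (1/30)) ^ 3)"
          using Lam1[OF elim] rn elim
          by (intro mult_mono power_mono) (auto simp: good_def)
        ultimately have "\<bar>thetaP3 (r n)\<bar> \<le> \<bar>K\<bar> * (y n * (y n powr (1/30)) ^ 3)" by linarith
        then show ?case
          using \<delta>01[OF elim] by (simp add: abs_mult mult_right_mono)
      qed
    qed
    show "\<forall>\<^sub>F n in sequentially. \<forall>t. \<delta> n \<le> \<bar>t\<bar> \<longrightarrow> \<bar>t\<bar> \<le> pi \<longrightarrow>
        cmod (exp (cP (of_real (r n) * cis t))) \<le> \<epsilon> n * exp (Re (cP (of_real (r n))))"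
      using good
    proof eventually_elim
      case (elim n)
      then show ?case
        using norm_exp_cP_tail[of "r n" "\<delta> n"] \<delta>01[OF elim]
        by (simp add: good_def \<epsilon>_def y_def cP_of_real)
    qed
    show "(\<lambda>n. sqrt (thetaP2 (r n)) * \<epsilon> n) \<longlonglongrightarrow> 0"
    proof (rule Lim_null_comparison)
      have "((\<lambda>y. sqrt (K2 * (y * (y powr (1/30)) ^ 2)) * exp (- (w d * y * (y powr (-2/5)) ^ 2 / 8))) \<longlongrightarrow> 0) at_top"
        using K2 w_d by real_asymp
      from filterlim_compose[OF this ylim]
      show "(\<lambda>n. sqrt (K2 * (y n * (y n powr (1/30)) ^ 2)) * \<epsilon> n) \<longlonglongrightarrow> 0"
        by (simp add: \<delta>_def \<epsilon>_def)
      show "eventually (\<lambda>n. norm (sqrt (thetaP2 (r n)) * \<epsilon> n) \<le> sqrt (K2 * (y n * (y n powr (1/30)) ^ 2)) * \<epsilon> n) sequentially"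
        using good
      proof eventually_elim
        case (elim n)
        have rn: "r n > 0" "h * r n \<ge> 1" "y n \<ge> 1" using elim by (auto simp: good_def)
        have "thetaP2 (r n) \<ge> 0"
          by (rule sums_le[OF _ sums_zero theta_sums(2)[OF p_sums rn(1)]]) (use p rn in auto)
        moreover have "thetaP2 (r n) \<le> K2 * (y n * Lam \<alpha> (h * r n) ^ 2)"
          unfolding y_def K2_def by (rule thetaP2_le[OF rn(1,2)])
        moreover have "K2 * (y n * Lam \<alpha> (h * r n) ^ 2) \<le> K2 * (y n * (y n powr (1/30)) ^ 2)"
          using Lam1[OF elim] rn elim K2
          by (intro mult_left_mono power_mono) (auto simp: good_def)
        ultimately show ?case
          by (simp add: \<epsilon>_def)
      qed
    qed
  qed
  then show ?thesis by (simp add: cP_of_real)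
qed

lemma filterlim_h_saddle:
  assumes r: "eventually (\<lambda>n. r n > 0 \<and> thetaP (r n) = real n) sequentially"
  shows "filterlim (\<lambda>n. h * r n) at_top sequentially"
  using h by (intro filterlim_tendsto_pos_mult_at_top[OF tendsto_const] filterlim_saddle[OF r])

text \<open>With L = \<open>Lam \<alpha>\<close>, the quotient theta^2 P / theta P is L (S 2 / S 1 +
  \<open>Lam1 \<alpha>\<close> / L^2). Here S 2 / S 1 tends to d since the degree d dominates, the
  second term tends to 0 by the gain in \<open>Lam1_le\<close>, and L is asymptotic to the product
  of the lower towers.\<close>

lemma thetaP2_asymp:
  "((\<lambda>r. thetaP2 r / (real d * thetaP r * (\<Prod>i<\<alpha>. Delta i (h * r)))) \<longlongrightarrow> 1) at_top"
proof -
  have hlim: "filterlim (\<lambda>r. h * r) at_top at_top"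
    using h by (intro filterlim_tendsto_pos_mult_at_top[OF tendsto_const] filterlim_ident)
  have "((\<lambda>x. (S 2 x / x ^ d) / (S 1 x / x ^ d)) \<longlongrightarrow> (real d ^ 2 * w d) / (real d ^ 1 * w d)) at_top"
    using d w_d by (intro tendsto_divide S_asymp) auto
  also have "(real d ^ 2 * w d) / (real d ^ 1 * w d) = real d"
    using d w_d by (simp add: power2_eq_square)
  finally have "((\<lambda>x. (S 2 x / x ^ d) / (S 1 x / x ^ d)) \<longlongrightarrow> real d) at_top" .
  from filterlim_compose[OF this filterlim_D]
  have 1: "((\<lambda>r. (S 2 (D r) / D r ^ d) / (S 1 (D r) / D r ^ d)) \<longlongrightarrow> real d) at_top" .
  have 2: "((\<lambda>r. Lam1 \<alpha> (h * r) / Lam \<alpha> (h * r) ^ 2) \<longlongrightarrow> 0) at_top"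
  proof (rule Lim_null_comparison)
    have "((\<lambda>z::real. real \<alpha> / z) \<longlongrightarrow> 0) at_top" by real_asymp
    from filterlim_compose[OF this hlim] show "((\<lambda>r. real \<alpha> / (h * r)) \<longlongrightarrow> 0) at_top" .
    have "eventually (\<lambda>r. h * r \<ge> 1) at_top" using hlim by (simp add: filterlim_at_top)
    then show "eventually (\<lambda>r. norm (Lam1 \<alpha> (h * r) / Lam \<alpha> (h * r) ^ 2) \<le> real \<alpha> / (h * r)) at_top"
    proof eventually_elim
      case (elim r)
      then have "Lam \<alpha> (h * r) > 0" using Lam_ge_1[of "h * r" \<alpha>] by simp
      moreover have "Lam1 \<alpha> (h * r) \<ge> 0" using Lam1_nonneg[of "h * r" \<alpha>] elim by simp
      ultimately show ?case using Lam1_le[OF elim, of \<alpha>] by (simp add: divide_le_eq)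
    qed
  qed
  from filterlim_compose[OF Lam_asymp_prod_Delta hlim, of \<alpha>]
  have 3: "((\<lambda>r. Lam \<alpha> (h * r) / (\<Prod>i<\<alpha>. Delta i (h * r))) \<longlongrightarrow> 1) at_top" .
  have "((\<lambda>r. ((S 2 (D r) / D r ^ d) / (S 1 (D r) / D r ^ d) + Lam1 \<alpha> (h * r) / Lam \<alpha> (h * r) ^ 2)
      * (Lam \<alpha> (h * r) / (\<Prod>i<\<alpha>. Delta i (h * r))) / real d) \<longlongrightarrow> (real d + 0) * 1 / real d) at_top"
    using d by (intro tendsto_intros 1 2 3) auto
  then have "((\<lambda>r. ((S 2 (D r) / D r ^ d) / (S 1 (D r) / D r ^ d) + Lam1 \<alpha> (h * r) / Lam \<alpha> (h * r) ^ 2)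
      * (Lam \<alpha> (h * r) / (\<Prod>i<\<alpha>. Delta i (h * r))) / real d) \<longlongrightarrow> 1) at_top"
    using d by simp
  then show ?thesis
  proof (rule Lim_transform_eventually)
    show "\<forall>\<^sub>F r in at_top. ((S 2 (D r) / D r ^ d) / (S 1 (D r) / D r ^ d) + Lam1 \<alpha> (h * r) / Lam \<alpha> (h * r) ^ 2)
      * (Lam \<alpha> (h * r) / (\<Prod>i<\<alpha>. Delta i (h * r))) / real d =
      thetaP2 r / (real d * thetaP r * (\<Prod>i<\<alpha>. Delta i (h * r)))"
      using eventually_gt_at_top[of 0]
    proof eventually_elim
      case (elim r)
      define Q where "Q = (\<Prod>i<\<alpha>. Delta i (h * r))"
      define L where "L = Lam \<alpha> (h * r)"
      have nz: "D r \<noteq> 0" "S 1 (D r) \<noteq> 0" "L \<noteq> 0"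
        using D_pos[OF elim] S_pos[OF D_pos[OF elim], of 1] Lam_ge_1[of "h * r" \<alpha>] elim h
        by (auto simp: L_def)
      have e1: "(S 2 (D r) / D r ^ d) / (S 1 (D r) / D r ^ d) = S 2 (D r) / S 1 (D r)"
        using nz by simp
      have e2: "(S 2 (D r) / S 1 (D r) + Lam1 \<alpha> (h * r) / L ^ 2) * L = thetaP2 r / thetaP r"
        unfolding thetaP2_def thetaP_def L_def[symmetric] using nz
        by (simp add: field_simps power2_eq_square)
      have "(S 2 (D r) / S 1 (D r) + Lam1 \<alpha> (h * r) / L ^ 2) * (L / Q) / real d =
          thetaP2 r / thetaP r / (real d * Q)"
        unfolding e2[symmetric] by simp
      then show ?case
        unfolding L_def[symmetric] Q_def[symmetric] e1 by (simp add: mult_ac)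
    qed
  qed
qed

text \<open>Logarithms are taken in n = S 1 (D) \<open>Lam \<alpha>\<close>. Here ln (S 1 (D)) = d
  ln D + O(1) and ln D = ln (h r) + \<open>Delta (\<alpha> - 1)\<close>; the terms ln (h r) and ln
  (\<open>Lam \<alpha>\<close>) are of lower order. Division by d leaves the tower of height
  \<alpha> - 1.\<close>

lemma ln_index_asymp:
  assumes r: "eventually (\<lambda>n. r n > 0 \<and> thetaP (r n) = real n) sequentially"
  shows "(\<lambda>n. (1 / real d * ln (real n)) / Delta (\<alpha> - 1) (h * r n)) \<longlonglongrightarrow> 1"
proof -
  obtain a where a: "\<alpha> = Suc a" using \<alpha> by (cases \<alpha>) auto
  note hlim = filterlim_h_saddle[OF r]
  have Dlim: "filterlim (\<lambda>n. Delta a (h * r n)) at_top sequentially"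
    by (rule filterlim_compose[OF filterlim_Delta_at_top hlim])
  have "(\<lambda>n. S 1 (D (r n)) / D (r n) ^ d) \<longlonglongrightarrow> real d ^ 1 * w d"
    by (rule filterlim_compose[OF S_asymp filterlim_compose[OF filterlim_D filterlim_saddle[OF r]]])
  then have "(\<lambda>n. ln (S 1 (D (r n)) / D (r n) ^ d)) \<longlonglongrightarrow> ln (real d ^ 1 * w d)"
    using d w_d by (intro tendsto_ln) auto
  moreover have "(\<lambda>n. inverse (Delta a (h * r n))) \<longlonglongrightarrow> 0"
    using Dlim by (rule tendsto_inverse_0_at_top)
  ultimately have 1: "(\<lambda>n. ln (S 1 (D (r n)) / D (r n) ^ d) * inverse (Delta a (h * r n))) \<longlonglongrightarrow> ln (real d ^ 1 * w d) * 0"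
    by (rule tendsto_mult)
  have ev1: "eventually (\<lambda>n. h * r n \<ge> 1) sequentially"
    using hlim by (simp add: filterlim_at_top)
  have 2: "(\<lambda>n. ln (h * r n) / Delta a (h * r n)) \<longlonglongrightarrow> 0"
  proof (rule Lim_null_comparison)
    have "((\<lambda>x::real. ln x / x) \<longlongrightarrow> 0) at_top" by real_asymp
    from filterlim_compose[OF this hlim] show "(\<lambda>n. ln (h * r n) / (h * r n)) \<longlonglongrightarrow> 0" .
    show "eventually (\<lambda>n. norm (ln (h * r n) / Delta a (h * r n)) \<le> ln (h * r n) / (h * r n)) sequentially"
      using ev1
    proof eventually_elim
      case (elim n)
      then have le: "h * r n \<le> Delta a (h * r n)" by (intro Delta_ge) auto
      have "ln (h * r n) / Delta a (h * r n) \<le> ln (h * r n) / (h * r n)"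
        by (rule frac_le) (use elim le ln_ge_zero[OF elim] in linarith)+
      then show ?case using elim le by simp
    qed
  qed
  \<comment> \<open>Writing \<alpha> = Suc a, \<open>Lam a\<close> is eventually below
    \<open>Delta a\<close>, so \<open>Lam \<alpha>\<close> is at most 1 + (\<open>Delta a\<close>)^2
    and its logarithm is negligible against \<open>Delta a\<close>.\<close>
  have 3: "(\<lambda>n. ln (Lam \<alpha> (h * r n)) / Delta a (h * r n)) \<longlonglongrightarrow> 0"
  proof (rule Lim_null_comparison)
    have "((\<lambda>x::real. ln (1 + x ^ 2) / x) \<longlongrightarrow> 0) at_top" by real_asymp
    from filterlim_compose[OF this Dlim]
    show "(\<lambda>n. ln (1 + Delta a (h * r n) ^ 2) / Delta a (h * r n)) \<longlonglongrightarrow> 0" .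
    have "(\<lambda>n. Lam a (h * r n) / Delta a (h * r n) powr 1) \<longlonglongrightarrow> 0"
      by (rule filterlim_compose[OF Lam_smallo_Delta_powr hlim]) simp
    then have "eventually (\<lambda>n. Lam a (h * r n) / Delta a (h * r n) powr 1 < 1) sequentially"
      by (intro order_tendstoD) auto
    then show "eventually (\<lambda>n. norm (ln (Lam \<alpha> (h * r n)) / Delta a (h * r n))
        \<le> ln (1 + Delta a (h * r n) ^ 2) / Delta a (h * r n)) sequentially"
      using ev1
    proof eventually_elim
      case (elim n)
      define x where "x = Delta a (h * r n)"
      have x: "x \<ge> 1" using Delta_ge[of "h * r n" a] elim by (simp add: x_def)
      have L: "1 \<le> Lam \<alpha> (h * r n)" using elim by (intro Lam_ge_1) auto
      have "Lam a (h * r n) \<le> x" using elim x by (simp add: x_def[symmetric] divide_less_eq)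
      then have "x * Lam a (h * r n) \<le> x * x" using x by (intro mult_left_mono) auto
      then have "Lam \<alpha> (h * r n) \<le> 1 + x ^ 2"
        by (simp add: a x_def[symmetric] power2_eq_square)
      then have "ln (Lam \<alpha> (h * r n)) \<le> ln (1 + x ^ 2)" using L by simp
      then show ?case using L x by (simp add: x_def[symmetric] divide_right_mono)
    qed
  qed
  have "(\<lambda>n. (ln (S 1 (D (r n)) / D (r n) ^ d) * inverse (Delta a (h * r n)) + ln (Lam \<alpha> (h * r n)) / Delta a (h * r n)) / real d
      + ln (h * r n) / Delta a (h * r n) + 1) \<longlonglongrightarrow> (ln (real d ^ 1 * w d) * 0 + 0) / real d + 0 + 1"
    using d by (intro tendsto_add tendsto_divide tendsto_const 1 2 3) auto
  then have "(\<lambda>n. (ln (S 1 (D (r n)) / D (r n) ^ d) * inverse (Delta a (h * r n)) + ln (Lam \<alpha> (h * r n)) / Delta a (h * r n)) / real d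
      + ln (h * r n) / Delta a (h * r n) + 1) \<longlonglongrightarrow> 1"
    by simp
  then show ?thesis
  proof (rule Lim_transform_eventually)
    show "\<forall>\<^sub>F n in sequentially. (ln (S 1 (D (r n)) / D (r n) ^ d) * inverse (Delta a (h * r n)) + ln (Lam \<alpha> (h * r n)) / Delta a (h * r n)) / real d
      + ln (h * r n) / Delta a (h * r n) + 1 = (1 / real d * ln (real n)) / Delta (\<alpha> - 1) (h * r n)"
      using r
    proof eventually_elim
      case (elim n)
      define x where "x = Delta a (h * r n)"
      have hr: "h * r n > 0" using h elim by simp
      have x: "x > 0" unfolding x_def using hr by (rule Delta_pos)
      have Dn: "D (r n) > 0" using elim by (simp add: D_pos)
      have S1: "S 1 (D (r n)) > 0" by (rule S_pos[OF Dn])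
      have L: "Lam \<alpha> (h * r n) > 0" using Lam_ge_1[of "h * r n" \<alpha>] hr by linarith
      have "D (r n) = h * r n * exp x"
        unfolding D_def by (simp add: a x_def)
      then have lnD: "ln (D (r n)) = ln (h * r n) + x"
        using hr by (simp add: ln_mult_pos)
      have "ln (real n) = ln (S 1 (D (r n)) * Lam \<alpha> (h * r n))"
        using elim by (simp add: thetaP_def)
      also have "\<dots> = ln (S 1 (D (r n))) + ln (Lam \<alpha> (h * r n))"
        using S1 L by (simp add: ln_mult_pos)
      finally have n: "ln (real n) = ln (S 1 (D (r n))) + ln (Lam \<alpha> (h * r n))" .
      have q: "ln (S 1 (D (r n)) / D (r n) ^ d) = ln (S 1 (D (r n))) - real d * (ln (h * r n) + x)"
        using S1 Dn by (simp add: ln_divide_pos ln_realpow lnD)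
      show ?case
        unfolding q n using x d by (simp add: a x_def[symmetric] field_simps)
    qed
  qed
qed

text \<open>At the saddle point theta P is n. Of the product of towers only the lowest factor
  \<open>Delta 0\<close> = h r is replaced by the iterated logarithm; the factors with index at
  least 1 keep their form.\<close>

lemma thetaP2_saddle_asymp:
  assumes r: "eventually (\<lambda>n. r n > 0 \<and> thetaP (r n) = real n) sequentially"
  shows "(\<lambda>n. thetaP2 (r n) / (real n * (real d * (\<Prod>k=1..\<alpha> - 1. Delta k (h * r n))
           * (ln ^^ (\<alpha> - 1)) (1 / real d * ln (real n))))) \<longlonglongrightarrow> 1"
proof -
  note hlim = filterlim_h_saddle[OF r]
  obtain a where a: "\<alpha> = Suc a" using \<alpha> by (cases \<alpha>) auto
  have prod: "(\<Prod>i<\<alpha>. Delta i z) = z * (\<Prod>k=1..\<alpha> - 1. Delta k z)" for z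
  proof -
    have "(\<Prod>k=1..\<alpha> - 1. Delta k z) = (\<Prod>k<a. Delta (Suc k) z)"
      unfolding a by (rule prod.reindex_bij_witness[of _ Suc "\<lambda>k. k - 1"]) auto
    then show ?thesis unfolding a prod.lessThan_Suc_shift by simp
  qed
  have lim1: "(\<lambda>n. thetaP2 (r n) / (real d * thetaP (r n) * (\<Prod>i<\<alpha>. Delta i (h * r n)))) \<longlonglongrightarrow> 1"
    by (rule filterlim_compose[OF thetaP2_asymp filterlim_saddle[OF r]])
  have lim2: "(\<lambda>n. (ln ^^ (\<alpha> - 1)) (1 / real d * ln (real n)) / (h * r n)) \<longlonglongrightarrow> 1"
    by (rule ln_funpow_asymp_Delta[OF hlim ln_index_asymp[OF r]])
  have "(\<lambda>n. thetaP2 (r n) / (real d * thetaP (r n) * (\<Prod>i<\<alpha>. Delta i (h * r n)))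
      / ((ln ^^ (\<alpha> - 1)) (1 / real d * ln (real n)) / (h * r n))) \<longlonglongrightarrow> 1 / 1"
    by (intro tendsto_divide lim1 lim2) auto
  then have "(\<lambda>n. thetaP2 (r n) / (real d * thetaP (r n) * (\<Prod>i<\<alpha>. Delta i (h * r n)))
      / ((ln ^^ (\<alpha> - 1)) (1 / real d * ln (real n)) / (h * r n))) \<longlonglongrightarrow> 1"
    by simp
  then show ?thesis
  proof (rule Lim_transform_eventually)
    show "\<forall>\<^sub>F n in sequentially. thetaP2 (r n) / (real d * thetaP (r n) * (\<Prod>i<\<alpha>. Delta i (h * r n)))
      / ((ln ^^ (\<alpha> - 1)) (1 / real d * ln (real n)) / (h * r n)) =
      thetaP2 (r n) / (real n * (real d * (\<Prod>k=1..\<alpha> - 1. Delta k (h * r n))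
           * (ln ^^ (\<alpha> - 1)) (1 / real d * ln (real n))))"
      using r
    proof eventually_elim
      case (elim n)
      define M where "M = (ln ^^ (\<alpha> - 1)) (1 / real d * ln (real n))"
      define Q where "Q = (\<Prod>k=1..\<alpha> - 1. Delta k (h * r n))"
      have "h * r n \<noteq> 0" using elim h by simp
      then show ?case
        unfolding prod M_def[symmetric] Q_def[symmetric] using elim
        by (simp add: field_simps)
    qed
  qed
qed

text \<open>Multiplication by n! and Stirling's formula: both sqrt (2 pi) and the sqrt n contained
  in the variance cancel, and n^n exp (-n) becomes the term (log n - 1) n of the exponent.\<close>

theorem egf_coeff_asymptotics:
  assumes F: "(\<lambda>z. exp (cP z)) has_fps_expansion Abs_fps (\<lambda>n. of_real (s n / fact n))"
    and r: "eventually (\<lambda>n. r n > 0 \<and> thetaP (r n) = real n) sequentially"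
  shows "(\<lambda>n. s n / (1 / (r n ^ n * sqrt (real d * (\<Prod>k=1..\<alpha> - 1. Delta k (h * r n))
           * (ln ^^ (\<alpha> - 1)) (1 / real d * ln (real n))))
         * exp ((ln (real n) - 1) * real n + S 0 (D (r n))))) \<longlonglongrightarrow> 1"
proof -
  define Q where "Q = (\<lambda>n. real d * (\<Prod>k=1..\<alpha> - 1. Delta k (h * r n))
           * (ln ^^ (\<alpha> - 1)) (1 / real d * ln (real n)))"
  have lim1: "(\<lambda>n. s n / fact n * r n ^ n * sqrt (2 * pi * thetaP2 (r n)) / exp (S 0 (D (r n)))) \<longlonglongrightarrow> 1"
    using coeff_asymptotics[OF F r] by (simp only: fps_nth_Abs_fps Re_complex_of_real)
  have lim2: "(\<lambda>n. thetaP2 (r n) / (real n * Q n)) \<longlonglongrightarrow> 1"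
    unfolding Q_def by (rule thetaP2_saddle_asymp[OF r])
  then have lim3: "(\<lambda>n. sqrt (thetaP2 (r n) / (real n * Q n))) \<longlonglongrightarrow> sqrt 1"
    by (intro tendsto_real_sqrt)
  have "(\<lambda>n. (s n / fact n * r n ^ n * sqrt (2 * pi * thetaP2 (r n)) / exp (S 0 (D (r n))))
      * (fact n / (sqrt (2 * pi * real n) * real n ^ n * exp (- real n)))
      / sqrt (thetaP2 (r n) / (real n * Q n))) \<longlonglongrightarrow> 1 * 1 / sqrt 1"
    by (intro tendsto_divide tendsto_mult lim1 lim3 Stirling_limit) auto
  then have "(\<lambda>n. (s n / fact n * r n ^ n * sqrt (2 * pi * thetaP2 (r n)) / exp (S 0 (D (r n))))
      * (fact n / (sqrt (2 * pi * real n) * real n ^ n * exp (- real n)))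
      / sqrt (thetaP2 (r n) / (real n * Q n))) \<longlonglongrightarrow> 1"
    by simp
  then have "(\<lambda>n. s n / (1 / (r n ^ n * sqrt (Q n)) * exp ((ln (real n) - 1) * real n + S 0 (D (r n))))) \<longlonglongrightarrow> 1"
  proof (rule Lim_transform_eventually)
    \<comment> \<open>Positivity of \<open>Q n\<close>, and with it of the iterated logarithm, is
      read off from the limit 1 and need not be derived from the logarithms themselves.\<close>
    have "eventually (\<lambda>n. thetaP2 (r n) / (real n * Q n) > 0) sequentially"
      using lim2 by (intro order_tendstoD) auto
    then show "\<forall>\<^sub>F n in sequentially.
      (s n / fact n * r n ^ n * sqrt (2 * pi * thetaP2 (r n)) / exp (S 0 (D (r n))))
      * (fact n / (sqrt (2 * pi * real n) * real n ^ n * exp (- real n)))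
      / sqrt (thetaP2 (r n) / (real n * Q n)) =
      s n / (1 / (r n ^ n * sqrt (Q n)) * exp ((ln (real n) - 1) * real n + S 0 (D (r n))))"
      using r eventually_gt_at_top[of 0]
    proof eventually_elim
      case (elim n)
      have t: "thetaP2 (r n) > 0"
        using thetaP2_ge[of "r n"] mult_pos_pos[OF w_d zero_less_power[OF D_pos, of "r n" d]] elim by linarith
      have Q: "Q n > 0"
        using elim t by (auto simp: zero_less_divide_iff zero_less_mult_iff)
      have "exp ((ln (real n) - 1) * real n) = real n ^ n * exp (- real n)"
        using elim by (simp add: left_diff_distrib exp_diff exp_minus divide_inverse
            mult.commute[of "ln _"] exp_of_nat_mult)
      then have e: "exp ((ln (real n) - 1) * real n + S 0 (D (r n))) = real n ^ n * exp (- real n) * exp (S 0 (D (r n)))"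
        by (simp add: exp_add)
      have sq: "sqrt (2 * pi * thetaP2 (r n)) = sqrt (2 * pi) * sqrt (thetaP2 (r n))"
        "sqrt (2 * pi * real n) = sqrt (2 * pi) * sqrt (real n)"
        "sqrt (thetaP2 (r n) / (real n * Q n)) = sqrt (thetaP2 (r n)) / (sqrt (real n) * sqrt (Q n))"
        by (simp_all only: real_sqrt_mult real_sqrt_divide)
      have "sqrt (2 * pi) > 0" "sqrt (thetaP2 (r n)) > 0" "sqrt (Q n) > 0" "sqrt (real n) > 0"
        using t Q elim by simp_all
      then show ?case
        unfolding e sq by (simp add: divide_simps)
    qed
  qed
  then show ?thesis by (simp only: Q_def)
qed

end

section \<open>Counting solutions\<close>

text \<open>A map on a disjoint union is the pair of its restrictions. All three decompositions
  below are counted this way: the first layer of a forest, the periodic part of a solution, and a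
  single cycle.\<close>

lemma card_glue_extensional:
  assumes "A \<inter> B = {}" and U: "U \<subseteq> extensional A" and V: "V \<subseteq> extensional B"
  shows "card {g \<in> extensional (A \<union> B). restrict g A \<in> U \<and> restrict g B \<in> V} = card U * card V"
proof -
  have "bij_betw (\<lambda>g. (restrict g A, restrict g B))
      {g \<in> extensional (A \<union> B). restrict g A \<in> U \<and> restrict g B \<in> V} (U \<times> V)"
  proof (rule bij_betw_byWitness[where f' = "\<lambda>(u, v). (\<lambda>x. if x \<in> A then u x else v x)"])
    have *: "restrict (\<lambda>x. if x \<in> A then u x else v x) A = u"
      "restrict (\<lambda>x. if x \<in> A then u x else v x) B = v"
      "(\<lambda>x. if x \<in> A then u x else v x) \<in> extensional (A \<union> B)" if "u \<in> U" "v \<in> V" for u v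
      using assms that by (auto simp: fun_eq_iff extensional_def restrict_def)
    then show "\<forall>uv\<in>U \<times> V. (\<lambda>g. (restrict g A, restrict g B)) ((\<lambda>(u, v). (\<lambda>x. if x \<in> A then u x else v x)) uv) = uv"
      by auto
    show "(\<lambda>(u, v). (\<lambda>x. if x \<in> A then u x else v x)) ` (U \<times> V)
        \<subseteq> {g \<in> extensional (A \<union> B). restrict g A \<in> U \<and> restrict g B \<in> V}"
      using * by auto
  qed (auto simp: fun_eq_iff extensional_def restrict_def)
  then show ?thesis
    by (simp add: bij_betw_same_card card_cartesian_product)
qed

lemma sum_Pow_card:
  fixes F :: "nat \<Rightarrow> 'b::comm_semiring_1"
  assumes "finite M"
  shows "(\<Sum>K\<in>Pow M. F (card K)) = (\<Sum>k\<le>card M. of_nat (card M choose k) * F k)"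
proof -
  have "(\<Sum>K\<in>Pow M. F (card K)) = (\<Sum>k\<le>card M. \<Sum>K\<in>{K\<in>Pow M. card K = k}. F (card K))"
    using assms by (intro sum.group[symmetric]) (auto intro: card_mono)
  also have "\<dots> = (\<Sum>k\<le>card M. of_nat (card M choose k) * F k)"
  proof (rule sum.cong[OF refl])
    fix k
    have "(\<Sum>K\<in>{K\<in>Pow M. card K = k}. F (card K)) = of_nat (card {K. K \<subseteq> M \<and> card K = k}) * F k"
      by (simp add: Pow_def)
    then show "(\<Sum>K\<in>{K\<in>Pow M. card K = k}. F (card K)) = of_nat (card M choose k) * F k"
      using n_subsets[OF assms, of k] by simp
  qed
  finally show ?thesis .
qed

text \<open>The recursion stops at the first point in \<open>C\<close>, so the values of
  \<open>t\<close> on \<open>C\<close> do not matter. Forests need this, since their maps are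
  defined only off \<open>C\<close>; a condition on \<open>(t ^^ k) x\<close> would iterate beyond
  the domain.\<close>

primrec hits :: "('c \<Rightarrow> 'c) \<Rightarrow> 'c set \<Rightarrow> nat \<Rightarrow> 'c \<Rightarrow> bool" where
  "hits t C 0 x \<longleftrightarrow> x \<in> C"
| "hits t C (Suc k) x \<longleftrightarrow> x \<in> C \<or> hits t C k (t x)"

lemma hits_funpow: "(t ^^ k) x \<in> C \<Longrightarrow> hits t C k x"
  by (induction k arbitrary: x) (auto simp: funpow_Suc_right simp del: funpow.simps)

lemma funpow_closed: "(\<And>y. y \<in> C \<Longrightarrow> t y \<in> C) \<Longrightarrow> x \<in> C \<Longrightarrow> (t ^^ k) x \<in> C"
  by (induction k) auto

lemma funpow_mult_fixed: "(t ^^ k) x = x \<Longrightarrow> (t ^^ (k * m)) x = x"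
  by (induction m) (simp_all add: funpow_add)

lemma hits_imp_funpow:
  assumes "\<And>y. y \<in> C \<Longrightarrow> t y \<in> C"
  shows "hits t C k x \<Longrightarrow> (t ^^ k) x \<in> C"
proof (induction k arbitrary: x)
  case (Suc k)
  then show ?case
    using funpow_closed[of C t x "Suc k"] assms by (auto simp: funpow_Suc_right simp del: funpow.simps)
qed auto

text \<open>The points sent directly into \<open>C\<close> form the first layer, and every path into
  \<open>C\<close> passes through it. This layer takes over the role of \<open>C\<close> for the
  remaining points.\<close>

lemma hits_level:
  assumes t: "\<And>y. y \<in> M \<Longrightarrow> t y \<in> M \<union> C" and disj: "M \<inter> C = {}" and x: "x \<in> M"
  shows "hits t C (Suc k) x \<longleftrightarrow> hits t {y \<in> M. t y \<in> C} k x"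
  using x
proof (induction k arbitrary: x)
  case 0
  then show ?case using disj by auto
next
  case (Suc k)
  show ?case
  proof (cases "t x \<in> C")
    case False
    then have "t x \<in> M" using t Suc.prems by blast
    then have "hits t C (Suc k) (t x) \<longleftrightarrow> hits t {y \<in> M. t y \<in> C} k (t x)"
      by (rule Suc.IH)
    then show ?thesis using False Suc.prems disj by auto
  qed (use Suc.prems in auto)
qed

lemma hits_cong:
  assumes "\<And>y. y \<in> M \<Longrightarrow> t y = t' y" "\<And>y. y \<in> M \<Longrightarrow> t y \<in> M \<union> C" "x \<in> M \<union> C"
  shows "hits t C k x \<longleftrightarrow> hits t' C k x"
  using assms(3)
proof (induction k arbitrary: x)
  case (Suc k)
  show ?case
  proof (cases "x \<in> C")
    case False
    then have "x \<in> M" using Suc.prems by blast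
    then show ?thesis using Suc.IH[of "t x"] assms(1,2)[of x] by simp
  qed auto
qed auto

lemma funpow_cong_on:
  assumes "\<And>y. y \<in> C \<Longrightarrow> t y = t' y" "\<And>y. y \<in> C \<Longrightarrow> t y \<in> C" "x \<in> C"
  shows "(t ^^ k) x = (t' ^^ k) x"
proof (induction k)
  case (Suc k)
  have "(t ^^ k) x \<in> C" using assms(2,3) by (rule funpow_closed)
  then show ?case using assms(1) Suc by simp
qed auto

section \<open>The periodic part of a solution and the forests attached to it\<close>

context monoid
begin

text \<open>An element \<open>(f, \<tau>)\<close> of the wreath product is encoded as the single map \<open>g x = (f x, \<tau> x)\<close>.
  Then \<open>orbit_prod g m\<close> and \<open>(snd \<circ> g) ^^ m\<close> are the two components of \<open>(f, \<tau>)\<^sup>m\<close>, and cancelling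
  \<open>orbit_prod g a\<close> turns \<open>X\<^sup>a = X\<^bsup>a + d\<^esup>\<close> into the condition in \<open>solutions\<close>.\<close>

primrec orbit_prod :: "('c \<Rightarrow> 'a \<times> 'c) \<Rightarrow> nat \<Rightarrow> 'c \<Rightarrow> 'a" where
  "orbit_prod g 0 x = \<one>"
| "orbit_prod g (Suc m) x = orbit_prod g m x \<otimes> fst (g (((snd \<circ> g) ^^ m) x))"

definition solutions :: "nat \<Rightarrow> nat \<Rightarrow> 'c set \<Rightarrow> ('c \<Rightarrow> 'a \<times> 'c) set" where
  "solutions a d A = {g \<in> A \<rightarrow>\<^sub>E carrier G \<times> A.
     \<forall>x\<in>A. ((snd \<circ> g) ^^ d) (((snd \<circ> g) ^^ a) x) = ((snd \<circ> g) ^^ a) x \<and>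
           orbit_prod g d (((snd \<circ> g) ^^ a) x) = \<one>}"

text \<open>Rooted forests on \<open>M\<close> of height at most a hanging off the points of
  \<open>C\<close>, where every vertex of \<open>M\<close> carries an arbitrary element of the
  group.\<close>

definition forests :: "nat \<Rightarrow> 'c set \<Rightarrow> 'c set \<Rightarrow> ('c \<Rightarrow> 'a \<times> 'c) set" where
  "forests a C M = {g \<in> M \<rightarrow>\<^sub>E carrier G \<times> (M \<union> C). \<forall>x\<in>M. hits (snd \<circ> g) C a x}"

lemma orbit_prod_closed:
  assumes "\<And>y. y \<in> A \<Longrightarrow> g y \<in> carrier G \<times> A" "x \<in> A"
  shows "orbit_prod g m x \<in> carrier G"
proof (induction m)
  case (Suc m)
  have "((snd \<circ> g) ^^ m) x \<in> A"
    by (rule funpow_closed[OF _ assms(2)]) (use assms(1) in \<open>auto simp: mem_Times_iff\<close>)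
  then show ?case using Suc assms(1) by (auto simp: mem_Times_iff)
qed auto

lemma orbit_prod_add:
  assumes "\<And>y. y \<in> A \<Longrightarrow> g y \<in> carrier G \<times> A" "x \<in> A"
  shows "orbit_prod g (m + k) x = orbit_prod g m x \<otimes> orbit_prod g k (((snd \<circ> g) ^^ m) x)"
proof (induction k)
  case 0
  then show ?case using orbit_prod_closed[OF assms] by simp
next
  case (Suc k)
  have cl: "((snd \<circ> g) ^^ j) x \<in> A" for j
    by (rule funpow_closed[OF _ assms(2)]) (use assms(1) in \<open>auto simp: mem_Times_iff\<close>)
  have e: "((snd \<circ> g) ^^ k) (((snd \<circ> g) ^^ m) x) = ((snd \<circ> g) ^^ (m + k)) x"
    by (simp add: funpow_add add.commute[of m k])
  have c1: "orbit_prod g m x \<in> carrier G"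
    by (rule orbit_prod_closed[OF assms])
  have c2: "orbit_prod g k (((snd \<circ> g) ^^ m) x) \<in> carrier G"
    by (rule orbit_prod_closed[OF assms(1) cl])
  have c3: "fst (g (((snd \<circ> g) ^^ (m + k)) x)) \<in> carrier G"
    using assms(1)[OF cl[of "m + k"]] by (simp add: mem_Times_iff)
  show ?case
    unfolding add_Suc_right orbit_prod.simps Suc.IH e by (rule m_assoc[OF c1 c2 c3])
qed

lemma orbit_prod_cong_on:
  assumes "\<And>y. y \<in> C \<Longrightarrow> g y = g' y" "\<And>y. y \<in> C \<Longrightarrow> snd (g y) \<in> C" "x \<in> C"
  shows "orbit_prod g m x = orbit_prod g' m x"
proof (induction m)
  case (Suc m)
  have "((snd \<circ> g) ^^ m) x \<in> C"
    by (rule funpow_closed[OF _ assms(3)]) (use assms(2) in auto)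
  moreover have "((snd \<circ> g) ^^ m) x = ((snd \<circ> g') ^^ m) x"
    by (rule funpow_cong_on[of C]) (use assms in auto)
  ultimately show ?case using Suc assms(1) by simp
qed auto

lemma forests_0: "M \<inter> C = {} \<Longrightarrow> forests 0 C M = (if M = {} then {\<lambda>_. undefined} else {})"
  unfolding forests_def by auto

text \<open>\<open>K\<close> is the first layer, the vertices mapped directly into \<open>C\<close>;
  the rest is a forest of height at most a hanging off \<open>K\<close>. The second claim recovers
  \<open>K\<close> from g, which makes the union disjoint.\<close>

lemma forests_Suc:
  assumes disj: "M \<inter> C = {}"
  shows "forests (Suc a) C M = (\<Union>K\<in>Pow M. {g \<in> extensional (K \<union> (M - K)).
      restrict g K \<in> (K \<rightarrow>\<^sub>E carrier G \<times> C) \<and> restrict g (M - K) \<in> forests a K (M - K)})"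
    (is "_ = (\<Union>K\<in>_. ?R K)")
    and "K \<subseteq> M \<Longrightarrow> g \<in> {g \<in> extensional (K \<union> (M - K)).
      restrict g K \<in> (K \<rightarrow>\<^sub>E carrier G \<times> C) \<and> restrict g (M - K) \<in> forests a K (M - K)} \<Longrightarrow>
      K = {x \<in> M. snd (g x) \<in> C}"
proof -
  have K_eq: "K = {x \<in> M. snd (g x) \<in> C}" if "K \<subseteq> M" "g \<in> ?R K" for K g
  proof -
    have "snd (g x) \<in> C" if "x \<in> K" for x
      using \<open>g \<in> ?R K\<close> that by (auto simp: PiE_iff mem_Times_iff split: if_splits)
    moreover have "snd (g x) \<notin> C" if "x \<in> M - K" for x
      using \<open>g \<in> ?R K\<close> \<open>K \<subseteq> M\<close> that disj
      by (auto simp: forests_def PiE_iff mem_Times_iff split: if_splits)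
    ultimately show ?thesis using \<open>K \<subseteq> M\<close> by blast
  qed
  then show "K \<subseteq> M \<Longrightarrow> g \<in> {g \<in> extensional (K \<union> (M - K)).
      restrict g K \<in> (K \<rightarrow>\<^sub>E carrier G \<times> C) \<and> restrict g (M - K) \<in> forests a K (M - K)} \<Longrightarrow>
      K = {x \<in> M. snd (g x) \<in> C}" by blast
  show "forests (Suc a) C M = (\<Union>K\<in>Pow M. ?R K)"
  proof (intro equalityI subsetI)
    fix g assume g: "g \<in> forests (Suc a) C M"
    define K where "K = {x \<in> M. snd (g x) \<in> C}"
    have KM: "K \<subseteq> M" by (auto simp: K_def)
    have gM: "g x \<in> carrier G \<times> (M \<union> C)" if "x \<in> M" for x
      using g that by (auto simp: forests_def PiE_iff)
    have gK: "g x \<in> carrier G \<times> C" if "x \<in> K" for x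
      using gM[of x] that by (auto simp: K_def mem_Times_iff)
    have gMK: "g x \<in> carrier G \<times> ((M - K) \<union> K)" if "x \<in> M - K" for x
      using gM[of x] that by (auto simp: K_def mem_Times_iff)
    have "hits (snd \<circ> restrict g (M - K)) K a x" if x: "x \<in> M - K" for x
    proof -
      have "hits (snd \<circ> g) C (Suc a) x" using g x by (auto simp: forests_def simp del: hits.simps)
      then have "hits (snd \<circ> g) {y \<in> M. (snd \<circ> g) y \<in> C} a x"
        using hits_level[of M "snd \<circ> g" C x a] gM disj x by (auto simp: mem_Times_iff simp del: hits.simps)
      then have "hits (snd \<circ> g) K a x" by (simp add: K_def)
      moreover have "hits (snd \<circ> g) K a x \<longleftrightarrow> hits (snd \<circ> restrict g (M - K)) K a x"
        by (rule hits_cong[of "M - K"]) (use gMK x in \<open>auto simp: mem_Times_iff\<close>)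
      ultimately show ?thesis by simp
    qed
    then have "restrict g (M - K) \<in> forests a K (M - K)"
      using gMK by (auto simp: forests_def PiE_iff simp del: hits.simps)
    moreover have "restrict g K \<in> (K \<rightarrow>\<^sub>E carrier G \<times> C)"
      using gK by auto
    moreover have "g \<in> extensional (K \<union> (M - K))"
      using g KM by (auto simp: forests_def PiE_iff Un_absorb1)
    ultimately show "g \<in> (\<Union>K\<in>Pow M. ?R K)"
      using KM by blast
  next
    fix g assume "g \<in> (\<Union>K\<in>Pow M. ?R K)"
    then obtain K where K: "K \<subseteq> M" "g \<in> ?R K" by blast
    have gK: "g x \<in> carrier G \<times> C" if "x \<in> K" for x
      using K that by (auto simp: PiE_iff split: if_splits)
    have gMK: "g x \<in> carrier G \<times> ((M - K) \<union> K)" if "x \<in> M - K" for x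
      using K that by (auto simp: forests_def PiE_iff split: if_splits)
    have gM: "g x \<in> carrier G \<times> (M \<union> C)" if "x \<in> M" for x
      using gK[of x] gMK[of x] that K(1) by (cases "x \<in> K") (auto simp: mem_Times_iff)
    have "hits (snd \<circ> g) C (Suc a) x" if x: "x \<in> M" for x
    proof -
      have "hits (snd \<circ> g) K a x"
      proof (cases "x \<in> K")
        case True
        then show ?thesis by (cases a) auto
      next
        case False
        then have "hits (snd \<circ> restrict g (M - K)) K a x"
          using K x by (auto simp: forests_def simp del: hits.simps)
        moreover have "hits (snd \<circ> g) K a x \<longleftrightarrow> hits (snd \<circ> restrict g (M - K)) K a x"
          by (rule hits_cong[of "M - K"]) (use gMK x in \<open>auto simp: mem_Times_iff\<close>)
        ultimately show ?thesis by simp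
      qed
      then have "hits (snd \<circ> g) {y \<in> M. (snd \<circ> g) y \<in> C} a x"
        using K_eq[OF K] by simp
      then show ?thesis
        using hits_level[of M "snd \<circ> g" C x a] gM disj x by (auto simp: mem_Times_iff simp del: hits.simps)
    qed
    moreover have "g \<in> extensional M"
      using K by (auto simp: Un_absorb1)
    ultimately show "g \<in> forests (Suc a) C M"
      using gM by (auto simp: forests_def PiE_iff simp del: hits.simps)
  qed
qed

text \<open>Each vertex of the first layer chooses its label and its target in \<open>C\<close>
  independently, hence the power with exponent \<open>card K\<close>.\<close>

lemma card_forests_Suc:
  assumes M: "finite M" and C: "finite C" and G: "finite (carrier G)" and disj: "M \<inter> C = {}"
  shows "card (forests (Suc a) C M) =
    (\<Sum>K\<in>Pow M. (card (carrier G) * card C) ^ card K * card (forests a K (M - K)))"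
proof -
  define R where "R = (\<lambda>K. {g \<in> extensional (K \<union> (M - K)).
      restrict g K \<in> (K \<rightarrow>\<^sub>E carrier G \<times> C) \<and> restrict g (M - K) \<in> forests a K (M - K)})"
  have eq: "forests (Suc a) C M = (\<Union>K\<in>Pow M. R K)"
    unfolding R_def by (rule forests_Suc(1)[OF disj])
  have "forests (Suc a) C M \<subseteq> M \<rightarrow>\<^sub>E carrier G \<times> (M \<union> C)"
    by (auto simp: forests_def)
  then have fin: "finite (forests (Suc a) C M)"
    by (rule finite_subset) (use M C G in \<open>auto intro!: finite_PiE\<close>)
  have "card (forests (Suc a) C M) = (\<Sum>K\<in>Pow M. card (R K))"
    unfolding eq
  proof (rule card_UN_disjoint)
    show "\<forall>K\<in>Pow M. finite (R K)"
      using finite_subset[OF UN_upper fin[unfolded eq]] by simp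
    show "\<forall>K\<in>Pow M. \<forall>K'\<in>Pow M. K \<noteq> K' \<longrightarrow> R K \<inter> R K' = {}"
    proof (intro ballI impI equals0I)
      fix K K' g assume "K \<in> Pow M" "K' \<in> Pow M" "K \<noteq> K'" "g \<in> R K \<inter> R K'"
      then show False
        using forests_Suc(2)[OF disj, of K g a] forests_Suc(2)[OF disj, of K' g a]
        unfolding R_def by simp
    qed
  qed (use M in auto)
  also have "\<dots> = (\<Sum>K\<in>Pow M. (card (carrier G) * card C) ^ card K * card (forests a K (M - K)))"
  proof (rule sum.cong[OF refl])
    fix K assume "K \<in> Pow M"
    then have K: "finite K" using M finite_subset by auto
    have "card (R K) = card (K \<rightarrow>\<^sub>E carrier G \<times> C) * card (forests a K (M - K))"
      unfolding R_def by (rule card_glue_extensional) (auto simp: forests_def PiE_iff)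
    also have "card (K \<rightarrow>\<^sub>E carrier G \<times> C) = (card (carrier G) * card C) ^ card K"
      using K by (simp add: card_PiE card_cartesian_product)
    finally show "card (R K) = (card (carrier G) * card C) ^ card K * card (forests a K (M - K))" .
  qed
  finally show ?thesis .
qed

text \<open>\<open>C\<close> consists of the points of period dividing d. In a solution every point
  enters \<open>C\<close> within a steps, and the product condition concerns \<open>C\<close> only:
  there it is the condition with exponent 0, while labels off \<open>C\<close> are free. As
  \<open>C\<close> can be recovered from g, the union is disjoint.\<close>

lemma solutions_split:
  assumes d: "d > 0"
  shows "solutions a d A = (\<Union>C\<in>Pow A. {g \<in> extensional (C \<union> (A - C)).
      restrict g C \<in> solutions 0 d C \<and> restrict g (A - C) \<in> forests a C (A - C)})"
    (is "_ = (\<Union>C\<in>_. ?R C)")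
    and "C \<subseteq> A \<Longrightarrow> g \<in> {g \<in> extensional (C \<union> (A - C)).
      restrict g C \<in> solutions 0 d C \<and> restrict g (A - C) \<in> forests a C (A - C)} \<Longrightarrow>
      C = {x \<in> A. ((snd \<circ> g) ^^ d) x = x}"
proof -
  have R: "g \<in> solutions a d A \<and> C = {x \<in> A. ((snd \<circ> g) ^^ d) x = x}" if CA: "C \<subseteq> A" and g: "g \<in> ?R C" for C g
  proof -
    have gC: "g x \<in> carrier G \<times> C" if "x \<in> C" for x
      using g that by (auto simp: solutions_def PiE_iff split: if_splits)
    have gAC: "g x \<in> carrier G \<times> A" if "x \<in> A - C" for x
      using g that CA by (auto simp: forests_def PiE_iff mem_Times_iff split: if_splits)
    have gA: "g x \<in> carrier G \<times> A" if "x \<in> A" for x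
      using gC[of x] gAC[of x] that CA by (cases "x \<in> C") (auto simp: mem_Times_iff)
    have tC: "(snd \<circ> g) x \<in> C" if "x \<in> C" for x
      using gC[OF that] by (auto simp: mem_Times_iff)
    have C1: "((snd \<circ> g) ^^ d) x = x \<and> orbit_prod g d x = \<one>" if x: "x \<in> C" for x
    proof -
      have "((snd \<circ> restrict g C) ^^ d) x = x \<and> orbit_prod (restrict g C) d x = \<one>"
        using g x by (auto simp: solutions_def)
      moreover have "((snd \<circ> g) ^^ d) x = ((snd \<circ> restrict g C) ^^ d) x"
        by (rule funpow_cong_on[of C]) (use x tC in auto)
      moreover have "orbit_prod g d x = orbit_prod (restrict g C) d x"
        by (rule orbit_prod_cong_on[of C]) (use x tC in auto)
      ultimately show ?thesis by simp
    qed
    have aC: "((snd \<circ> g) ^^ a) x \<in> C" if x: "x \<in> A" for x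
    proof (cases "x \<in> C")
      case True
      show ?thesis by (rule funpow_closed[OF tC True])
    next
      case False
      then have "hits (snd \<circ> restrict g (A - C)) C a x"
        using g x by (auto simp: forests_def)
      moreover have "hits (snd \<circ> g) C a x \<longleftrightarrow> hits (snd \<circ> restrict g (A - C)) C a x"
        by (rule hits_cong[of "A - C"]) (use x False gA CA in \<open>auto simp: mem_Times_iff\<close>)
      ultimately show ?thesis using hits_imp_funpow[of C "snd \<circ> g"] tC by blast
    qed
    have "x \<in> C" if x: "x \<in> A" and per: "((snd \<circ> g) ^^ d) x = x" for x
    proof -
      \<comment> \<open>A point of period d also returns after d a \<ge> a steps. Its first a steps
        lead into \<open>C\<close>, the remaining ones stay there, so the point itself lies in
        \<open>C\<close>.\<close>
      have e: "(d * a - a) + a = d * a" using d by (cases d) auto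
      have "((snd \<circ> g) ^^ ((d * a - a) + a)) x = ((snd \<circ> g) ^^ (d * a - a)) (((snd \<circ> g) ^^ a) x)"
        by (simp only: funpow_add comp_apply)
      then have "((snd \<circ> g) ^^ (d * a)) x = ((snd \<circ> g) ^^ (d * a - a)) (((snd \<circ> g) ^^ a) x)"
        by (simp only: e)
      moreover have "((snd \<circ> g) ^^ (d * a - a)) (((snd \<circ> g) ^^ a) x) \<in> C"
        by (rule funpow_closed[OF tC aC[OF x]])
      ultimately show ?thesis using funpow_mult_fixed[OF per, of a] by simp
    qed
    then have "C = {x \<in> A. ((snd \<circ> g) ^^ d) x = x}" using C1 CA by blast
    moreover have "g \<in> solutions a d A"
    proof -
      have "g \<in> extensional A" using g CA by (auto simp: Un_absorb1)
      then show ?thesis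
        unfolding solutions_def PiE_iff using gA C1[OF aC] by blast
    qed
    ultimately show ?thesis by blast
  qed
  then show "C \<subseteq> A \<Longrightarrow> g \<in> {g \<in> extensional (C \<union> (A - C)).
      restrict g C \<in> solutions 0 d C \<and> restrict g (A - C) \<in> forests a C (A - C)} \<Longrightarrow>
      C = {x \<in> A. ((snd \<circ> g) ^^ d) x = x}" by blast
  show "solutions a d A = (\<Union>C\<in>Pow A. ?R C)"
  proof (intro equalityI subsetI)
    fix g assume g: "g \<in> solutions a d A"
    define C where "C = {x \<in> A. ((snd \<circ> g) ^^ d) x = x}"
    have CA: "C \<subseteq> A" by (auto simp: C_def)
    have gA: "g x \<in> carrier G \<times> A" if "x \<in> A" for x
      using g that by (auto simp: solutions_def PiE_iff)
    have tA: "(snd \<circ> g) x \<in> A" if "x \<in> A" for x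
      using gA[OF that] by (auto simp: mem_Times_iff)
    have tC: "(snd \<circ> g) x \<in> C" if "x \<in> C" for x
    proof -
      have "((snd \<circ> g) ^^ d) ((snd \<circ> g) x) = (snd \<circ> g) (((snd \<circ> g) ^^ d) x)"
        by (simp only: funpow_swap1)
      then show ?thesis using that tA unfolding C_def by auto
    qed
    have gC: "g x \<in> carrier G \<times> C" if "x \<in> C" for x
      using gA[of x] tC[of x] that CA by (auto simp: mem_Times_iff)
    have aC: "((snd \<circ> g) ^^ a) x \<in> C" if x: "x \<in> A" for x
    proof -
      have "((snd \<circ> g) ^^ a) x \<in> A" by (rule funpow_closed[OF tA x])
      then show ?thesis using g x by (auto simp: C_def solutions_def)
    qed
    have prodC: "orbit_prod g d x = \<one>" if x: "x \<in> C" for x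
    proof -
      \<comment> \<open>The product condition is given only at a-th images. A periodic x is such an
        image, namely of the point reached from x after d a - a steps.\<close>
      have e: "a + (d * a - a) = d * a" using d by (cases d) auto
      have "((snd \<circ> g) ^^ (a + (d * a - a))) x = ((snd \<circ> g) ^^ a) (((snd \<circ> g) ^^ (d * a - a)) x)"
        by (simp only: funpow_add comp_apply)
      then have "((snd \<circ> g) ^^ (d * a)) x = ((snd \<circ> g) ^^ a) (((snd \<circ> g) ^^ (d * a - a)) x)"
        by (simp only: e)
      moreover have "((snd \<circ> g) ^^ (d * a)) x = x"
        using x by (intro funpow_mult_fixed) (auto simp: C_def)
      moreover have "((snd \<circ> g) ^^ (d * a - a)) x \<in> A"
        by (rule funpow_closed[OF tA]) (use x CA in auto)
      moreover have "orbit_prod g d (((snd \<circ> g) ^^ a) y) = \<one>" if "y \<in> A" for y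
        using g that by (auto simp: solutions_def)
      ultimately show ?thesis by metis
    qed
    have "restrict g C \<in> solutions 0 d C"
    proof -
      have "((snd \<circ> restrict g C) ^^ d) x = x \<and> orbit_prod (restrict g C) d x = \<one>" if x: "x \<in> C" for x
      proof -
        have "((snd \<circ> g) ^^ d) x = ((snd \<circ> restrict g C) ^^ d) x"
          by (rule funpow_cong_on[of C]) (use x tC in auto)
        moreover have "orbit_prod g d x = orbit_prod (restrict g C) d x"
          by (rule orbit_prod_cong_on[of C]) (use x tC in auto)
        ultimately show ?thesis using x prodC[OF x] by (auto simp: C_def)
      qed
      then show ?thesis using gC by (auto simp: solutions_def PiE_iff)
    qed
    moreover have "restrict g (A - C) \<in> forests a C (A - C)"
    proof -
      have "hits (snd \<circ> restrict g (A - C)) C a x" if x: "x \<in> A - C" for x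
      proof -
        have "hits (snd \<circ> g) C a x" using aC x by (intro hits_funpow) auto
        moreover have "hits (snd \<circ> g) C a x \<longleftrightarrow> hits (snd \<circ> restrict g (A - C)) C a x"
          by (rule hits_cong[of "A - C"]) (use x gA CA in \<open>auto simp: mem_Times_iff\<close>)
        ultimately show ?thesis by simp
      qed
      then show ?thesis using gA CA by (fastforce simp: forests_def PiE_iff mem_Times_iff)
    qed
    moreover have "g \<in> extensional (C \<union> (A - C))"
      using g CA by (auto simp: solutions_def PiE_iff Un_absorb1)
    ultimately show "g \<in> (\<Union>C\<in>Pow A. ?R C)" using CA by blast
  next
    fix g assume "g \<in> (\<Union>C\<in>Pow A. ?R C)"
    then show "g \<in> solutions a d A" using R by blast
  qed
qed

lemma finite_solutions: "finite A \<Longrightarrow> finite (carrier G) \<Longrightarrow> finite (solutions a d A)"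
  by (rule finite_subset[of _ "A \<rightarrow>\<^sub>E carrier G \<times> A"]) (auto simp: solutions_def intro!: finite_PiE)

lemma card_solutions_split:
  assumes d: "d > 0" and A: "finite A" and G: "finite (carrier G)"
  shows "card (solutions a d A) = (\<Sum>C\<in>Pow A. card (solutions 0 d C) * card (forests a C (A - C)))"
proof -
  define R where "R = (\<lambda>C. {g \<in> extensional (C \<union> (A - C)).
      restrict g C \<in> solutions 0 d C \<and> restrict g (A - C) \<in> forests a C (A - C)})"
  have eq: "solutions a d A = (\<Union>C\<in>Pow A. R C)"
    unfolding R_def by (rule solutions_split(1)[OF d])
  have "card (solutions a d A) = (\<Sum>C\<in>Pow A. card (R C))"
    unfolding eq
  proof (rule card_UN_disjoint)
    show "\<forall>C\<in>Pow A. finite (R C)"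
      using finite_subset[OF UN_upper finite_solutions[OF A G, of a d, unfolded eq]] by simp
    show "\<forall>C\<in>Pow A. \<forall>C'\<in>Pow A. C \<noteq> C' \<longrightarrow> R C \<inter> R C' = {}"
    proof (intro ballI impI equals0I)
      fix C C' g assume "C \<in> Pow A" "C' \<in> Pow A" "C \<noteq> C'" "g \<in> R C \<inter> R C'"
      then show False
        using solutions_split(2)[OF d, of C A g a] solutions_split(2)[OF d, of C' A g a]
        unfolding R_def by simp
    qed
  qed (use A in auto)
  also have "\<dots> = (\<Sum>C\<in>Pow A. card (solutions 0 d C) * card (forests a C (A - C)))"
    unfolding R_def
    by (intro sum.cong refl card_glue_extensional) (auto simp: forests_def solutions_def PiE_iff)
  finally show ?thesis .
qed

text \<open>A cycle is given by the list of its points in order, with \<open>rotate1\<close> as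
  successor. The product condition is imposed at the head only; when the length divides d, the
  products at the other points are conjugate to it.\<close>

definition cycle_maps :: "nat \<Rightarrow> 'c list \<Rightarrow> ('c \<Rightarrow> 'a \<times> 'c) set" where
  "cycle_maps d xs = {u \<in> set xs \<rightarrow>\<^sub>E carrier G \<times> set xs.
     (\<forall>i<length xs. snd (u (xs ! i)) = rotate1 xs ! i) \<and> orbit_prod u d (hd xs) = \<one>}"

lemma funpow_cycle:
  assumes "xs \<noteq> []" "\<And>i. i < length xs \<Longrightarrow> snd (u (xs ! i)) = rotate1 xs ! i"
  shows "((snd \<circ> u) ^^ i) (hd xs) = xs ! (i mod length xs)"
proof (induction i)
  case 0
  then show ?case using assms by (simp add: hd_conv_nth)
next
  case (Suc i)
  have "i mod length xs < length xs" using assms by simp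
  then show ?case using Suc assms(2) by (simp add: nth_rotate1 mod_Suc_eq)
qed

lemma orbit_prod_cycle:
  assumes "xs \<noteq> []" "\<And>i. i < length xs \<Longrightarrow> snd (u (xs ! i)) = rotate1 xs ! i"
  shows "orbit_prod u (length xs) (hd xs) = foldl (\<otimes>) \<one> (map (fst \<circ> u) xs)"
proof -
  have "orbit_prod u k (hd xs) = foldl (\<otimes>) \<one> (map (fst \<circ> u) (take k xs))" if "k \<le> length xs" for k
    using that
  proof (induction k)
    case (Suc k)
    have "((snd \<circ> u) ^^ k) (hd xs) = xs ! k"
      using funpow_cycle[of xs u k] assms Suc.prems by simp
    then show ?case using Suc by (simp add: take_Suc_conv_app_nth)
  qed auto
  from this[of "length xs"] show ?thesis by simp
qed

text \<open>Going round a cycle m times raises the cycle product to the power m. This is how the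
  condition over d steps becomes one on m-th roots of unity, with m = d / \<gamma>.\<close>

lemma orbit_prod_mult_period:
  assumes "\<And>y. y \<in> A \<Longrightarrow> g y \<in> carrier G \<times> A" "x \<in> A" "((snd \<circ> g) ^^ k) x = x"
  shows "orbit_prod g (k * m) x = orbit_prod g k x [^] m"
proof (induction m)
  case (Suc m)
  have per: "((snd \<circ> g) ^^ (k * m)) x = x"
    by (rule funpow_mult_fixed[OF assms(3)])
  have "orbit_prod g (k * m + k) x = orbit_prod g (k * m) x \<otimes> orbit_prod g k (((snd \<circ> g) ^^ (k * m)) x)"
    by (rule orbit_prod_add[OF assms(1,2)])
  then show ?case using Suc per by (simp add: add.commute)
qed auto

lemma foldl_mult_closed:
  assumes "set hs \<subseteq> carrier G" "y \<in> carrier G"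
  shows "foldl (\<otimes>) y hs \<in> carrier G"
  using assms by (induction hs arbitrary: y) auto

end

section \<open>Counting labelled cycles and solutions without a tail\<close>

context group
begin

text \<open>The first k labels are free, and so is the total product among the solutions of x^m = 1;
  the last label is then determined.\<close>

lemma card_lists_root_of_unity:
  assumes fin: "finite (carrier G)"
  shows "card {hs. set hs \<subseteq> carrier G \<and> length hs = Suc k \<and> foldl (\<otimes>) \<one> hs [^] m = \<one>}
    = card (carrier G) ^ k * iota G m"
proof -
  let ?P = "foldl (\<otimes>) \<one>"
  have P: "?P ys \<in> carrier G" if "set ys \<subseteq> carrier G" for ys
    using that by (rule foldl_mult_closed) simp
  have "bij_betw (\<lambda>(ys, c). ys @ [inv (?P ys) \<otimes> c])
      ({ys. set ys \<subseteq> carrier G \<and> length ys = k} \<times> {x \<in> carrier G. x [^] m = \<one>})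
      {hs. set hs \<subseteq> carrier G \<and> length hs = Suc k \<and> ?P hs [^] m = \<one>}"
  proof (rule bij_betw_byWitness[where f' = "\<lambda>hs. (butlast hs, ?P hs)"], goal_cases)
    case 1
    then show ?case using P by (auto simp: m_assoc[symmetric])
  next
    case 2
    show ?case
    proof
      fix hs assume "hs \<in> {hs. set hs \<subseteq> carrier G \<and> length hs = Suc k \<and> ?P hs [^] m = \<one>}"
      then obtain ys y where hs: "hs = ys @ [y]" "set ys \<subseteq> carrier G" "y \<in> carrier G"
        by (cases hs rule: rev_cases) auto
      then show "(case (butlast hs, ?P hs) of (ys, c) \<Rightarrow> ys @ [inv (?P ys) \<otimes> c]) = hs"
        using P[of ys] by (auto simp: m_assoc[symmetric])
    qed
  next
    case 3
    then show ?case using P by (auto simp: m_assoc[symmetric])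
  next
    case 4
    then show ?case
      using P by (auto dest: in_set_butlastD)
  qed
  then have "card {hs. set hs \<subseteq> carrier G \<and> length hs = Suc k \<and> ?P hs [^] m = \<one>} =
      card ({ys. set ys \<subseteq> carrier G \<and> length ys = k} \<times> {x \<in> carrier G. x [^] m = \<one>})"
    by (simp add: bij_betw_same_card)
  also have "\<dots> = card (carrier G) ^ k * iota G m"
    using fin by (simp add: card_cartesian_product card_lists_length_eq iota_def)
  finally show ?thesis .
qed

lemma card_cycle_maps:
  assumes fin: "finite (carrier G)" and xs: "distinct xs" "xs \<noteq> []" "length xs dvd d"
  shows "card (cycle_maps d xs) = card (carrier G) ^ (length xs - 1) * iota G (d div length xs)"
proof -
  let ?P = "foldl (\<otimes>) \<one>"
  define m where "m = d div length xs"
  have d: "d = length xs * m" using xs by (simp add: m_def)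
  \<comment> \<open>The inverse of reading off the labels: each point of the cycle is looked up
    together with its label and its successor.\<close>
  define mk where "mk = (\<lambda>hs :: 'a list. restrict (\<lambda>y. the (map_of (zip xs (zip hs (rotate1 xs))) y)) (set xs))"
  have mk: "mk hs (xs ! i) = (hs ! i, rotate1 xs ! i)" if "length hs = length xs" "i < length xs" for hs i
    using that xs by (simp add: mk_def map_of_zip_nth)
  have prod_eq: "orbit_prod u d (hd xs) = ?P (map (fst \<circ> u) xs) [^] m"
    if u: "u \<in> set xs \<rightarrow>\<^sub>E carrier G \<times> set xs" "\<And>i. i < length xs \<Longrightarrow> snd (u (xs ! i)) = rotate1 xs ! i" for u
  proof -
    have "((snd \<circ> u) ^^ length xs) (hd xs) = hd xs"
      using funpow_cycle[of xs u "length xs"] xs u by (simp add: hd_conv_nth)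
    then have "orbit_prod u (length xs * m) (hd xs) = orbit_prod u (length xs) (hd xs) [^] m"
      using u xs by (intro orbit_prod_mult_period[of "set xs"]) auto
    then show ?thesis
      using orbit_prod_cycle[of xs u] xs u d by simp
  qed
  have mem_nth: "\<exists>i<length xs. y = xs ! i" if "y \<in> set xs" for y
    using that by (auto simp: in_set_conv_nth)
  have "bij_betw (\<lambda>u. map (fst \<circ> u) xs) (cycle_maps d xs)
     {hs. set hs \<subseteq> carrier G \<and> length hs = Suc (length xs - 1) \<and> ?P hs [^] m = \<one>}"
  proof (rule bij_betw_byWitness[where f' = mk])
    show "\<forall>u\<in>cycle_maps d xs. mk (map (fst \<circ> u) xs) = u"
    proof
      fix u assume u: "u \<in> cycle_maps d xs"
      show "mk (map (fst \<circ> u) xs) = u"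
      proof
        fix y
        show "mk (map (fst \<circ> u) xs) y = u y"
        proof (cases "y \<in> set xs")
          case True
          then obtain i where "i < length xs" "y = xs ! i" using mem_nth by blast
          then show ?thesis using u mk[of "map (fst \<circ> u) xs" i]
            by (auto simp: cycle_maps_def prod_eq_iff)
        next
          case False
          then show ?thesis using u by (auto simp: mk_def cycle_maps_def PiE_iff extensional_def)
        qed
      qed
    qed
    show "\<forall>hs\<in>{hs. set hs \<subseteq> carrier G \<and> length hs = Suc (length xs - 1) \<and> ?P hs [^] m = \<one>}. map (fst \<circ> mk hs) xs = hs"
      using mk xs by (auto intro!: nth_equalityI)
    show "(\<lambda>u. map (fst \<circ> u) xs) ` cycle_maps d xs
        \<subseteq> {hs. set hs \<subseteq> carrier G \<and> length hs = Suc (length xs - 1) \<and> ?P hs [^] m = \<one>}"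
    proof (rule image_subsetI)
      fix u assume u: "u \<in> cycle_maps d xs"
      then have "?P (map (fst \<circ> u) xs) [^] m = \<one>"
        using prod_eq[of u] by (simp add: cycle_maps_def)
      moreover have "set (map (fst \<circ> u) xs) \<subseteq> carrier G"
        using u by (auto simp: cycle_maps_def PiE_iff mem_Times_iff)
      ultimately show "map (fst \<circ> u) xs \<in> {hs. set hs \<subseteq> carrier G \<and> length hs = Suc (length xs - 1) \<and> ?P hs [^] m = \<one>}"
        using xs by simp
    qed
    show "mk ` {hs. set hs \<subseteq> carrier G \<and> length hs = Suc (length xs - 1) \<and> ?P hs [^] m = \<one>} \<subseteq> cycle_maps d xs"
    proof (rule image_subsetI)
      fix hs assume "hs \<in> {hs. set hs \<subseteq> carrier G \<and> length hs = Suc (length xs - 1) \<and> ?P hs [^] m = \<one>}"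
      then have hs: "set hs \<subseteq> carrier G" "length hs = length xs" "?P hs [^] m = \<one>"
        using xs by auto
      have 1: "snd (mk hs (xs ! i)) = rotate1 xs ! i" if "i < length xs" for i
        using mk[OF hs(2) that] by simp
      have "mk hs y \<in> carrier G \<times> set xs" if y: "y \<in> set xs" for y
      proof -
        obtain i where i: "i < length xs" "y = xs ! i" using mem_nth[OF y] by blast
        have "rotate1 xs ! i \<in> set (rotate1 xs)" using i by (intro nth_mem) simp
        then show ?thesis using mk[OF hs(2) i(1)] i hs nth_mem[of i hs] by auto
      qed
      then have 2: "mk hs \<in> set xs \<rightarrow>\<^sub>E carrier G \<times> set xs"
        by (auto simp: PiE_iff mk_def)
      have "map (fst \<circ> mk hs) xs = hs"
        using mk hs by (auto intro!: nth_equalityI)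
      then have "orbit_prod (mk hs) d (hd xs) = \<one>"
        using prod_eq[OF 2 1] hs by simp
      then show "mk hs \<in> cycle_maps d xs"
        using 1 2 by (simp add: cycle_maps_def)
    qed
  qed
  then have "card (cycle_maps d xs) = card {hs. set hs \<subseteq> carrier G \<and> length hs = Suc (length xs - 1) \<and> ?P hs [^] m = \<one>}"
    by (rule bij_betw_same_card)
  then show ?thesis using card_lists_root_of_unity[OF fin] by (simp add: m_def)
qed

text \<open>Fixing the head at x gives every cycle through x exactly one list, so no division by the
  number of rotations is needed.\<close>

definition cycle_lists :: "nat \<Rightarrow> 'c \<Rightarrow> 'c set \<Rightarrow> 'c list set" where
  "cycle_lists d x A = {xs. distinct xs \<and> set xs \<subseteq> A \<and> xs \<noteq> [] \<and> hd xs = x \<and> length xs dvd d}"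

text \<open>Since the d-th power of the map is the identity, the map permutes A. So the cycle of x
  can be removed, and its complement is again invariant. The second claim, that g determines the
  list, makes the union disjoint.\<close>

lemma solutions_0_split:
  assumes d: "d > 0" and x: "x \<in> A"
  shows "solutions 0 d A = (\<Union>xs\<in>cycle_lists d x A. {g \<in> extensional (set xs \<union> (A - set xs)).
      restrict g (set xs) \<in> cycle_maps d xs \<and> restrict g (A - set xs) \<in> solutions 0 d (A - set xs)})"
    (is "_ = (\<Union>xs\<in>_. ?R xs)")
    and "xs \<in> cycle_lists d x A \<Longrightarrow> ys \<in> cycle_lists d x A \<Longrightarrow>
      restrict g (set xs) \<in> cycle_maps d xs \<Longrightarrow> restrict g (set ys) \<in> cycle_maps d ys \<Longrightarrow> xs = ys"
proof -
  have step: "snd (g (xs ! i)) = rotate1 xs ! i"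
    if "restrict g (set xs) \<in> cycle_maps d xs" "i < length xs" for g :: "'c \<Rightarrow> 'a \<times> 'c" and xs i
    using that by (auto simp: cycle_maps_def)
  have le: "length xs \<le> length ys \<Longrightarrow> xs = ys"
    if xs: "xs \<in> cycle_lists d x A" "ys \<in> cycle_lists d x A"
      "restrict g (set xs) \<in> cycle_maps d xs" "restrict g (set ys) \<in> cycle_maps d ys" for xs ys and g :: "'c \<Rightarrow> 'a \<times> 'c"
  proof -
    assume len: "length xs \<le> length ys"
    have ne: "xs \<noteq> []" "ys \<noteq> []" "hd xs = x" "hd ys = x" "distinct ys"
      using xs by (auto simp: cycle_lists_def)
    have 1: "((snd \<circ> g) ^^ i) x = xs ! (i mod length xs)" for i
      using funpow_cycle[of xs g i] step[OF xs(3)] ne by simp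
    have 2: "((snd \<circ> g) ^^ i) x = ys ! (i mod length ys)" for i
      using funpow_cycle[of ys g i] step[OF xs(4)] ne by simp
    have "length xs = length ys"
    proof (rule ccontr)
      assume "length xs \<noteq> length ys"
      then have lt: "length xs < length ys" using len by simp
      have "ys ! length xs = ys ! 0"
        using 1[of "length xs"] 2[of "length xs"] 1[of 0] 2[of 0] lt by simp
      then show False
        using \<open>distinct ys\<close> lt ne nth_eq_iff_index_eq[of ys "length xs" 0] by auto
    qed
    moreover have "xs ! i = ys ! i" if "i < length xs" for i
      using 1[of i] 2[of i] that \<open>length xs = length ys\<close> by simp
    ultimately show "xs = ys" by (rule nth_equalityI)
  qed
  show "xs \<in> cycle_lists d x A \<Longrightarrow> ys \<in> cycle_lists d x A \<Longrightarrow>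
      restrict g (set xs) \<in> cycle_maps d xs \<Longrightarrow> restrict g (set ys) \<in> cycle_maps d ys \<Longrightarrow> xs = ys"
    using le[of xs ys g] le[of ys xs g] by (cases "length xs \<le> length ys") auto
  show "solutions 0 d A = (\<Union>xs\<in>cycle_lists d x A. ?R xs)"
  proof (intro equalityI subsetI)
    fix g assume g: "g \<in> solutions 0 d A"
    let ?t = "snd \<circ> g"
    have gA: "g y \<in> carrier G \<times> A" if "y \<in> A" for y
      using g that by (auto simp: solutions_def PiE_iff)
    have tA: "?t y \<in> A" if "y \<in> A" for y
      using gA[OF that] by (auto simp: mem_Times_iff)
    have td: "(?t ^^ d) y = y" "orbit_prod g d y = \<one>" if "y \<in> A" for y
      using g that by (auto simp: solutions_def)
    \<comment> \<open>Any iterate with i \<le> d is injective on A because d - i further steps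
      restore the starting point.\<close>
    have t_inj: "y = z" if "y \<in> A" "z \<in> A" "(?t ^^ i) y = (?t ^^ i) z" "i \<le> d" for y z i
    proof -
      have "(?t ^^ (d - i)) ((?t ^^ i) y) = (?t ^^ (d - i)) ((?t ^^ i) z)"
        using that by simp
      then have "(?t ^^ (d - i + i)) y = (?t ^^ (d - i + i)) z"
        by (simp only: funpow_add comp_apply)
      then show ?thesis using td that by simp
    qed
    define k where "k = (LEAST k. k > 0 \<and> (?t ^^ k) x = x)"
    have k: "k > 0 \<and> (?t ^^ k) x = x"
      unfolding k_def by (rule LeastI[of _ d]) (use d td x in auto)
    have k_least: "k \<le> j" if "j > 0" "(?t ^^ j) x = x" for j
      unfolding k_def using that by (intro Least_le) auto
    \<comment> \<open>Unless it is 0, this remainder would be a positive period smaller than the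
      least one.\<close>
    have "(?t ^^ (d mod k)) x = x"
      using funpow_mod_eq[where f = ?t and n = k and x = x and m = d] k td(1)[OF x] by simp
    then have kd: "k dvd d"
      using k_least[of "d mod k"] k by (meson dvd_eq_mod_eq_0 mod_less_divisor not_gr_zero not_le)
    then have kd_le: "k \<le> d" using d dvd_imp_le by auto
    define xs where "xs = map (\<lambda>i. (?t ^^ i) x) [0..<k]"
    have len: "length xs = k" by (simp add: xs_def)
    have nth: "xs ! i = (?t ^^ i) x" if "i < k" for i using that by (simp add: xs_def)
    have xsA: "set xs \<subseteq> A"
      using funpow_closed[of A ?t x] tA x by (auto simp: xs_def)
    have neq: "(?t ^^ i) x \<noteq> (?t ^^ j) x" if ij: "i < j" "j < k" for i j
    proof
      assume "(?t ^^ i) x = (?t ^^ j) x"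
      also have "j = i + (j - i)" using ij by simp
      then have "(?t ^^ j) x = (?t ^^ i) ((?t ^^ (j - i)) x)"
        by (metis comp_apply funpow_add)
      finally have "x = (?t ^^ (j - i)) x"
        using ij kd_le funpow_closed[of A ?t x "j - i"] tA x by (intro t_inj[of x _ i]) auto
      then show False using k_least[of "j - i"] ij by simp
    qed
    have dist: "distinct xs"
      unfolding distinct_conv_nth len
    proof (intro allI impI)
      fix i j assume "i < k" "j < k" "i \<noteq> j"
      then show "xs ! i \<noteq> xs ! j"
        using neq[of i j] neq[of j i] nth[of i] nth[of j] by (cases "i < j") auto
    qed
    have ne: "xs \<noteq> []" using len k by auto
    have hd: "hd xs = x" using ne nth[of 0] k by (simp add: hd_conv_nth)
    have L: "xs \<in> cycle_lists d x A"
      using dist xsA ne hd kd len by (simp add: cycle_lists_def)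
    have st: "snd (g (xs ! i)) = rotate1 xs ! i" if "i < length xs" for i
    proof -
      have i: "i < k" using that len by simp
      have "snd (g (xs ! i)) = (?t ^^ Suc i) x" using nth[OF i] by simp
      also have "\<dots> = xs ! (Suc i mod k)"
      proof (cases "Suc i = k")
        case True
        then have "(?t ^^ Suc i) x = x" using k by blast
        moreover have "Suc i mod k = 0" using True by simp
        ultimately show ?thesis using nth[of 0] k by simp
      next
        case False
        then show ?thesis using i nth[of "Suc i"] by simp
      qed
      finally show ?thesis using i len by (simp add: nth_rotate1)
    qed
    have cl: "?t y \<in> set xs" if y: "y \<in> set xs" for y
    proof -
      obtain i where i: "i < length xs" "y = xs ! i" using y by (auto simp: in_set_conv_nth)
      have "rotate1 xs ! i \<in> set (rotate1 xs)" using i by (intro nth_mem) simp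
      then show ?thesis using st[OF i(1)] i by simp
    qed
    \<comment> \<open>A point outside the cycle cannot enter it: d - 1 further steps inside the
      cycle would lead back to that point.\<close>
    have cl': "?t y \<in> A - set xs" if y: "y \<in> A - set xs" for y
    proof -
      have "?t y \<notin> set xs"
      proof
        assume "?t y \<in> set xs"
        then have "(?t ^^ (d - 1)) (?t y) \<in> set xs"
          using cl by (intro funpow_closed[of "set xs" ?t "?t y" "d - 1"])
        moreover have "(?t ^^ (d - 1)) (?t y) = (?t ^^ d) y"
          using d by (metis Suc_diff_1 comp_apply funpow_Suc_right)
        ultimately show False using td y by simp
      qed
      then show ?thesis using tA y by simp
    qed
    have "restrict g (set xs) \<in> cycle_maps d xs"
    proof -
      have "orbit_prod g d x = orbit_prod (restrict g (set xs)) d x"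
        by (rule orbit_prod_cong_on[of "set xs"]) (use cl hd ne in auto)
      then have "orbit_prod (restrict g (set xs)) d (hd xs) = \<one>"
        using td(2)[OF x] hd by simp
      moreover have "restrict g (set xs) \<in> set xs \<rightarrow>\<^sub>E carrier G \<times> set xs"
      proof (subst restrict_PiE_iff, intro ballI)
        fix y assume y: "y \<in> set xs"
        then show "g y \<in> carrier G \<times> set xs"
          using gA[of y] cl[OF y] xsA by (auto simp: mem_Times_iff)
      qed
      ultimately show ?thesis using st by (simp add: cycle_maps_def)
    qed
    moreover have "restrict g (A - set xs) \<in> solutions 0 d (A - set xs)"
    proof -
      have "((snd \<circ> restrict g (A - set xs)) ^^ d) y = y \<and> orbit_prod (restrict g (A - set xs)) d y = \<one>"
        if y: "y \<in> A - set xs" for y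
      proof -
        have "(?t ^^ d) y = ((snd \<circ> restrict g (A - set xs)) ^^ d) y"
          by (rule funpow_cong_on[of "A - set xs"]) (use y cl' in auto)
        moreover have "orbit_prod g d y = orbit_prod (restrict g (A - set xs)) d y"
          by (rule orbit_prod_cong_on[of "A - set xs"]) (use y cl' in auto)
        ultimately show ?thesis using td[of y] y by simp
      qed
      moreover have "restrict g (A - set xs) \<in> (A - set xs) \<rightarrow>\<^sub>E carrier G \<times> (A - set xs)"
      proof (subst restrict_PiE_iff, intro ballI)
        fix y assume y: "y \<in> A - set xs"
        then show "g y \<in> carrier G \<times> (A - set xs)"
          using gA[of y] cl'[OF y] by (simp add: mem_Times_iff)
      qed
      ultimately show ?thesis by (simp add: solutions_def)
    qed
    moreover have "g \<in> extensional (set xs \<union> (A - set xs))"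
      using g xsA by (auto simp: solutions_def PiE_iff Un_absorb1)
    ultimately show "g \<in> (\<Union>xs\<in>cycle_lists d x A. ?R xs)" using L by blast
  next
    fix g assume "g \<in> (\<Union>xs\<in>cycle_lists d x A. ?R xs)"
    then obtain xs where L: "xs \<in> cycle_lists d x A" and g: "g \<in> ?R xs" by blast
    let ?t = "snd \<circ> g"
    have ne: "xs \<noteq> []" "hd xs = x" "distinct xs" "set xs \<subseteq> A" "length xs dvd d"
      using L by (auto simp: cycle_lists_def)
    have gxs: "g y \<in> carrier G \<times> set xs" if "y \<in> set xs" for y
      using g that by (auto simp: cycle_maps_def PiE_iff split: if_splits)
    have gr: "g y \<in> carrier G \<times> (A - set xs)" if "y \<in> A - set xs" for y
      using g that by (auto simp: solutions_def PiE_iff split: if_splits)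
    have gA: "g y \<in> carrier G \<times> A" if "y \<in> A" for y
      using gxs[of y] gr[of y] that ne by (cases "y \<in> set xs") (auto simp: mem_Times_iff)
    have it: "(?t ^^ i) x = xs ! (i mod length xs)" for i
      using funpow_cycle[of xs g i] step[of g xs] g ne by simp
    have dx: "(?t ^^ d) x = x"
      using it[of d] it[of 0] ne by simp
    have px: "orbit_prod g d x = \<one>"
    proof -
      have "orbit_prod g d x = orbit_prod (restrict g (set xs)) d x"
        by (rule orbit_prod_cong_on[of "set xs"]) (use gxs ne in \<open>auto simp: mem_Times_iff\<close>)
      then show ?thesis using g ne by (simp add: cycle_maps_def)
    qed
    have sol: "(?t ^^ d) y = y \<and> orbit_prod g d y = \<one>" if y: "y \<in> A" for y
    proof (cases "y \<in> set xs")
      case True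
      then obtain i where i: "i < length xs" "y = xs ! i" by (auto simp: in_set_conv_nth)
      then have yi: "y = (?t ^^ i) x" using it[of i] by simp
      have "(?t ^^ d) y = (?t ^^ (d + i)) x" by (simp only: yi funpow_add comp_apply)
      also have "\<dots> = (?t ^^ i) ((?t ^^ d) x)" by (simp only: add.commute[of d] funpow_add comp_apply)
      finally have 1: "(?t ^^ d) y = y" using dx yi by simp
      \<comment> \<open>The product over i + d steps from x is split in two ways. Since the product
        over d steps at x is 1 and x has period d, cancelling the product over i steps gives the
        value 1 at y as well; this is the conjugacy of the cycle products.\<close>
      have a: "orbit_prod g (i + d) x = orbit_prod g i x \<otimes> orbit_prod g d y"
        using orbit_prod_add[OF gA x, where m = i and k = d] yi by simp
      have b: "orbit_prod g (d + i) x = orbit_prod g d x \<otimes> orbit_prod g i x"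
        using orbit_prod_add[OF gA x, where m = d and k = i] dx by simp
      have c: "orbit_prod g i x \<in> carrier G" "orbit_prod g d y \<in> carrier G"
        using orbit_prod_closed[OF gA x] orbit_prod_closed[OF gA y] by auto
      have "orbit_prod g i x \<otimes> orbit_prod g d y = orbit_prod g i x"
        using a b px c by (simp add: add.commute)
      then have "orbit_prod g d y = \<one>"
        using c by (simp add: r_cancel_one)
      with 1 show ?thesis by simp
    next
      case False
      then have y': "y \<in> A - set xs" using y by simp
      have "(?t ^^ d) y = ((snd \<circ> restrict g (A - set xs)) ^^ d) y"
        by (rule funpow_cong_on[of "A - set xs"]) (use y' gr in \<open>auto simp: mem_Times_iff\<close>)
      moreover have "orbit_prod g d y = orbit_prod (restrict g (A - set xs)) d y"
        by (rule orbit_prod_cong_on[of "A - set xs"]) (use y' gr in \<open>auto simp: mem_Times_iff\<close>)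
      moreover have "((snd \<circ> restrict g (A - set xs)) ^^ d) y = y \<and> orbit_prod (restrict g (A - set xs)) d y = \<one>"
        using g y' by (simp add: solutions_def)
      ultimately show ?thesis by simp
    qed
    have "g \<in> extensional A" using g ne by (auto simp: Un_absorb1)
    then show "g \<in> solutions 0 d A"
      using gA sol by (simp add: solutions_def PiE_iff)
  qed
qed

end

section \<open>Exponential generating functions of cycles, forests and solutions\<close>

lemma fps_X_mult_power_nth: "fps_nth ((fps_X * F) ^ k) n = (if n < k then 0 else fps_nth (F ^ k) (n - k))"
  for F :: "complex fps"
  by (simp add: power_mult_distrib fps_X_power_mult_nth)

text \<open>Substitution in terms of labelled structures: k of the n points are chosen as roots and
  carry a U-structure, the other points are distributed by F over the k roots. It serves both for
  the layers of a forest and for hanging forests on the periodic points.\<close>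

lemma binomial_sum_compose:
  fixes U F :: "complex fps"
  shows "(\<Sum>k\<le>n. of_nat (n choose k) * (fact k * fps_nth U k * (fact (n - k) * fps_nth (F ^ k) (n - k))))
    = fact n * fps_nth (U oo (fps_X * F)) n"
proof -
  have "fact n * fps_nth (U oo (fps_X * F)) n = (\<Sum>k\<le>n. fact n * (fps_nth U k * fps_nth ((fps_X * F) ^ k) n))"
    by (simp add: fps_compose_nth sum_distrib_left atLeast0AtMost)
  also have "\<dots> = (\<Sum>k\<le>n. of_nat (n choose k) * (fact k * fps_nth U k * (fact (n - k) * fps_nth (F ^ k) (n - k))))"
  proof (rule sum.cong[OF refl])
    fix k assume "k \<in> {..n}"
    then have "k \<le> n" by simp
    then have "(fact n :: complex) = of_nat (n choose k) * fact k * fact (n - k)"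
      by (simp add: binomial_fact)
    then show "fact n * (fps_nth U k * fps_nth ((fps_X * F) ^ k) n) =
        of_nat (n choose k) * (fact k * fps_nth U k * (fact (n - k) * fps_nth (F ^ k) (n - k)))"
      using \<open>k \<le> n\<close> by (simp add: fps_X_mult_power_nth)
  qed
  finally show ?thesis by simp
qed

lemma card_distinct_lists_hd:
  assumes A: "finite A" "x \<in> A" and k: "0 < k" "k \<le> card A"
  shows "of_nat (card {xs. distinct xs \<and> set xs \<subseteq> A \<and> xs \<noteq> [] \<and> hd xs = x \<and> length xs = k})
    = (fact (card A - 1) / fact (card A - k) :: 'b::field_char_0)"
proof -
  have eq: "{xs. distinct xs \<and> set xs \<subseteq> A \<and> xs \<noteq> [] \<and> hd xs = x \<and> length xs = k} =
      (#) x ` {ys. length ys = k - 1 \<and> distinct ys \<and> set ys \<subseteq> A - {x}}" (is "?L = _ ` ?R")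
  proof (intro equalityI subsetI)
    fix xs assume "xs \<in> ?L"
    then show "xs \<in> (#) x ` ?R" by (cases xs) auto
  next
    fix xs assume "xs \<in> (#) x ` ?R"
    then show "xs \<in> ?L" using A k by auto
  qed
  have cA: "card (A - {x}) = card A - 1" using A by simp
  have "card ?L = card ?R"
    unfolding eq by (rule card_image) simp
  also have "\<dots> = \<Prod>{card (A - {x}) - (k - 1) + 1..card (A - {x})}"
    using A k by (intro card_lists_distinct_length_eq) auto
  also have "card (A - {x}) - (k - 1) = card A - k" using cA k by simp
  also have "\<Prod>{card A - k + 1..card (A - {x})} = fact (card A - 1) div fact (card A - k)"
    using k unfolding cA by (subst fact_div_fact) auto
  finally have "of_nat (card ?L) = (of_nat (fact (card A - 1) div fact (card A - k)) :: 'b)" by simp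
  also have "\<dots> = fact (card A - 1) / fact (card A - k)"
  proof -
    have "(fact (card A - 1) div fact (card A - k)) * fact (card A - k) = (fact (card A - 1) :: nat)"
      using k by (intro dvd_div_mult_self fact_dvd) simp
    then have "of_nat (fact (card A - 1) div fact (card A - k)) * fact (card A - k) = (fact (card A - 1) :: 'b)"
      by (metis of_nat_fact of_nat_mult)
    then show ?thesis by (simp add: eq_divide_eq)
  qed
  finally show ?thesis .
qed

context group
begin

text \<open>Classification by the cycle through x: the quotient of factorials counts its lists of
  length \<gamma>, and \<open>card_cycle_maps\<close> its labellings. The function f packages the
  induction hypothesis that the count on a proper subset depends only on its cardinality.\<close>

lemma card_solutions_0_rec:
  fixes f :: "nat \<Rightarrow> 'f::field_char_0"
  assumes fin: "finite (carrier G)" "finite A" and x: "x \<in> A" and d: "d > 0"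
    and f: "\<And>B. B \<subset> A \<Longrightarrow> of_nat (card (solutions 0 d B)) = f (card B)"
  shows "of_nat (card (solutions 0 d A)) = (\<Sum>\<gamma> | \<gamma> dvd d \<and> \<gamma> \<le> card A.
    fact (card A - 1) / fact (card A - \<gamma>) *
      (of_nat (card (carrier G)) ^ (\<gamma> - 1) * of_nat (iota G (d div \<gamma>)) * f (card A - \<gamma>)))"
proof -
  define L where "L = cycle_lists d x A"
  define R where "R = (\<lambda>xs. {g \<in> extensional (set xs \<union> (A - set xs)).
      restrict g (set xs) \<in> cycle_maps d xs \<and> restrict g (A - set xs) \<in> solutions 0 d (A - set xs)})"
  define T where "T = (\<lambda>\<gamma>. of_nat (card (carrier G)) ^ (\<gamma> - 1) * of_nat (iota G (d div \<gamma>)) * f (card A - \<gamma>))"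
  have eq: "solutions 0 d A = (\<Union>xs\<in>L. R xs)"
    unfolding R_def L_def by (rule solutions_0_split(1)[OF d x])
  have finL: "finite L"
    by (rule finite_subset[OF _ finite_subset_distinct[OF fin(2)]]) (auto simp: L_def cycle_lists_def)
  have "card (solutions 0 d A) = (\<Sum>xs\<in>L. card (R xs))"
    unfolding eq
  proof (rule card_UN_disjoint[OF finL])
    show "\<forall>xs\<in>L. finite (R xs)"
      using finite_subset[OF UN_upper finite_solutions[OF fin(2,1), of 0 d, unfolded eq]] by simp
    show "\<forall>xs\<in>L. \<forall>ys\<in>L. xs \<noteq> ys \<longrightarrow> R xs \<inter> R ys = {}"
    proof (intro ballI impI equals0I)
      fix xs ys g assume "xs \<in> L" "ys \<in> L" "xs \<noteq> ys" "g \<in> R xs \<inter> R ys"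
      then show False
        using solutions_0_split(2)[OF d x, of xs ys g] unfolding R_def L_def by simp
    qed
  qed
  then have "of_nat (card (solutions 0 d A)) = (\<Sum>xs\<in>L. of_nat (card (R xs)) :: 'f)"
    by simp
  also have "\<dots> = (\<Sum>xs\<in>L. T (length xs))"
  proof (rule sum.cong[OF refl])
    fix xs assume "xs \<in> L"
    then have xs: "distinct xs" "set xs \<subseteq> A" "xs \<noteq> []" "length xs dvd d"
      by (auto simp: L_def cycle_lists_def)
    have "card (R xs) = card (cycle_maps d xs) * card (solutions 0 d (A - set xs))"
      unfolding R_def by (rule card_glue_extensional) (auto simp: cycle_maps_def solutions_def PiE_iff)
    moreover have "A - set xs \<subset> A" using xs by (cases xs) auto
    then have "of_nat (card (solutions 0 d (A - set xs))) = f (card (A - set xs))" by (rule f)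
    moreover have "card (A - set xs) = card A - length xs"
      using xs fin by (simp add: card_Diff_subset distinct_card)
    ultimately show "of_nat (card (R xs)) = T (length xs)"
      using card_cycle_maps[OF fin(1) xs(1,3,4)] by (simp add: T_def)
  qed
  also have "\<dots> = (\<Sum>\<gamma>\<in>{\<gamma>. \<gamma> dvd d \<and> \<gamma> \<le> card A}. \<Sum>xs\<in>{xs\<in>L. length xs = \<gamma>}. T (length xs))"
  proof (rule sum.group[symmetric, OF finL])
    show "finite {\<gamma>. \<gamma> dvd d \<and> \<gamma> \<le> card A}" by simp
    show "length ` L \<subseteq> {\<gamma>. \<gamma> dvd d \<and> \<gamma> \<le> card A}"
    proof (rule image_subsetI)
      fix xs assume "xs \<in> L"
      then have xs: "distinct xs" "set xs \<subseteq> A" "length xs dvd d"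
        by (auto simp: L_def cycle_lists_def)
      then show "length xs \<in> {\<gamma>. \<gamma> dvd d \<and> \<gamma> \<le> card A}"
        using card_mono[OF fin(2) xs(2)] distinct_card[OF xs(1)] by simp
    qed
  qed
  also have "\<dots> = (\<Sum>\<gamma> | \<gamma> dvd d \<and> \<gamma> \<le> card A. fact (card A - 1) / fact (card A - \<gamma>) * T \<gamma>)"
  proof (rule sum.cong[OF refl])
    fix \<gamma> assume \<gamma>: "\<gamma> \<in> {\<gamma>. \<gamma> dvd d \<and> \<gamma> \<le> card A}"
    then have "\<gamma> > 0" using d by (auto intro!: Nat.gr0I)
    have "{xs \<in> L. length xs = \<gamma>} =
        {xs. distinct xs \<and> set xs \<subseteq> A \<and> xs \<noteq> [] \<and> hd xs = x \<and> length xs = \<gamma>}"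
      using \<gamma> by (auto simp: L_def cycle_lists_def)
    then have "of_nat (card {xs \<in> L. length xs = \<gamma>}) = (fact (card A - 1) / fact (card A - \<gamma>) :: 'f)"
      using card_distinct_lists_hd[OF fin(2) x \<open>\<gamma> > 0\<close>, where 'b = 'f] \<gamma> by simp
    then show "(\<Sum>xs\<in>{xs\<in>L. length xs = \<gamma>}. T (length xs)) = fact (card A - 1) / fact (card A - \<gamma>) * T \<gamma>"
      by simp
  qed
  finally show ?thesis by (simp add: T_def)
qed

text \<open>The generating function of a single labelled cycle: (\<gamma> - 1)! cyclic orders
  divided by \<gamma>! give 1/\<gamma>, and the rest of the coefficient counts admissible
  labels.\<close>

definition cycle_fps :: "nat \<Rightarrow> complex fps" where
  "cycle_fps d = (\<Sum>\<gamma> | \<gamma> dvd d.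
     fps_const (of_nat (iota G (d div \<gamma>)) * of_nat (card (carrier G)) ^ (\<gamma> - 1) / of_nat \<gamma>) * fps_X ^ \<gamma>)"

text \<open>Forests of height at most a below a single root. Multiplied by z, which accounts for the
  root, this counts rooted trees; in the exponent the factor |H| is the label of each child.\<close>

primrec forest_fps :: "nat \<Rightarrow> complex fps" where
  "forest_fps 0 = 1"
| "forest_fps (Suc a) = fps_exp (of_nat (card (carrier G))) oo (fps_X * forest_fps a)"

lemma cycle_fps_0:
  assumes "d > 0"
  shows "fps_nth (cycle_fps d) 0 = 0"
proof -
  have "\<gamma> > 0" if "\<gamma> dvd d" for \<gamma> using assms that by (auto intro!: Nat.gr0I)
  then show ?thesis unfolding cycle_fps_def fps_sum_nth by (intro sum.neutral) auto
qed

text \<open>Coefficients are compared in V' = V Q' for V = exp Q. The derivative cancels the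
  1/\<gamma> of the cycle series, which yields the recursion obtained by removing the cycle through
  a marked point.\<close>

lemma exp_cycle_fps_rec:
  assumes d: "d > 0"
  defines "V \<equiv> fps_exp 1 oo cycle_fps d"
  shows "of_nat (Suc n) * fps_nth V (Suc n) = (\<Sum>\<gamma> | \<gamma> dvd d \<and> \<gamma> \<le> Suc n.
    of_nat (card (carrier G)) ^ (\<gamma> - 1) * of_nat (iota G (d div \<gamma>)) * fps_nth V (Suc n - \<gamma>))"
proof -
  let ?c = "\<lambda>\<gamma>. of_nat (card (carrier G)) ^ (\<gamma> - 1) * of_nat (iota G (d div \<gamma>)) :: complex"
  have pos: "\<gamma> > 0" if "\<gamma> dvd d" for \<gamma> using d that by (auto intro!: Nat.gr0I)
  have fin: "finite {\<gamma>. \<gamma> dvd d}" using d by (rule finite_divisors_nat)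
  have Q': "fps_deriv (cycle_fps d) = (\<Sum>\<gamma> | \<gamma> dvd d. fps_const (?c \<gamma>) * fps_X ^ (\<gamma> - 1))"
    unfolding cycle_fps_def fps_deriv_sum
  proof (rule sum.cong[OF refl])
    fix \<gamma> assume "\<gamma> \<in> {\<gamma>. \<gamma> dvd d}"
    then have "of_nat \<gamma> \<noteq> (0::complex)" using pos[of \<gamma>] by simp
    then show "fps_deriv (fps_const (of_nat (iota G (d div \<gamma>)) * of_nat (card (carrier G)) ^ (\<gamma> - 1) / of_nat \<gamma>) * fps_X ^ \<gamma>)
        = fps_const (?c \<gamma>) * fps_X ^ (\<gamma> - 1)"
      by (simp add: fps_deriv_power mult.assoc[symmetric] fps_const_mult[symmetric] del: fps_const_mult)
  qed
  have "fps_deriv V = (fps_deriv (fps_exp 1) oo cycle_fps d) * fps_deriv (cycle_fps d)"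
    unfolding V_def by (rule fps_compose_deriv[OF cycle_fps_0[OF d]])
  then have "fps_deriv V = V * fps_deriv (cycle_fps d)"
    by (simp add: V_def)
  then have "of_nat (Suc n) * fps_nth V (Suc n) = fps_nth (V * fps_deriv (cycle_fps d)) n"
    using fps_deriv_nth[of V n] by simp
  also have "\<dots> = (\<Sum>\<gamma> | \<gamma> dvd d. ?c \<gamma> * fps_nth (V * fps_X ^ (\<gamma> - 1)) n)"
    unfolding Q' sum_distrib_left fps_sum_nth
    by (rule sum.cong[OF refl]) (simp add: mult.left_commute[of V])
  also have "\<dots> = (\<Sum>\<gamma> | \<gamma> dvd d. if \<gamma> \<le> Suc n then ?c \<gamma> * fps_nth V (Suc n - \<gamma>) else 0)"
  proof (rule sum.cong[OF refl])
    fix \<gamma> assume "\<gamma> \<in> {\<gamma>. \<gamma> dvd d}"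
    then have "\<gamma> > 0" using pos by simp
    then show "?c \<gamma> * fps_nth (V * fps_X ^ (\<gamma> - 1)) n = (if \<gamma> \<le> Suc n then ?c \<gamma> * fps_nth V (Suc n - \<gamma>) else 0)"
      by (cases \<gamma>) (auto simp: fps_X_power_mult_right_nth)
  qed
  also have "\<dots> = (\<Sum>\<gamma> | \<gamma> dvd d \<and> \<gamma> \<le> Suc n. ?c \<gamma> * fps_nth V (Suc n - \<gamma>))"
    using fin by (simp add: sum.If_cases Collect_conj_eq)
  finally show ?thesis .
qed

text \<open>Both sides equal 1 for the empty set and satisfy the same recursion. The induction runs
  over proper subsets because a whole cycle is removed at once.\<close>

lemma card_solutions_0:
  assumes fin: "finite (carrier G)" "finite A" and d: "d > 0"
  shows "of_nat (card (solutions 0 d A)) = fact (card A) * fps_nth (fps_exp 1 oo cycle_fps d) (card A)"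
  using fin(2)
proof (induction A rule: finite_psubset_induct)
  case (psubset A)
  let ?V = "fps_exp 1 oo cycle_fps d"
  show ?case
  proof (cases "A = {}")
    case True
    then have "solutions 0 d A = {\<lambda>_. undefined}" by (auto simp: solutions_def)
    then show ?thesis using True by simp
  next
    case False
    then obtain x where x: "x \<in> A" by blast
    obtain n where n: "card A = Suc n" using psubset.hyps False by (cases "card A") auto
    have "of_nat (card (solutions 0 d A)) = (\<Sum>\<gamma> | \<gamma> dvd d \<and> \<gamma> \<le> card A.
       fact (card A - 1) / fact (card A - \<gamma>) *
      (of_nat (card (carrier G)) ^ (\<gamma> - 1) * of_nat (iota G (d div \<gamma>)) *
        (fact (card A - \<gamma>) * fps_nth ?V (card A - \<gamma>))))"
      by (rule card_solutions_0_rec[OF fin(1) psubset.hyps x d]) (rule psubset.IH)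
    also have "\<dots> = fact n * (\<Sum>\<gamma> | \<gamma> dvd d \<and> \<gamma> \<le> Suc n.
        of_nat (card (carrier G)) ^ (\<gamma> - 1) * of_nat (iota G (d div \<gamma>)) * fps_nth ?V (Suc n - \<gamma>))"
      unfolding n sum_distrib_left by (intro sum.cong) auto
    also have "\<dots> = fact n * (of_nat (Suc n) * fps_nth ?V (Suc n))"
      by (simp only: exp_cycle_fps_rec[OF d])
    also have "\<dots> = fact (card A) * fps_nth ?V (card A)"
      by (simp add: n algebra_simps)
    finally show ?thesis .
  qed
qed

text \<open>The points of \<open>C\<close> carry their forests independently, hence the power
  \<open>card C\<close>. In the induction the first layer contributes the coefficients of exp (|C| h
  u), the later layers substitute u = z F, and exp (|C| h u) is the |C|-th power of exp (h
  u).\<close>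

lemma card_forests:
  assumes fin: "finite (carrier G)"
  shows "finite M \<Longrightarrow> finite C \<Longrightarrow> M \<inter> C = {} \<Longrightarrow>
    of_nat (card (forests a C M)) = fact (card M) * fps_nth (forest_fps a ^ card C) (card M)"
proof (induction a arbitrary: M C)
  case 0
  then show ?case by (auto simp: forests_0 card_gt_0_iff)
next
  case (Suc a)
  let ?h = "of_nat (card (carrier G)) :: complex"
  let ?n = "card M"
  have "of_nat (card (forests (Suc a) C M)) = (\<Sum>K\<in>Pow M. (?h * of_nat (card C)) ^ card K *
      of_nat (card (forests a K (M - K))))"
    by (simp add: card_forests_Suc[OF Suc.prems(1,2) fin Suc.prems(3)])
  also have "\<dots> = (\<Sum>K\<in>Pow M. (?h * of_nat (card C)) ^ card K * (fact (?n - card K) * fps_nth (forest_fps a ^ card K) (?n - card K)))"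
  proof (rule sum.cong[OF refl])
    fix K assume "K \<in> Pow M"
    then have K: "finite K" "K \<subseteq> M" using Suc.prems finite_subset by auto
    then have "of_nat (card (forests a K (M - K))) = fact (card (M - K)) * fps_nth (forest_fps a ^ card K) (card (M - K))"
      using Suc.prems by (intro Suc.IH) auto
    then show "(?h * of_nat (card C)) ^ card K * of_nat (card (forests a K (M - K))) =
      (?h * of_nat (card C)) ^ card K * (fact (?n - card K) * fps_nth (forest_fps a ^ card K) (?n - card K))"
      using K by (simp add: card_Diff_subset)
  qed
  also have "\<dots> = (\<Sum>k\<le>?n. of_nat (?n choose k) * ((?h * of_nat (card C)) ^ k * (fact (?n - k) * fps_nth (forest_fps a ^ k) (?n - k))))"
    using Suc.prems by (intro sum_Pow_card)
  also have "\<dots> = (\<Sum>k\<le>?n. of_nat (?n choose k) * (fact k * fps_nth (fps_exp (of_nat (card C) * ?h)) k * (fact (?n - k) * fps_nth (forest_fps a ^ k) (?n - k))))"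
    by (intro sum.cong) (auto simp: mult.commute)
  also have "\<dots> = fact ?n * fps_nth (fps_exp (of_nat (card C) * ?h) oo (fps_X * forest_fps a)) ?n"
    by (rule binomial_sum_compose)
  also have "fps_exp (of_nat (card C) * ?h) oo (fps_X * forest_fps a) = forest_fps (Suc a) ^ card C"
    by (simp add: fps_compose_power fps_exp_power_mult)
  finally show ?case .
qed

lemma card_solutions:
  assumes fin: "finite (carrier G)" "finite A" and d: "d > 0"
  shows "of_nat (card (solutions a d A)) =
    fact (card A) * fps_nth ((fps_exp 1 oo cycle_fps d) oo (fps_X * forest_fps a)) (card A)"
proof -
  let ?V = "fps_exp 1 oo cycle_fps d"
  have "of_nat (card (solutions a d A)) = (\<Sum>C\<in>Pow A. of_nat (card (solutions 0 d C)) * of_nat (card (forests a C (A - C))) :: complex)"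
    by (simp add: card_solutions_split[OF d fin(2,1)])
  also have "\<dots> = (\<Sum>C\<in>Pow A. fact (card C) * fps_nth ?V (card C) * (fact (card A - card C) * fps_nth (forest_fps a ^ card C) (card A - card C)))"
  proof (rule sum.cong[OF refl])
    fix C assume "C \<in> Pow A"
    then have C: "finite C" "C \<subseteq> A" using fin finite_subset by auto
    have "of_nat (card (forests a C (A - C))) = fact (card (A - C)) * fps_nth (forest_fps a ^ card C) (card (A - C))"
      using C fin by (intro card_forests) auto
    then show "of_nat (card (solutions 0 d C)) * of_nat (card (forests a C (A - C))) =
        fact (card C) * fps_nth ?V (card C) * (fact (card A - card C) * fps_nth (forest_fps a ^ card C) (card A - card C))"
      using C card_solutions_0[OF fin(1) C(1) d] by (simp add: card_Diff_subset)
  qed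
  also have "\<dots> = (\<Sum>k\<le>card A. of_nat (card A choose k) * (fact k * fps_nth ?V k * (fact (card A - k) * fps_nth (forest_fps a ^ k) (card A - k))))"
    using fin(2) by (rule sum_Pow_card)
  also have "\<dots> = fact (card A) * fps_nth (?V oo (fps_X * forest_fps a)) (card A)"
    by (rule binomial_sum_compose)
  finally show ?thesis .
qed

text \<open>T(z) = \<open>cDelta a (h * z) / h\<close> satisfies the recursion of rooted trees:
  passing from a to a + 1 replaces T by z exp (h T).\<close>

lemma tree_fps_expansion:
  assumes fin: "finite (carrier G)"
  defines "h \<equiv> of_nat (card (carrier G))"
  shows "(\<lambda>z. cDelta a (h * z) / h) has_fps_expansion fps_X * forest_fps a"
proof (induction a)
  case 0
  have "h \<noteq> 0" using fin by (auto simp: h_def card_eq_0_iff)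
  then show ?case using has_fps_expansion_fps_X by simp
next
  case (Suc a)
  have h: "h \<noteq> 0" using fin by (auto simp: h_def card_eq_0_iff)
  have "((\<lambda>z. exp (h * z)) \<circ> (\<lambda>z. cDelta a (h * z) / h)) has_fps_expansion (fps_exp h oo (fps_X * forest_fps a))"
    by (intro has_fps_expansion_compose Suc.IH has_fps_expansion_exp) simp
  then have "(\<lambda>z. z * ((\<lambda>z. exp (h * z)) \<circ> (\<lambda>z. cDelta a (h * z) / h)) z) has_fps_expansion fps_X * (fps_exp h oo (fps_X * forest_fps a))"
    by (intro has_fps_expansion_mult has_fps_expansion_fps_X)
  then show ?case using h by (simp add: h_def)
qed

text \<open>The h^(\<gamma> - 1) of the free labels on a cycle meets the h^(-\<gamma>) from the
  \<gamma> trees rooted on it. This leaves a factor 1/h for every \<gamma>, which is the 1/|H| in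
  front of the sum.\<close>

lemma solutions_egf:
  assumes fin: "finite (carrier G)" and d: "d > 0"
  defines "h \<equiv> real (card (carrier G))"
  shows "(\<lambda>z. exp (\<Sum>\<gamma> | \<gamma> dvd d. of_real (real (iota G (d div \<gamma>)) / (real \<gamma> * h)) * cDelta a (of_real h * z) ^ \<gamma>))
    has_fps_expansion ((fps_exp 1 oo cycle_fps d) oo (fps_X * forest_fps a))"
proof -
  have h: "h > 0" using fin by (auto simp: h_def card_gt_0_iff)
  define Q where "Q = (\<lambda>z::complex. \<Sum>\<gamma> | \<gamma> dvd d.
     (of_nat (iota G (d div \<gamma>)) * of_nat (card (carrier G)) ^ (\<gamma> - 1) / of_nat \<gamma>) * z ^ \<gamma>)"
  have "Q has_fps_expansion cycle_fps d"
    unfolding Q_def cycle_fps_def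
    by (intro has_fps_expansion_sum has_fps_expansion_cmult_left has_fps_expansion_power has_fps_expansion_fps_X)
  then have V: "(exp \<circ> Q) has_fps_expansion (fps_exp 1 oo cycle_fps d)"
    by (intro has_fps_expansion_compose has_fps_expansion_exp1 cycle_fps_0[OF d])
  have "((exp \<circ> Q) \<circ> (\<lambda>z. cDelta a (of_nat (card (carrier G)) * z) / of_nat (card (carrier G))))
      has_fps_expansion ((fps_exp 1 oo cycle_fps d) oo (fps_X * forest_fps a))"
    by (rule has_fps_expansion_compose[OF V tree_fps_expansion[OF fin]]) simp
  also have "((exp \<circ> Q) \<circ> (\<lambda>z. cDelta a (of_nat (card (carrier G)) * z) / of_nat (card (carrier G)))) =
      (\<lambda>z. exp (\<Sum>\<gamma> | \<gamma> dvd d. of_real (real (iota G (d div \<gamma>)) / (real \<gamma> * h)) * cDelta a (of_real h * z) ^ \<gamma>))"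
  proof
    fix z
    have "(of_nat (iota G (d div \<gamma>)) * of_nat (card (carrier G)) ^ (\<gamma> - 1) / of_nat \<gamma>) *
        (cDelta a (of_nat (card (carrier G)) * z) / of_nat (card (carrier G))) ^ \<gamma> =
        of_real (real (iota G (d div \<gamma>)) / (real \<gamma> * h)) * cDelta a (of_real h * z) ^ \<gamma>" if \<gamma>: "\<gamma> dvd d" for \<gamma>
    proof -
      obtain k where "\<gamma> = Suc k" using d \<gamma> by (cases \<gamma>) auto
      moreover have "(i * H ^ k / g) * (x / H) ^ Suc k = i / (g * H) * x ^ Suc k" if "H \<noteq> 0"
        for i H g x :: complex
        using that by (simp add: power_divide)
      moreover have "of_nat (card (carrier G)) \<noteq> (0 :: complex)"
        using h by (simp add: h_def)
      ultimately show ?thesis by (simp add: h_def del: of_nat_Suc power_Suc)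
    qed
    then show "((exp \<circ> Q) \<circ> (\<lambda>z. cDelta a (of_nat (card (carrier G)) * z) / of_nat (card (carrier G)))) z =
      exp (\<Sum>\<gamma> | \<gamma> dvd d. of_real (real (iota G (d div \<gamma>)) / (real \<gamma> * h)) * cDelta a (of_real h * z) ^ \<gamma>)"
      by (simp add: Q_def)
  qed
  finally show ?thesis .
qed

end

section \<open>Translation from the wreath product and the final asymptotics\<close>

lemma (in group) nat_pow_wreath_transf:
  assumes "(f, \<tau>) \<in> carrier (wreath_transf G n)"
  defines "g \<equiv> \<lambda>j\<in>{1..n}. (f j, \<tau> j)"
  shows "(f, \<tau>) [^]\<^bsub>wreath_transf G n\<^esub> m =
    (\<lambda>j\<in>{1..n}. orbit_prod g m j, \<lambda>j\<in>{1..n}. ((snd \<circ> g) ^^ m) j)"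
proof (induction m)
  case 0
  show ?case by (simp add: wreath_transf_def full_transf_def fun_eq_iff)
next
  case (Suc m)
  have f: "f \<in> {1..n} \<rightarrow>\<^sub>E carrier G" and \<tau>: "\<tau> \<in> {1..n} \<rightarrow>\<^sub>E {1..n}"
    using assms by (auto simp: wreath_transf_def full_transf_def)
  have cl: "((snd \<circ> g) ^^ m) j \<in> {1..n}" if "j \<in> {1..n}" for j
    by (rule funpow_closed[OF _ that]) (use \<tau> in \<open>auto simp: g_def\<close>)
  \<comment> \<open>The power multiplies by the base on the right. This is why
    \<open>orbit_prod\<close> appends its new factor on the right, taken at the point reached after
    m steps.\<close>
  have "(f, \<tau>) [^]\<^bsub>wreath_transf G n\<^esub> Suc m =
      (f, \<tau>) [^]\<^bsub>wreath_transf G n\<^esub> m \<otimes>\<^bsub>wreath_transf G n\<^esub> (f, \<tau>)"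
    by (rule monoid.nat_pow_Suc[OF monoid_wreath_transf[OF is_monoid]])
  also have "\<dots> = (\<lambda>j\<in>{1..n}. orbit_prod g m j \<otimes> f (((snd \<circ> g) ^^ m) j), \<lambda>j\<in>{1..n}. \<tau> (((snd \<circ> g) ^^ m) j))"
    unfolding Suc.IH by (auto simp: wreath_transf_def full_transf_def fun_eq_iff)
  also have "\<dots> = (\<lambda>j\<in>{1..n}. orbit_prod g (Suc m) j, \<lambda>j\<in>{1..n}. ((snd \<circ> g) ^^ Suc m) j)"
  proof -
    have *: "fst (g (((snd \<circ> g) ^^ m) j)) = f (((snd \<circ> g) ^^ m) j)"
      "snd (g (((snd \<circ> g) ^^ m) j)) = \<tau> (((snd \<circ> g) ^^ m) j)" if "j \<in> {1..n}" for j
      using cl[OF that] by (simp_all add: g_def)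
    show ?thesis
      unfolding prod.inject
    proof (intro conjI restrict_ext)
      fix j assume j: "j \<in> {1..n}"
      show "orbit_prod g m j \<otimes> f (((snd \<circ> g) ^^ m) j) = orbit_prod g (Suc m) j"
        using *(1)[OF j] by simp
      show "\<tau> (((snd \<circ> g) ^^ m) j) = ((snd \<circ> g) ^^ Suc m) j"
        using *(2)[OF j] by simp
    qed
  qed
  finally show ?case .
qed

lemma (in group) num_solutions_eq_card:
  assumes "\<alpha> < \<beta>"
  shows "num_solutions G \<alpha> \<beta> n = card (solutions \<alpha> (\<beta> - \<alpha>) {1..n})"
proof -
  define d where "d = \<beta> - \<alpha>"
  have \<beta>: "\<beta> = \<alpha> + d" using assms by (simp add: d_def)
  define mk where "mk = (\<lambda>(f :: nat \<Rightarrow> 'a, \<tau> :: nat \<Rightarrow> nat). \<lambda>j\<in>{1..n}. (f j, \<tau> j))"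
  define un where "un = (\<lambda>g :: nat \<Rightarrow> 'a \<times> nat. (\<lambda>j\<in>{1..n}. fst (g j), \<lambda>j\<in>{1..n}. snd (g j)))"
  have mk_in: "mk X \<in> {1..n} \<rightarrow>\<^sub>E carrier G \<times> {1..n}" and un_mk: "un (mk X) = X"
    if "X \<in> carrier (wreath_transf G n)" for X
    using that by (auto simp: mk_def un_def wreath_transf_def full_transf_def PiE_iff extensional_def fun_eq_iff)
  have un_in: "un g \<in> carrier (wreath_transf G n)" and mk_un: "mk (un g) = g"
    if "g \<in> {1..n} \<rightarrow>\<^sub>E carrier G \<times> {1..n}" for g
    using that by (auto simp: mk_def un_def wreath_transf_def full_transf_def PiE_iff extensional_def fun_eq_iff mem_Times_iff)
  have iff: "X [^]\<^bsub>wreath_transf G n\<^esub> \<alpha> = X [^]\<^bsub>wreath_transf G n\<^esub> \<beta> \<longleftrightarrow> mk X \<in> solutions \<alpha> d {1..n}"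
    if X: "X \<in> carrier (wreath_transf G n)" for X
  proof -
    define g where "g = mk X"
    have gA: "g y \<in> carrier G \<times> {1..n}" if "y \<in> {1..n}" for y
      using mk_in[OF X] that by (auto simp: g_def PiE_iff)
    have pow: "X [^]\<^bsub>wreath_transf G n\<^esub> m =
      (\<lambda>j\<in>{1..n}. orbit_prod g m j, \<lambda>j\<in>{1..n}. ((snd \<circ> g) ^^ m) j)" for m
      using nat_pow_wreath_transf[of "fst X" "snd X" n m] X by (simp add: g_def mk_def case_prod_beta)
    have "X [^]\<^bsub>wreath_transf G n\<^esub> \<alpha> = X [^]\<^bsub>wreath_transf G n\<^esub> \<beta> \<longleftrightarrow>
        (\<forall>j\<in>{1..n}. orbit_prod g \<alpha> j = orbit_prod g \<beta> j \<and> ((snd \<circ> g) ^^ \<alpha>) j = ((snd \<circ> g) ^^ \<beta>) j)"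
      unfolding pow prod.inject by (auto simp: fun_eq_iff restrict_def)
    also have "\<dots> \<longleftrightarrow> (\<forall>j\<in>{1..n}. ((snd \<circ> g) ^^ d) (((snd \<circ> g) ^^ \<alpha>) j) = ((snd \<circ> g) ^^ \<alpha>) j \<and>
           orbit_prod g d (((snd \<circ> g) ^^ \<alpha>) j) = \<one>)"
    proof (intro ball_cong refl)
      fix j assume j: "j \<in> {1..n}"
      let ?y = "((snd \<circ> g) ^^ \<alpha>) j"
      have y: "?y \<in> {1..n}"
        by (rule funpow_closed[OF _ j]) (use gA in \<open>auto simp: mem_Times_iff\<close>)
      have 1: "((snd \<circ> g) ^^ \<beta>) j = ((snd \<circ> g) ^^ d) ?y"
        unfolding \<beta> add.commute[of \<alpha>] funpow_add comp_apply ..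
      have 2: "orbit_prod g \<beta> j = orbit_prod g \<alpha> j \<otimes> orbit_prod g d ?y"
        unfolding \<beta> by (rule orbit_prod_add[OF gA j])
      have "orbit_prod g \<alpha> j \<in> carrier G" "orbit_prod g d ?y \<in> carrier G"
        using orbit_prod_closed[OF gA j] orbit_prod_closed[OF gA y] by auto
      then have "orbit_prod g \<alpha> j = orbit_prod g \<alpha> j \<otimes> orbit_prod g d ?y \<longleftrightarrow> orbit_prod g d ?y = \<one>"
        by (rule l_cancel_one')
      then show "(orbit_prod g \<alpha> j = orbit_prod g \<beta> j \<and> ?y = ((snd \<circ> g) ^^ \<beta>) j) \<longleftrightarrow>
        (((snd \<circ> g) ^^ d) ?y = ?y \<and> orbit_prod g d ?y = \<one>)"
        unfolding 1 2 by auto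
    qed
    also have "\<dots> \<longleftrightarrow> g \<in> solutions \<alpha> d {1..n}"
      using mk_in[OF X] by (simp add: solutions_def g_def)
    finally show ?thesis by (simp add: g_def)
  qed
  have sub: "solutions \<alpha> d {1..n} \<subseteq> {1..n} \<rightarrow>\<^sub>E carrier G \<times> {1..n}"
    by (auto simp: solutions_def)
  have "bij_betw mk {X \<in> carrier (wreath_transf G n).
             X [^]\<^bsub>wreath_transf G n\<^esub> \<alpha> = X [^]\<^bsub>wreath_transf G n\<^esub> \<beta>} (solutions \<alpha> d {1..n})"
  proof (rule bij_betw_byWitness[where f' = un])
    show "\<forall>X\<in>{X \<in> carrier (wreath_transf G n). X [^]\<^bsub>wreath_transf G n\<^esub> \<alpha> = X [^]\<^bsub>wreath_transf G n\<^esub> \<beta>}. un (mk X) = X"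
      using un_mk by simp
    show "\<forall>g\<in>solutions \<alpha> d {1..n}. mk (un g) = g"
      using mk_un sub by blast
    show "mk ` {X \<in> carrier (wreath_transf G n). X [^]\<^bsub>wreath_transf G n\<^esub> \<alpha> = X [^]\<^bsub>wreath_transf G n\<^esub> \<beta>}
        \<subseteq> solutions \<alpha> d {1..n}"
      using iff by auto
    show "un ` solutions \<alpha> d {1..n} \<subseteq> {X \<in> carrier (wreath_transf G n).
        X [^]\<^bsub>wreath_transf G n\<^esub> \<alpha> = X [^]\<^bsub>wreath_transf G n\<^esub> \<beta>}"
    proof (rule image_subsetI)
      fix g assume g: "g \<in> solutions \<alpha> d {1..n}"
      then have "g \<in> {1..n} \<rightarrow>\<^sub>E carrier G \<times> {1..n}" using sub by blast
      then show "un g \<in> {X \<in> carrier (wreath_transf G n).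
        X [^]\<^bsub>wreath_transf G n\<^esub> \<alpha> = X [^]\<^bsub>wreath_transf G n\<^esub> \<beta>}"
        using iff[OF un_in] un_in mk_un g by simp
    qed
  qed
  then show ?thesis
    unfolding num_solutions_def d_def by (rule bij_betw_same_card)
qed

theorem theorem4:
  fixes H :: "('a, 'b) monoid_scheme" and \<alpha> \<beta> :: nat
  assumes "group H" and "finite (carrier H)"
    and "0 < \<alpha>" and "\<alpha> < \<beta>"
  shows "(\<forall>\<^sub>F n in sequentially. \<exists>!r. is_saddle H \<alpha> \<beta> n r) \<and>
    (\<lambda>n. real (num_solutions H \<alpha> \<beta> n)) \<sim>[sequentially]
    (\<lambda>n. let r = saddle H \<alpha> \<beta> n; h = real (order H); d = real (\<beta> - \<alpha>) in
       1 / (r ^ n * sqrt (d * (\<Prod>k=1..\<alpha> - 1. Delta k (h * r))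
                            * (ln ^^ (\<alpha> - 1)) (1 / d * ln (real n))))
       * exp ((Delta \<alpha> (h * r) / (d * h * r * deriv (Delta \<alpha>) (h * r)) + ln (real n) - 1) * real n
              + 1 / h * (\<Sum>\<gamma> | \<gamma> dvd \<beta> - \<alpha>. (1 / real \<gamma> - 1 / d)
                   * real (iota H ((\<beta> - \<alpha>) div \<gamma>)) * Delta \<alpha> (h * r) ^ \<gamma>)))"
proof -
  interpret group H by fact
  define d where "d = \<beta> - \<alpha>"
  define h where "h = real (order H)"
  define w where "w = (\<lambda>\<gamma>. real (iota H (d div \<gamma>)) / (real \<gamma> * h))"
  have d: "d > 0" using assms by (simp add: d_def)
  have h_card: "h = real (card (carrier H))" by (simp add: h_def order_def)
  have h: "h > 0" using assms(2) by (auto simp: h_card card_gt_0_iff)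
  \<comment> \<open>The weight of full-length cycles is iota(1) / (d h), and iota(1) = 1 makes it
    positive.\<close>
  have "{x \<in> carrier H. x [^]\<^bsub>H\<^esub> (1::nat) = \<one>\<^bsub>H\<^esub>} = {\<one>\<^bsub>H\<^esub>}" by auto
  then have iota1: "iota H 1 = 1" by (simp add: iota_def)
  interpret delta_weights h d \<alpha> w
  proof
    show "w d > 0" using d h iota1 by (simp add: w_def)
  qed (use h d assms(3) in \<open>auto simp: w_def\<close>)
  have deriv_eq: "deriv (Delta \<alpha>) (h * r) = D r * Lam \<alpha> (h * r) / (h * r)" if "r > 0" for r
    unfolding D_def using h that by (intro DERIV_imp_deriv has_derivative_Delta) auto
  have S1: "S 1 x = 1 / h * (\<Sum>\<gamma> | \<gamma> dvd d. real (iota H (d div \<gamma>)) * x ^ \<gamma>)" for x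
    unfolding S_def sum_distrib_left
    by (intro sum.cong refl) (use div_pos h in \<open>auto simp: w_def field_simps\<close>)
  \<comment> \<open>Since r times the derivative of \<open>Delta \<alpha>\<close> at h r is D
    \<open>Lam \<alpha>\<close> / h, each power \<gamma> - 1 is raised to \<gamma>. The missing
    1/\<gamma> fits as well: the factor \<gamma> in \<open>S 1\<close> cancels the one in w.\<close>
  have saddle_iff: "is_saddle H \<alpha> \<beta> n r \<longleftrightarrow> r > 0 \<and> thetaP r = real n" for n r
  proof (cases "r > 0")
    case True
    have "r * (\<Sum>\<gamma> | \<gamma> dvd d. real (iota H (d div \<gamma>)) * D r ^ (\<gamma> - 1) * deriv (Delta \<alpha>) (h * r))
        = S 1 (D r) * Lam \<alpha> (h * r)"
      unfolding S1 sum_distrib_left sum_distrib_right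
    proof (intro sum.cong refl)
      fix \<gamma> assume "\<gamma> \<in> {\<gamma>. \<gamma> dvd d}"
      then obtain k where "\<gamma> = Suc k" using div_pos[of \<gamma>] by (cases \<gamma>) auto
      then show "r * (real (iota H (d div \<gamma>)) * D r ^ (\<gamma> - 1) * deriv (Delta \<alpha>) (h * r)) =
          1 / h * (real (iota H (d div \<gamma>)) * D r ^ \<gamma>) * Lam \<alpha> (h * r)"
        using True h by (simp add: deriv_eq)
    qed
    then show ?thesis
      unfolding is_saddle_def d_def[symmetric] h_def[symmetric] D_def[symmetric] thetaP_def
      using True by simp
  qed (simp add: is_saddle_def)
  have ex1: "\<forall>\<^sub>F n in sequentially. \<exists>!r. is_saddle H \<alpha> \<beta> n r"
    using ex1_saddle by (simp add: saddle_iff)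
  define r where "r = saddle H \<alpha> \<beta>"
  have r: "\<forall>\<^sub>F n in sequentially. r n > 0 \<and> thetaP (r n) = real n"
    using ex1
  proof eventually_elim
    case (elim n)
    then have "is_saddle H \<alpha> \<beta> n (saddle H \<alpha> \<beta> n)"
      unfolding saddle_def by (rule theI')
    then show ?case by (simp add: saddle_iff r_def)
  qed
  define s where "s = (\<lambda>n. real (num_solutions H \<alpha> \<beta> n))"
  have "(\<lambda>z. exp (cP z)) has_fps_expansion ((fps_exp 1 oo cycle_fps d) oo (fps_X * forest_fps \<alpha>))"
    unfolding cP_def unfolding w_def by (rule solutions_egf[OF assms(2) d, folded h_card])
  also have "(fps_exp 1 oo cycle_fps d) oo (fps_X * forest_fps \<alpha>) = Abs_fps (\<lambda>n. of_real (s n / fact n))"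
  proof (rule fps_ext)
    fix n
    have "of_nat (num_solutions H \<alpha> \<beta> n) =
        fact n * fps_nth ((fps_exp 1 oo cycle_fps d) oo (fps_X * forest_fps \<alpha>)) n"
      using card_solutions[OF assms(2) _ d, of "{1..n}" \<alpha>] num_solutions_eq_card[OF assms(4)]
      by (simp add: d_def)
    then show "fps_nth ((fps_exp 1 oo cycle_fps d) oo (fps_X * forest_fps \<alpha>)) n =
        fps_nth (Abs_fps (\<lambda>n. of_real (s n / fact n))) n"
      by (simp add: s_def field_simps)
  qed
  finally have lim: "(\<lambda>n. s n / (1 / (r n ^ n * sqrt (real d * (\<Prod>k=1..\<alpha> - 1. Delta k (h * r n))
           * (ln ^^ (\<alpha> - 1)) (1 / real d * ln (real n))))
         * exp ((ln (real n) - 1) * real n + S 0 (D (r n))))) \<longlonglongrightarrow> 1"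
    by (rule egf_coeff_asymptotics[OF _ r])
  \<comment> \<open>An identity at the saddle point: the quotient of \<open>Delta \<alpha>\<close>
    by its derivative term is 1 / (d \<open>Lam \<alpha>\<close>), and multiplied by n = S 1 (D)
    \<open>Lam \<alpha>\<close> it gives S 1 (D) / d. The differences 1/\<gamma> - 1/d are what
    remains of S 0 (D) after subtracting this.\<close>
  have exponent: "(ln (real n) - 1) * real n + S 0 (D (r n)) =
      (Delta \<alpha> (h * r n) / (real d * h * r n * deriv (Delta \<alpha>) (h * r n)) + ln (real n) - 1) * real n
        + 1 / h * (\<Sum>\<gamma> | \<gamma> dvd d. (1 / real \<gamma> - 1 / real d) * real (iota H (d div \<gamma>)) * Delta \<alpha> (h * r n) ^ \<gamma>)"
    if rn: "r n > 0 \<and> thetaP (r n) = real n" for n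
  proof -
    have Dn: "D (r n) > 0" using rn D_pos by blast
    have L: "Lam \<alpha> (h * r n) > 0" using Lam_ge_1[of "h * r n" \<alpha>] h rn by simp
    have "Delta \<alpha> (h * r n) / (real d * h * r n * deriv (Delta \<alpha>) (h * r n)) = 1 / (real d * Lam \<alpha> (h * r n))"
      using rn h Dn by (simp add: deriv_eq D_def[symmetric])
    also have "\<dots> * real n = S 1 (D (r n)) / real d"
    proof -
      have n: "real n = S 1 (D (r n)) * Lam \<alpha> (h * r n)" using rn by (simp add: thetaP_def)
      show ?thesis unfolding n using L by simp
    qed
    finally have 1: "Delta \<alpha> (h * r n) / (real d * h * r n * deriv (Delta \<alpha>) (h * r n)) * real n = S 1 (D (r n)) / real d" .
    have 2: "S 0 (D (r n)) = S 1 (D (r n)) / real d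
        + 1 / h * (\<Sum>\<gamma> | \<gamma> dvd d. (1 / real \<gamma> - 1 / real d) * real (iota H (d div \<gamma>)) * D (r n) ^ \<gamma>)"
      unfolding S1 S_def sum_distrib_left sum_divide_distrib sum.distrib[symmetric]
      by (intro sum.cong refl) (use div_pos h in \<open>auto simp: w_def field_simps\<close>)
    show ?thesis
      unfolding 2 D_def[symmetric] using 1 by (simp add: algebra_simps D_def[symmetric])
  qed
  have "s \<sim>[sequentially] (\<lambda>n. 1 / (r n ^ n * sqrt (real d * (\<Prod>k=1..\<alpha> - 1. Delta k (h * r n))
           * (ln ^^ (\<alpha> - 1)) (1 / real d * ln (real n))))
         * exp ((ln (real n) - 1) * real n + S 0 (D (r n))))"
    by (rule asymp_equivI'[OF lim])
  also have "(\<lambda>n. 1 / (r n ^ n * sqrt (real d * (\<Prod>k=1..\<alpha> - 1. Delta k (h * r n))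
           * (ln ^^ (\<alpha> - 1)) (1 / real d * ln (real n))))
         * exp ((ln (real n) - 1) * real n + S 0 (D (r n)))) \<sim>[sequentially]
      (\<lambda>n. 1 / (r n ^ n * sqrt (real d * (\<Prod>k=1..\<alpha> - 1. Delta k (h * r n))
           * (ln ^^ (\<alpha> - 1)) (1 / real d * ln (real n))))
         * exp ((Delta \<alpha> (h * r n) / (real d * h * r n * deriv (Delta \<alpha>) (h * r n)) + ln (real n) - 1) * real n
        + 1 / h * (\<Sum>\<gamma> | \<gamma> dvd d. (1 / real \<gamma> - 1 / real d) * real (iota H (d div \<gamma>)) * Delta \<alpha> (h * r n) ^ \<gamma>)))"
    by (rule asymp_equiv_refl_ev) (use r in eventually_elim, simp only: exponent)
  finally show ?thesis
    using ex1 unfolding s_def r_def h_def d_def Let_def by blast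
qed

end
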